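(* Let $A$ be the preprojective algebra of type $\mathrm{E}_7$ over a field $\mathbb{F}$. With the elements and cochains defined in the context: (i) The elements in $\{z_0,z_8,z_{12}\}\cup\{\pi_i;\ 0\leq i\leq6\}$ form a basis of $\mathrm{HK}^0(A)$. (ii) If $\mathrm{char}(\mathbb{F})\notin\{2,3\}$, the elements in $\{\overline{\zeta}_\ell;\ \ell=0,8,12\}$ form a basis of $\mathrm{HK}^1(A)$. If $\mathrm{char}(\mathbb{F})=2$, the elements in $\{\overline{\zeta}_\ell;\ \ell=0,8,12\}\cup\{\overline{\rho}_3,\overline{\rho}_7,\overline{\rho}_{15}\}$ form a basis of $\mathrm{HK}^1(A)$. If $\mathrm{char}(\mathbb{F})=3$, the elements in $\{\overline{\zeta}_\ell;\ \ell=0,8,12\}\cup\{\overline{\rho}_5\}$ form a basis of $\mathrm{HK}^1(A)$. (iii) If $\mathrm{char}(\mathbb{F})\notin\{2,3\}$, the elements in $\{\overline{h}_j;\ 0\leq j\leq6\}$ form a basis of $\mathrm{HK}^2(A)$. If $\mathrm{char}(\mathbb{F})=2$, the elements in $\{\overline{h}_j;\ 0\leq j\leq6\}\cup\{\overline{\gamma}_4,\overline{\gamma}_8,\overline{\gamma}_{16}\}$ form a basis of $\mathrm{HK}^2(A)$. If $\mathrm{char}(\mathbb{F})=3$, the elements in $\{\overline{h}_j;\ 0\leq j\leq6\}\cup\{\overline{\gamma}_6\}$ form a basis of $\mathrm{HK}^2(A)$.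
   Context: The algebra. $\overline{Q}$ is the quiver with vertices $0,\ldots,6$ and arrows $a_0:0\to3$, $a_1:1\to2$, $a_2:2\to3$, $a_3:3\to4$, $a_4:4\to5$, $a_5:5\to6$, together with reversed arrows $a_i^*$; paths are written from right to left. $k=\bigoplus_i\mathbb{F}e_i$, $V=\mathbb{F}\overline{Q}_1$, $k^e=k\otimes_{\mathbb{F}}k$, $A=\mathbb{F}\overline{Q}/(R)$ with $R\subseteq V\otimes_kV$ spanned by $\sigma_0=-a_0^*a_0$, $\sigma_1=-a_1^*a_1$, $\sigma_2=a_1a_1^*-a_2^*a_2$, $\sigma_3=a_0a_0^*+a_2a_2^*-a_3^*a_3$, $\sigma_4=a_3a_3^*-a_4^*a_4$, $\sigma_5=a_4a_4^*-a_5^*a_5$, $\sigma_6=a_5a_5^*$. Put $c_0=a_0a_0^*$, $c_2=a_2a_2^*$, $c_3=a_3^*a_3$. Koszul cohomology. $W_0=k$, $W_1=V$, $W_p=\bigcap_{i+2+j=p}V^{\otimes_k i}\otimes_kR\otimes_kV^{\otimes_k j}$ for $p\geq2$ (so $W_2=R$); elements of $W_p$ are written $x_1\ldots x_p$ (a sum is understood). $\mathrm{HK}^\bullet(A)=H^\bullet(\mathrm{Hom}_{k^e}(W_\bullet,A),b_K)$ with $b_K(f)(x_1\ldots x_{p+1})=f(x_1\ldots x_p)x_{p+1}-(-1)^px_1f(x_2\ldots x_{p+1})$ for $f:W_p\to A$. $\mathrm{HK}^0(A)$ is identified with the centre of $A$. $\overline{f}$ denotes the class of a cocycle $f$; a cochain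 takes the value $0$ on arrows or relations where no value is specified. Elements of $A$. $\pi_0=(a_0^*c_3a_0)^4$, $\pi_1=-a_1^*a_2^*c_0c_3(c_3c_0)^2a_2a_1$, $\pi_2=-(a_2^*c_0a_2)^4$, $\pi_3=(c_3c_0)^3c_3^2$, $\pi_4=-(a_3c_0a_3^* )^4$, $\pi_5=-a_4a_3(c_3c_0)^3a_3^*a_4^*$, $\pi_6=-a_5a_4(a_3c_0a_3^* )^3a_4^*a_5^*$; $z_0=1$, $z_8=a_0^*c_2c_0c_2a_0-a_2^*c_2c_0c_2a_2-c_2c_3^2c_2+a_3c_0c_2c_0a_3^*-a_4a_3c_2^2a_3^*a_4^*+a_5a_4a_3c_0a_3^*a_4^*a_5^*$, $z_{12}=a_0^*(c_2c_0)^2c_2a_0+a_2^*(c_0c_2)^2c_0a_2-(c_3c_0c_3)^2+a_3c_3(c_0c_3)^2a_3^*$. Elements of $\mathrm{Hom}_{k^e}(V,A)$. $\zeta_\ell(a_i)=a_iz_\ell$ for all $i$ ($\ell\in\{0,8,12\}$); $\rho_3(a_2)=c_0a_2$, $\rho_3(a_3)=a_3c_3$, $\rho_3(a_4)=a_4a_3a_3^*$, $\rho_3(a_2^* )=a_2^*c_3$; $\rho_7(a_0)=c_3^3a_0+c_3c_0c_3a_0$, $\rho_7(a_3)=a_3c_3c_0c_3$, $\rho_7(a_3^* )=c_3c_0c_3a_3^*$; $\rho_{15}(a_0)=(c_2c_0)^3c_2a_0$, $\rho_{15}(a_0^* )=a_0^*c_2(c_0c_2)^3$; $\rho_5(a_0)=-c_2c_3a_0$,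 $\rho_5(a_2)=c_3c_0a_2$, $\rho_5(a_3)=a_3c_3^2$, $\rho_5(a_0^* )=a_0^*c_3^2$, $\rho_5(a_2^* )=-a_2^*c_2c_0$. Elements of $\mathrm{Hom}_{k^e}(R,A)$. $h_j(\sigma_i)=\delta_{ij}e_j$ ($0\leq j\leq6$); $\gamma_4(\sigma_0)=a_0^*c_3a_0$; $\gamma_8(\sigma_0)=a_0^*c_3^3a_0$; $\gamma_{16}(\sigma_0)=\pi_0$; $\gamma_6(\sigma_0)=a_0^*c_3^2a_0$. *)

theory Defs
  imports "Jordan_Normal_Form.VS_Connect" "HOL-Algebra.AbelCoset"
begin

section \<open>The double quiver and its path algebra\<close>

datatype vertex = V0 | V1 | V2 | V3 | V4 | V5 | V6

datatype edge = A0 | A1 | A2 | A3 | A4 | A5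

text \<open>\<^term>\<open>Fwd Ai\<close> is the arrow \<open>a\<^sub>i\<close> and \<^term>\<open>Rev Ai\<close> is the reversed arrow \<open>a\<^sub>i\<^sup>*\<close>.\<close>

datatype arrow = Fwd edge | Rev edge

fun edge_src :: "edge \<Rightarrow> vertex" where
  "edge_src A0 = V0" | "edge_src A1 = V1" | "edge_src A2 = V2"
| "edge_src A3 = V3" | "edge_src A4 = V4" | "edge_src A5 = V5"

fun edge_tgt :: "edge \<Rightarrow> vertex" where
  "edge_tgt A0 = V3" | "edge_tgt A1 = V2" | "edge_tgt A2 = V3"
| "edge_tgt A3 = V4" | "edge_tgt A4 = V5" | "edge_tgt A5 = V6"

fun src :: "arrow \<Rightarrow> vertex" where
  "src (Fwd i) = edge_src i" | "src (Rev i) = edge_tgt i"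

fun tgt :: "arrow \<Rightarrow> vertex" where
  "tgt (Fwd i) = edge_tgt i" | "tgt (Rev i) = edge_src i"

lemma UNIV_vertex: "(UNIV :: vertex set) = {V0, V1, V2, V3, V4, V5, V6}"
proof (rule UNIV_eq_I)
  fix x
  show "x \<in> {V0, V1, V2, V3, V4, V5, V6}"
    by (cases x) simp_all
qed

lemma UNIV_edge: "(UNIV :: edge set) = {A0, A1, A2, A3, A4, A5}"
proof (rule UNIV_eq_I)
  fix x
  show "x \<in> {A0, A1, A2, A3, A4, A5}"
    by (cases x) simp_all
qed

lemma UNIV_arrow: "(UNIV :: arrow set) = range Fwd \<union> range Rev"
proof (rule UNIV_eq_I)
  fix x
  show "x \<in> range Fwd \<union> range Rev"
    by (cases x) simp_all
qed

instance vertex :: finite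
  by standard (simp add: UNIV_vertex)

instance edge :: finite
  by standard (simp add: UNIV_edge)

instance arrow :: finite
  by standard (simp add: UNIV_arrow)

text \<open>Paths are written from right to left. A path \<open>x\<^sub>1 x\<^sub>2 \<dots> x\<^sub>n\<close> is encoded by its target
  vertex \<open>t\<close> and the list \<open>[x\<^sub>1, x\<^sub>2, \<dots>, x\<^sub>n]\<close>, so that \<open>tgt x\<^sub>1 = t\<close> and
  \<open>src x\<^sub>i = tgt x\<^sub>i\<^sub>+\<^sub>1\<close>; the trivial path at \<open>t\<close> is \<open>(t, [])\<close>.\<close>

primrec is_path :: "vertex \<Rightarrow> arrow list \<Rightarrow> bool" where
  "is_path t [] \<longleftrightarrow> True"
| "is_path t (x # xs) \<longleftrightarrow> tgt x = t \<and> is_path (src x) xs"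

primrec path_src :: "vertex \<Rightarrow> arrow list \<Rightarrow> vertex" where
  "path_src t [] = t"
| "path_src t (x # xs) = path_src (src x) xs"

lemma is_path_append: "is_path t (ys @ zs) \<longleftrightarrow> is_path t ys \<and> is_path (path_src t ys) zs"
  by (induction ys arbitrary: t) auto

lemma path_src_append: "path_src t (ys @ zs) = path_src (path_src t ys) zs"
  by (induction ys arbitrary: t) auto

typedef (overloaded) 'f path_alg =
  "{f :: vertex \<times> arrow list \<Rightarrow> 'f :: field.
      finite {p. f p \<noteq> 0} \<and> (\<forall>t xs. f (t, xs) \<noteq> 0 \<longrightarrow> is_path t xs)}"
  morphisms path_coeff Abs_path_alg
  by (rule exI[of _ "\<lambda>_. 0"]) simp

setup_lifting type_definition_path_alg

lemma path_alg_eqI: "(\<And>t xs. path_coeff f (t, xs) = path_coeff g (t, xs)) \<Longrightarrow> f = g"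
  by (simp add: path_coeff_inject[symmetric] fun_eq_iff)

lemma finite_splits: "finite {(ys, zs). ys @ zs = xs}"
proof -
  have "{(ys, zs). ys @ zs = xs} \<subseteq> (\<lambda>n. (take n xs, drop n xs)) ` {..length xs}"
  proof clarify
    fix ys zs
    show "(ys, zs) \<in> (\<lambda>n. (take n (ys @ zs), drop n (ys @ zs))) ` {..length (ys @ zs)}"
      by (rule image_eqI[of _ _ "length ys"]) auto
  qed
  then show ?thesis
    by (rule finite_subset) simp
qed

lemma finite_support_combine:
  assumes "h 0 0 = 0" "finite {p. f p \<noteq> 0}" "finite {p. g p \<noteq> 0}"
  shows "finite {p. h (f p) (g p) \<noteq> 0}"
proof -
  have "{p. h (f p) (g p) \<noteq> 0} \<subseteq> {p. f p \<noteq> 0} \<union> {p. g p \<noteq> 0}"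
    using assms(1) by auto
  then show ?thesis
    using assms(2,3) finite_subset by blast
qed

instantiation path_alg :: (field) ab_group_add
begin

lift_definition zero_path_alg :: "'a path_alg" is "\<lambda>_. 0"
  by simp

lift_definition plus_path_alg :: "'a path_alg \<Rightarrow> 'a path_alg \<Rightarrow> 'a path_alg" is
  "\<lambda>f g p. f p + g p"
proof (intro conjI allI impI; (elim conjE)?)
  fix f g :: "vertex \<times> arrow list \<Rightarrow> 'a" and t xs
  assume "\<forall>t xs. f (t, xs) \<noteq> 0 \<longrightarrow> is_path t xs" "\<forall>t xs. g (t, xs) \<noteq> 0 \<longrightarrow> is_path t xs"
    "f (t, xs) + g (t, xs) \<noteq> 0"
  then show "is_path t xs" by (cases "f (t, xs) = 0") auto
qed (rule finite_support_combine[of "(+)"]; simp)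

lift_definition uminus_path_alg :: "'a path_alg \<Rightarrow> 'a path_alg" is "\<lambda>f p. - f p"
  by simp

lift_definition minus_path_alg :: "'a path_alg \<Rightarrow> 'a path_alg \<Rightarrow> 'a path_alg" is
  "\<lambda>f g p. f p - g p"
proof (intro conjI allI impI; (elim conjE)?)
  fix f g :: "vertex \<times> arrow list \<Rightarrow> 'a" and t xs
  assume "\<forall>t xs. f (t, xs) \<noteq> 0 \<longrightarrow> is_path t xs" "\<forall>t xs. g (t, xs) \<noteq> 0 \<longrightarrow> is_path t xs"
    "f (t, xs) - g (t, xs) \<noteq> 0"
  then show "is_path t xs" by (cases "f (t, xs) = 0") auto
qed (rule finite_support_combine[of "(-)"]; simp)

instance
  by standard (transfer; simp add: fun_eq_iff)+

end

text \<open>The product is concatenation of paths, where \<open>p q\<close> is read from right to left and is zero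
  unless the source of \<open>p\<close> is the target of \<open>q\<close>.\<close>

instantiation path_alg :: (field) ring_1
begin

lift_definition one_path_alg :: "'a path_alg" is "\<lambda>(t, xs). if xs = [] then 1 else 0"
proof
  let ?S = "{p :: vertex \<times> arrow list. (case p of (t, xs) \<Rightarrow> if xs = [] then 1 else 0) \<noteq> (0 :: 'a)}"
  have "?S \<subseteq> UNIV \<times> {[]}"
    by (auto split: if_splits)
  then show "finite ?S"
    by (rule finite_subset) simp
qed auto

lift_definition times_path_alg :: "'a path_alg \<Rightarrow> 'a path_alg \<Rightarrow> 'a path_alg" is
  "\<lambda>f g (t, xs). \<Sum>(ys, zs) | ys @ zs = xs. f (t, ys) * g (path_src t ys, zs)"
proof (intro conjI allI impI; (elim conjE)?)
  fix f g :: "vertex \<times> arrow list \<Rightarrow> 'a"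
  assume f: "finite {p. f p \<noteq> 0}" "\<forall>t xs. f (t, xs) \<noteq> 0 \<longrightarrow> is_path t xs"
    and g: "finite {p. g p \<noteq> 0}" "\<forall>t xs. g (t, xs) \<noteq> 0 \<longrightarrow> is_path t xs"
  let ?h = "\<lambda>(t, xs). \<Sum>(ys, zs) | ys @ zs = xs. f (t, ys) * g (path_src t ys, zs)"
  have *: "\<exists>ys zs. ys @ zs = xs \<and> f (t, ys) \<noteq> 0 \<and> g (path_src t ys, zs) \<noteq> 0"
    if "?h (t, xs) \<noteq> 0" for t xs
  proof -
    from that obtain q where "q \<in> {(ys, zs). ys @ zs = xs}"
      "(case q of (ys, zs) \<Rightarrow> f (t, ys) * g (path_src t ys, zs)) \<noteq> 0"
      by (auto elim: sum.not_neutral_contains_not_neutral)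
    then show ?thesis by (cases q) auto
  qed
  have "{p. ?h p \<noteq> 0} \<subseteq>
      (\<lambda>((t, ys), (s, zs)). (t, ys @ zs)) ` ({p. f p \<noteq> 0} \<times> {p. g p \<noteq> 0})"
  proof
    fix p assume "p \<in> {p. ?h p \<noteq> 0}"
    moreover obtain t xs where p: "p = (t, xs)" by fastforce
    ultimately obtain ys zs where
      "ys @ zs = xs" "f (t, ys) \<noteq> 0" "g (path_src t ys, zs) \<noteq> 0"
      using * by blast
    then show "p \<in> (\<lambda>((t, ys), (s, zs)). (t, ys @ zs)) ` ({p. f p \<noteq> 0} \<times> {p. g p \<noteq> 0})"
      using p by (intro image_eqI[of _ _ "((t, ys), (path_src t ys, zs))"]) auto
  qed
  then show "finite {p. ?h p \<noteq> 0}"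
    by (rule finite_subset) (intro finite_imageI finite_cartesian_product f(1) g(1))
next
  fix f g :: "vertex \<times> arrow list \<Rightarrow> 'a" and t xs
  assume "\<forall>t xs. f (t, xs) \<noteq> 0 \<longrightarrow> is_path t xs" "\<forall>t xs. g (t, xs) \<noteq> 0 \<longrightarrow> is_path t xs"
    and "(case (t, xs) of (t, xs) \<Rightarrow>
      \<Sum>(ys, zs) | ys @ zs = xs. f (t, ys) * g (path_src t ys, zs)) \<noteq> 0"
  then show "is_path t xs"
    by (auto elim!: sum.not_neutral_contains_not_neutral simp: is_path_append)
qed

lemma path_coeff_times:
  "path_coeff (f * g) (t, xs) =
    (\<Sum>(ys, zs) | ys @ zs = xs. path_coeff f (t, ys) * path_coeff g (path_src t ys, zs))"
  by transfer simp

lemma sum_splits_Nil_left: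
  fixes xs :: "'c list" and h :: "'c list \<Rightarrow> 'b :: comm_monoid_add"
  shows "(\<Sum>(ys, zs) | ys @ zs = xs. if ys = [] then h zs else 0) = h xs"
proof -
  have "(\<Sum>(ys, zs) | ys @ zs = xs. if ys = [] then h zs else 0) =
      (\<Sum>(ys, zs)\<in>{([] :: 'c list, xs)}. if ys = [] then h zs else 0)"
    by (rule sum.mono_neutral_right) (auto simp: finite_splits split: if_splits)
  then show ?thesis by simp
qed

lemma sum_splits_Nil_right:
  fixes xs :: "'c list" and h :: "'c list \<Rightarrow> 'b :: comm_monoid_add"
  shows "(\<Sum>(ys, zs) | ys @ zs = xs. if zs = [] then h ys else 0) = h xs"
proof -
  have "(\<Sum>(ys, zs) | ys @ zs = xs. if zs = [] then h ys else 0) =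
      (\<Sum>(ys, zs)\<in>{(xs, [] :: 'c list)}. if zs = [] then h ys else 0)"
    by (rule sum.mono_neutral_right) (auto simp: finite_splits split: if_splits)
  then show ?thesis by simp
qed

lemma sum_splits_assoc:
  fixes xs :: "'c list" and h :: "'c list \<Rightarrow> 'c list \<Rightarrow> 'c list \<Rightarrow> 'b :: comm_monoid_add"
  shows "(\<Sum>(us, zs) | us @ zs = xs. \<Sum>(ws, ys) | ws @ ys = us. h ws ys zs) =
    (\<Sum>(ws, us) | ws @ us = xs. \<Sum>(ys, zs) | ys @ zs = us. h ws ys zs)"
proof -
  have "(\<Sum>(us, zs) | us @ zs = xs. \<Sum>(ws, ys) | ws @ ys = us. h ws ys zs) =
      (\<Sum>(q, r)\<in>(SIGMA q:{(us, zs). us @ zs = xs}. {(ws, ys). ws @ ys = fst q}).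
        h (fst r) (snd r) (snd q))"
    by (subst sum.Sigma[symmetric]) (auto simp: finite_splits intro!: sum.cong)
  also have "\<dots> = (\<Sum>(q, r)\<in>(SIGMA q:{(ws, us). ws @ us = xs}. {(ys, zs). ys @ zs = snd q}).
        h (fst q) (fst r) (snd r))"
    by (rule sum.reindex_bij_witness[where
          i = "\<lambda>(q, r). ((fst q @ fst r, snd r), (fst q, fst r))" and
          j = "\<lambda>(q, r). ((fst r, snd r @ snd q), (snd r, snd q))"]) auto
  also have "\<dots> = (\<Sum>(ws, us) | ws @ us = xs. \<Sum>(ys, zs) | ys @ zs = us. h ws ys zs)"
    by (subst sum.Sigma[symmetric]) (auto simp: finite_splits intro!: sum.cong)
  finally show ?thesis .
qed

instance
proof
  fix f g h :: "'a path_alg"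
  show "f * g * h = f * (g * h)"
  proof (rule path_alg_eqI)
    fix t xs
    have "path_coeff (f * g * h) (t, xs) =
      (\<Sum>(us, zs) | us @ zs = xs. \<Sum>(ws, ys) | ws @ ys = us.
        path_coeff f (t, ws) * path_coeff g (path_src t ws, ys) *
          path_coeff h (path_src (path_src t ws) ys, zs))"
      by (auto simp: path_coeff_times sum_distrib_right path_src_append intro!: sum.cong)
    also have "\<dots> = path_coeff (f * (g * h)) (t, xs)"
      unfolding sum_splits_assoc
      by (auto simp: path_coeff_times sum_distrib_left mult.assoc intro!: sum.cong)
    finally show "path_coeff (f * g * h) (t, xs) = path_coeff (f * (g * h)) (t, xs)" .
  qed
  have one: "path_coeff (1 :: 'a path_alg) (t, xs) = (if xs = [] then 1 else 0)" for t xs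
    by transfer simp
  show "1 * f = f"
  proof (rule path_alg_eqI)
    fix t xs
    have "path_coeff (1 * f) (t, xs) =
        (\<Sum>(ys, zs) | ys @ zs = xs. if ys = [] then path_coeff f (t, zs) else 0)"
      by (auto simp: path_coeff_times one intro!: sum.cong)
    then show "path_coeff (1 * f) (t, xs) = path_coeff f (t, xs)"
      by (simp add: sum_splits_Nil_left)
  qed
  show "f * 1 = f"
  proof (rule path_alg_eqI)
    fix t xs
    have "path_coeff (f * 1) (t, xs) =
        (\<Sum>(ys, zs) | ys @ zs = xs. if zs = [] then path_coeff f (t, ys) else 0)"
      by (auto simp: path_coeff_times one intro!: sum.cong)
    then show "path_coeff (f * 1) (t, xs) = path_coeff f (t, xs)"
      by (simp add: sum_splits_Nil_right)
  qed
  have plus: "path_coeff (x + y) p = path_coeff x p + path_coeff y p" for x y :: "'a path_alg" and p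
    by transfer simp
  show "(f + g) * h = f * h + g * h" "f * (g + h) = f * g + f * h"
    by (rule path_alg_eqI;
        simp add: path_coeff_times plus algebra_simps sum.distrib split_def)+
  have "path_coeff (0 :: 'a path_alg) (V0, []) \<noteq> path_coeff 1 (V0, [])"
    by (transfer, simp)
  then show "0 \<noteq> (1 :: 'a path_alg)"
    by metis
qed

end

lift_definition path_scale :: "'f :: field \<Rightarrow> 'f path_alg \<Rightarrow> 'f path_alg" is "\<lambda>c f p. c * f p"
proof (intro conjI allI impI; (elim conjE)?)
  fix c :: 'f and f :: "vertex \<times> arrow list \<Rightarrow> 'f"
  assume "finite {p. f p \<noteq> 0}"
  then show "finite {p. c * f p \<noteq> 0}"
    by (rule finite_subset[rotated]) auto
qed simp

lemma path_coeff_simps [simp]: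
  "path_coeff 0 p = 0"
  "path_coeff (f + g) p = path_coeff f p + path_coeff g p"
  "path_coeff (f - g) p = path_coeff f p - path_coeff g p"
  "path_coeff (- f) p = - path_coeff f p"
  "path_coeff (path_scale c f) p = c * path_coeff f p"
  by (transfer, simp)+

lemma path_coeff_one: "path_coeff 1 (t, xs) = (if xs = [] then 1 else 0)"
  by transfer simp

interpretation qalg: Vector_Spaces.vector_space path_scale
  by unfold_locales (rule path_alg_eqI; simp add: algebra_simps)+

lemma path_scale_mult [simp]:
  "path_scale c f * g = path_scale c (f * g)"
  "f * path_scale c g = path_scale c (f * g)"
  by (rule path_alg_eqI; simp add: path_coeff_times sum_distrib_left split_def ac_simps)+

lift_definition idem :: "vertex \<Rightarrow> 'f :: field path_alg" is
  "\<lambda>i p. if p = (i, []) then 1 else 0"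
  by simp

lift_definition arrow_elt :: "arrow \<Rightarrow> 'f :: field path_alg" is
  "\<lambda>x p. if p = (tgt x, [x]) then 1 else 0"
  by auto

abbreviation qar :: "edge \<Rightarrow> 'f :: field path_alg" where "qar i \<equiv> arrow_elt (Fwd i)"
abbreviation qst :: "edge \<Rightarrow> 'f :: field path_alg" where "qst i \<equiv> arrow_elt (Rev i)"


section \<open>The preprojective algebra of type \<open>E\<^sub>7\<close>\<close>

fun relator :: "vertex \<Rightarrow> 'f :: field path_alg" where
  "relator V0 = - (qst A0 * qar A0)"
| "relator V1 = - (qst A1 * qar A1)"
| "relator V2 = qar A1 * qst A1 - qst A2 * qar A2"
| "relator V3 = qar A0 * qst A0 + qar A2 * qst A2 - qst A3 * qar A3"
| "relator V4 = qar A3 * qst A3 - qst A4 * qar A4"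
| "relator V5 = qar A4 * qst A4 - qst A5 * qar A5"
| "relator V6 = qar A5 * qst A5"

definition rel_space :: "'f :: field path_alg set" where
  "rel_space = qalg.span (range relator)"

definition rel_ideal :: "'f :: field path_alg set" where
  "rel_ideal = qalg.span {x * r * y | x r y. r \<in> rel_space}"

lemma rel_ideal_subspace: "qalg.subspace rel_ideal"
  by (simp add: rel_ideal_def)

lemma rel_ideal_mult:
  assumes "f \<in> rel_ideal"
  shows "g * f \<in> rel_ideal" "f * g \<in> rel_ideal"
proof -
  have "g * f \<in> rel_ideal \<and> f * g \<in> rel_ideal"
    using assms unfolding rel_ideal_def
  proof (induction rule: qalg.span_induct_alt)
    case base
    then show ?case by (simp add: qalg.span_zero)
  next
    case (step c x y)
    then obtain u r v where x: "x = u * r * v" and r: "r \<in> rel_space" by blast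
    have "g * x = (g * u) * r * v" "x * g = u * r * (v * g)"
      by (simp_all add: x mult.assoc)
    then have "g * x \<in> qalg.span {x * r * y | x r y. r \<in> rel_space}"
      "x * g \<in> qalg.span {x * r * y | x r y. r \<in> rel_space}"
      using r by (auto intro!: qalg.span_base)
    then show ?case
      using step by (simp add: distrib_left distrib_right qalg.span_add qalg.span_scale)
  qed
  then show "g * f \<in> rel_ideal" "f * g \<in> rel_ideal" by auto
qed

quotient_type (overloaded) 'f preproj = "'f :: field path_alg" / "\<lambda>x y. x - y \<in> rel_ideal"
  morphisms preproj_rep preproj_class
proof (rule equivpI)
  show "reflp (\<lambda>x y :: 'f path_alg. x - y \<in> rel_ideal)"
    by (simp add: reflp_def qalg.subspace_0[OF rel_ideal_subspace])
  show "symp (\<lambda>x y :: 'f path_alg. x - y \<in> rel_ideal)"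
  proof (rule sympI)
    fix x y :: "'f path_alg" assume "x - y \<in> rel_ideal"
    from qalg.subspace_neg[OF rel_ideal_subspace this] show "y - x \<in> rel_ideal" by simp
  qed
  show "transp (\<lambda>x y :: 'f path_alg. x - y \<in> rel_ideal)"
  proof (rule transpI)
    fix x y z :: "'f path_alg" assume "x - y \<in> rel_ideal" "y - z \<in> rel_ideal"
    from qalg.subspace_add[OF rel_ideal_subspace this] show "x - z \<in> rel_ideal" by simp
  qed
qed

lemma preproj_class_eq_iff: "preproj_class f = preproj_class g \<longleftrightarrow> f - g \<in> rel_ideal"
  by (simp add: preproj.abs_eq_iff)

lemma rel_ideal_coeff_Nil:
  assumes "f \<in> rel_ideal"
  shows "path_coeff f (t, []) = 0"
proof -
  have Nil: "path_coeff (f * g) (t, []) = path_coeff f (t, []) * path_coeff g (t, [])"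
    for f g :: "'a path_alg" and t
  proof -
    have "{(ys, zs). ys @ zs = ([] :: arrow list)} = {([], [])}" by auto
    then show ?thesis by (simp add: path_coeff_times)
  qed
  have arrow: "path_coeff (arrow_elt x :: 'a path_alg) (t, []) = 0" for x t
    by transfer simp
  have relator: "path_coeff (relator i :: 'a path_alg) (t, []) = 0" for i t
    by (cases i) (simp_all add: Nil arrow)
  have rel: "path_coeff r (t, []) = 0" if "r \<in> rel_space" for r :: "'a path_alg" and t
    using that unfolding rel_space_def
    by (induction rule: qalg.span_induct_alt) (auto simp: relator)
  show ?thesis
    using assms unfolding rel_ideal_def
    by (induction rule: qalg.span_induct_alt) (auto simp: Nil rel)
qed

instantiation preproj :: (field) ring_1
begin

lift_definition zero_preproj :: "'a preproj" is 0 .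

lift_definition one_preproj :: "'a preproj" is 1 .

lift_definition plus_preproj :: "'a preproj \<Rightarrow> 'a preproj \<Rightarrow> 'a preproj" is "(+)"
proof -
  fix a b c d :: "'a path_alg" assume "a - b \<in> rel_ideal" "c - d \<in> rel_ideal"
  from qalg.subspace_add[OF rel_ideal_subspace this]
  show "a + c - (b + d) \<in> rel_ideal" by (simp add: algebra_simps)
qed

lift_definition uminus_preproj :: "'a preproj \<Rightarrow> 'a preproj" is uminus
proof -
  fix a b :: "'a path_alg" assume "a - b \<in> rel_ideal"
  from qalg.subspace_neg[OF rel_ideal_subspace this]
  show "- a - - b \<in> rel_ideal" by simp
qed

lift_definition minus_preproj :: "'a preproj \<Rightarrow> 'a preproj \<Rightarrow> 'a preproj" is "(-)"
proof -
  fix a b c d :: "'a path_alg" assume "a - b \<in> rel_ideal" "c - d \<in> rel_ideal"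
  from qalg.subspace_diff[OF rel_ideal_subspace this]
  show "a - c - (b - d) \<in> rel_ideal" by (simp add: algebra_simps)
qed

lift_definition times_preproj :: "'a preproj \<Rightarrow> 'a preproj \<Rightarrow> 'a preproj" is "(*)"
proof -
  fix a b c d :: "'a path_alg" assume "a - b \<in> rel_ideal" "c - d \<in> rel_ideal"
  then have "(a - b) * c + b * (c - d) \<in> rel_ideal"
    by (intro qalg.subspace_add[OF rel_ideal_subspace] rel_ideal_mult)
  then show "a * c - b * d \<in> rel_ideal" by (simp add: algebra_simps)
qed

instance
proof
  have "(0 :: 'a path_alg) - 1 \<notin> rel_ideal"
    using rel_ideal_coeff_Nil[of "(0 :: 'a path_alg) - 1" V0] by (auto simp: path_coeff_one)
  then show "(0 :: 'a preproj) \<noteq> 1"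
    by transfer
qed (transfer; simp add: algebra_simps qalg.subspace_0[OF rel_ideal_subspace])+

end

lift_definition preproj_scale :: "'f :: field \<Rightarrow> 'f preproj \<Rightarrow> 'f preproj" is path_scale
proof -
  fix c and a b :: "'f path_alg" assume "a - b \<in> rel_ideal"
  from qalg.subspace_scale[OF rel_ideal_subspace this, of c]
  show "path_scale c a - path_scale c b \<in> rel_ideal" by (simp add: qalg.scale_right_diff_distrib)
qed

interpretation palg: Vector_Spaces.vector_space preproj_scale
  by unfold_locales
    (transfer; simp add: algebra_simps qalg.subspace_0[OF rel_ideal_subspace] qalg.scale_right_distrib
      qalg.scale_left_distrib)+


section \<open>Koszul cohomology\<close>

text \<open>The tensor algebra \<open>T\<^sub>k(V)\<close> is the path algebra, and for homogeneous sub-bimodules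
  \<open>X \<subseteq> V\<^sup>\<otimes>\<^sup>m\<close> and \<open>Y \<subseteq> V\<^sup>\<otimes>\<^sup>n\<close> the space \<open>X \<otimes>\<^sub>k Y \<subseteq> V\<^sup>\<otimes>\<^sup>(\<^sup>m\<^sup>+\<^sup>n\<^sup>)\<close> is the span of the products.\<close>

definition tensor_k :: "'f :: field path_alg set \<Rightarrow> 'f path_alg set \<Rightarrow> 'f path_alg set" where
  "tensor_k X Y = qalg.span {x * y | x y. x \<in> X \<and> y \<in> Y}"

definition vertex_space :: "'f :: field path_alg set" where
  "vertex_space = qalg.span (range idem)"

definition arrow_space :: "'f :: field path_alg set" where
  "arrow_space = qalg.span (range arrow_elt)"

primrec tensor_power :: "nat \<Rightarrow> 'f :: field path_alg set" where
  "tensor_power 0 = vertex_space"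
| "tensor_power (Suc n) = tensor_k arrow_space (tensor_power n)"

definition koszul_space :: "nat \<Rightarrow> 'f :: field path_alg set" where
  "koszul_space p =
    (if p = 0 then vertex_space
     else if p = 1 then arrow_space
     else \<Inter> {tensor_k (tensor_power i) (tensor_k rel_space (tensor_power j)) | i j. i + 2 + j = p})"

text \<open>A map on \<open>W\<^sub>p\<close> is represented by its extension by zero to the whole path algebra.\<close>

type_synonym 'f cochain = "'f path_alg \<Rightarrow> 'f preproj"

definition cochains :: "nat \<Rightarrow> 'f :: field cochain set" where
  "cochains p = {f.
     (\<forall>w. w \<notin> koszul_space p \<longrightarrow> f w = 0) \<and>
     (\<forall>v \<in> koszul_space p. \<forall>w \<in> koszul_space p. f (v + w) = f v + f w) \<and>
     (\<forall>a \<in> vertex_space. \<forall>b \<in> vertex_space. \<forall>w \<in> koszul_space p.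
        f (a * w * b) = preproj_class a * f w * preproj_class b)}"

text \<open>Every element \<open>w\<close> of \<open>W\<^sub>p\<^sub>+\<^sub>1\<close> is \<open>\<Sum>\<^sub>x w\<^sub>x x = \<Sum>\<^sub>x x w'\<^sub>x\<close>, summed over the arrows \<open>x\<close>, for
  unique \<open>w\<^sub>x \<in> W\<^sub>p e\<^bsub>tgt x\<^esub>\<close> and \<open>w'\<^sub>x \<in> e\<^bsub>src x\<^esub> W\<^sub>p\<close>; these are \<^term>\<open>init_part x w\<close> and
  \<^term>\<open>tail_part x w\<close>. So \<open>\<Sum>\<^sub>x f(w\<^sub>x) x\<close> is what is written
  \<open>f(x\<^sub>1 \<dots> x\<^sub>p) x\<^sub>p\<^sub>+\<^sub>1\<close>, with the sum understood.\<close>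

lift_definition init_part :: "arrow \<Rightarrow> 'f :: field path_alg \<Rightarrow> 'f path_alg" is
  "\<lambda>x f (t, xs). f (t, xs @ [x])"
proof (intro conjI allI impI; (elim conjE)?)
  fix x and f :: "vertex \<times> arrow list \<Rightarrow> 'f"
  let ?\<phi> = "\<lambda>(t :: vertex, xs :: arrow list). (t, xs @ [x])"
  assume "finite {p. f p \<noteq> 0}"
  moreover have "inj ?\<phi>" by (auto intro: injI)
  ultimately have "finite (?\<phi> -` {p. f p \<noteq> 0})" by (rule finite_vimageI)
  then show "finite {p. (case p of (t, xs) \<Rightarrow> f (t, xs @ [x])) \<noteq> 0}"
    by (simp add: vimage_def case_prod_beta)
next
  fix x and f :: "vertex \<times> arrow list \<Rightarrow> 'f" and t xs
  assume "\<forall>t xs. f (t, xs) \<noteq> 0 \<longrightarrow> is_path t xs" "(case (t, xs) of (t, xs) \<Rightarrow> f (t, xs @ [x])) \<noteq> 0"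
  then have "is_path t (xs @ [x])" by simp
  then show "is_path t xs" by (simp add: is_path_append)
qed

lift_definition tail_part :: "arrow \<Rightarrow> 'f :: field path_alg \<Rightarrow> 'f path_alg" is
  "\<lambda>x f (s, xs). if s = src x then f (tgt x, x # xs) else 0"
proof (intro conjI allI impI; (elim conjE)?)
  fix x and f :: "vertex \<times> arrow list \<Rightarrow> 'f"
  assume fin: "finite {p. f p \<noteq> 0}"
  have "{p. (case p of (s, xs) \<Rightarrow> if s = src x then f (tgt x, x # xs) else 0) \<noteq> 0}
      \<subseteq> (\<lambda>(t, xs). (src x, tl xs)) ` {p. f p \<noteq> 0}"
    by (force split: if_splits)
  then show "finite {p. (case p of (s, xs) \<Rightarrow> if s = src x then f (tgt x, x # xs) else 0) \<noteq> 0}"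
    using fin finite_surj by blast
next
  fix x and f :: "vertex \<times> arrow list \<Rightarrow> 'f" and t xs
  assume "\<forall>t xs. f (t, xs) \<noteq> 0 \<longrightarrow> is_path t xs"
    and "(case (t, xs) of (s, xs) \<Rightarrow> if s = src x then f (tgt x, x # xs) else 0) \<noteq> 0"
  then show "is_path t xs" by (fastforce split: if_splits)
qed

lemma path_coeff_is_path: "path_coeff f (t, xs) \<noteq> 0 \<Longrightarrow> is_path t xs"
  by transfer simp

lemma path_coeff_sum: "path_coeff (\<Sum>i\<in>I. f i) p = (\<Sum>i\<in>I. path_coeff (f i) p)"
  by (induction I rule: infinite_finite_induct) simp_all

lemma path_coeff_arrow_elt:
  "path_coeff (arrow_elt x :: 'f :: field path_alg) (t, xs) = (if t = tgt x \<and> xs = [x] then 1 else 0)"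
  by transfer simp

lemma path_coeff_mult_arrow_elt:
  fixes f :: "'f :: field path_alg"
  shows "path_coeff (f * arrow_elt x) (t, xs @ [y]) =
      (if y = x \<and> path_src t xs = tgt x then path_coeff f (t, xs) else 0)"
    and "path_coeff (f * arrow_elt x) (t, []) = 0"
proof -
  have "path_coeff (f * arrow_elt x) (t, xs @ [y]) =
      (\<Sum>(us, vs)\<in>{(xs, [y])}. path_coeff f (t, us) * path_coeff (arrow_elt x) (path_src t us, vs))"
    unfolding path_coeff_times
    by (rule sum.mono_neutral_right) (auto simp: finite_splits path_coeff_arrow_elt split: if_splits)
  then show "path_coeff (f * arrow_elt x) (t, xs @ [y]) =
      (if y = x \<and> path_src t xs = tgt x then path_coeff f (t, xs) else 0)"
    by (auto simp: path_coeff_arrow_elt)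
  show "path_coeff (f * arrow_elt x) (t, []) = 0"
    by (auto simp: path_coeff_times path_coeff_arrow_elt intro!: sum.neutral)
qed

lemma path_coeff_arrow_elt_mult:
  fixes f :: "'f :: field path_alg"
  shows "path_coeff (arrow_elt x * f) (t, y # xs) =
      (if y = x \<and> t = tgt x then path_coeff f (src x, xs) else 0)"
    and "path_coeff (arrow_elt x * f) (t, []) = 0"
proof -
  have "path_coeff (arrow_elt x * f) (t, y # xs) =
      (\<Sum>(us, vs)\<in>{([y], xs)}. path_coeff (arrow_elt x) (t, us) * path_coeff f (path_src t us, vs))"
    unfolding path_coeff_times
    by (rule sum.mono_neutral_right) (auto simp: finite_splits path_coeff_arrow_elt split: if_splits)
  then show "path_coeff (arrow_elt x * f) (t, y # xs) =
      (if y = x \<and> t = tgt x then path_coeff f (src x, xs) else 0)"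
    by (auto simp: path_coeff_arrow_elt)
  show "path_coeff (arrow_elt x * f) (t, []) = 0"
    by (auto simp: path_coeff_times path_coeff_arrow_elt intro!: sum.neutral)
qed

lemma parts_decomposition:
  fixes w :: "'f :: field path_alg"
  assumes "\<And>t. path_coeff w (t, []) = 0"
  shows "w = (\<Sum>x\<in>UNIV. init_part x w * arrow_elt x)"
    and "w = (\<Sum>x\<in>UNIV. arrow_elt x * tail_part x w)"
proof -
  show "w = (\<Sum>x\<in>UNIV. init_part x w * arrow_elt x)"
  proof (rule path_alg_eqI)
    fix t xs
    show "path_coeff w (t, xs) = path_coeff (\<Sum>x\<in>UNIV. init_part x w * arrow_elt x) (t, xs)"
    proof (cases xs rule: rev_cases)
      case Nil
      then show ?thesis by (simp add: path_coeff_sum path_coeff_mult_arrow_elt assms)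
    next
      case (snoc us y)
      have "path_src t us = tgt y \<or> path_coeff w (t, us @ [y]) = 0"
        using path_coeff_is_path[of w t "us @ [y]"] unfolding is_path_append by force
      moreover have "path_coeff (init_part y w) (t, us) = path_coeff w (t, us @ [y])"
        by transfer simp
      moreover have "(\<Sum>x\<in>UNIV. path_coeff (init_part x w * arrow_elt x) (t, us @ [y])) =
          (\<Sum>x\<in>UNIV. if x = y then
            (if path_src t us = tgt y then path_coeff (init_part y w) (t, us) else 0) else 0)"
        by (rule sum.cong) (auto simp: path_coeff_mult_arrow_elt)
      ultimately show ?thesis
        by (auto simp: snoc path_coeff_sum)
    qed
  qed
  show "w = (\<Sum>x\<in>UNIV. arrow_elt x * tail_part x w)"
  proof (rule path_alg_eqI)
    fix t xs
    show "path_coeff w (t, xs) = path_coeff (\<Sum>x\<in>UNIV. arrow_elt x * tail_part x w) (t, xs)"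
    proof (cases xs)
      case Nil
      then show ?thesis by (simp add: path_coeff_sum path_coeff_arrow_elt_mult assms)
    next
      case (Cons y us)
      have "t = tgt y \<or> path_coeff w (t, y # us) = 0"
        using path_coeff_is_path[of w t "y # us"] unfolding is_path.simps by blast
      moreover have "path_coeff (tail_part y w) (src y, us) = path_coeff w (tgt y, y # us)"
        by transfer simp
      moreover have "(\<Sum>x\<in>UNIV. path_coeff (arrow_elt x * tail_part x w) (t, y # us)) =
          (\<Sum>x\<in>UNIV. if x = y then
            (if t = tgt y then path_coeff (tail_part y w) (src y, us) else 0) else 0)"
        by (rule sum.cong) (auto simp: path_coeff_arrow_elt_mult)
      ultimately show ?thesis
        by (auto simp: Cons path_coeff_sum)
    qed
  qed
qed

definition koszul_diff :: "nat \<Rightarrow> 'f :: field cochain \<Rightarrow> 'f cochain" where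
  "koszul_diff p f = (\<lambda>w.
     if w \<in> koszul_space (Suc p) then
       (\<Sum>x\<in>UNIV. f (init_part x w) * preproj_class (arrow_elt x)) -
       (-1) ^ p * (\<Sum>x\<in>UNIV. preproj_class (arrow_elt x) * f (tail_part x w))
     else 0)"

definition cocycles :: "nat \<Rightarrow> 'f :: field cochain set" where
  "cocycles p = {f \<in> cochains p. koszul_diff p f = (\<lambda>_. 0)}"

primrec coboundaries :: "nat \<Rightarrow> 'f :: field cochain set" where
  "coboundaries 0 = {\<lambda>_. 0}"
| "coboundaries (Suc p) = koszul_diff p ` cochains p"

text \<open>The ring multiplication and unit of a record used as a module play no role.\<close>

definition cocycle_module :: "nat \<Rightarrow> ('f :: field, 'f cochain) module" where
  "cocycle_module p = \<lparr>
     carrier = cocycles p,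
     mult = undefined,
     one = undefined,
     zero = (\<lambda>_. 0),
     add = (\<lambda>f g w. f w + g w),
     smult = (\<lambda>c f w. preproj_scale c (f w))\<rparr>"

definition quotient_module :: "('a, 'b) module \<Rightarrow> 'b set \<Rightarrow> ('a, 'b set) module" where
  "quotient_module M N = \<lparr>
     carrier = a_rcosets\<^bsub>M\<^esub> N,
     mult = undefined,
     one = undefined,
     zero = N,
     add = set_add M,
     smult = (\<lambda>c X. \<Union>x\<in>X. N +>\<^bsub>M\<^esub> (c \<odot>\<^bsub>M\<^esub> x))\<rparr>"

definition HK :: "nat \<Rightarrow> ('f :: field, 'f cochain set) module" where
  "HK p = quotient_module (cocycle_module p) (coboundaries p)"

definition cohomology_class :: "nat \<Rightarrow> 'f :: field cochain \<Rightarrow> 'f cochain set" where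
  "cohomology_class p f = coboundaries p +>\<^bsub>cocycle_module p\<^esub> f"

text \<open>Distinctness is required separately, since passing to a set of classes forgets repetitions.\<close>

definition HK_basis :: "nat \<Rightarrow> 'f :: field cochain list \<Rightarrow> bool" where
  "HK_basis p fs \<longleftrightarrow>
     distinct (map (cohomology_class p) fs) \<and>
     vectorspace.basis class_ring (HK p) (set (map (cohomology_class p) fs))"

text \<open>The linear map with values \<open>\<phi> i\<close> on the members \<open>b i\<close> of a linearly independent family,
  extended by zero outside the span of the family.\<close>

definition cochain_on :: "('i :: finite \<Rightarrow> 'f :: field path_alg) \<Rightarrow> ('i \<Rightarrow> 'f preproj) \<Rightarrow> 'f cochain" where
  "cochain_on b \<phi> = (\<lambda>w. \<Sum>i\<in>UNIV. preproj_scale (qalg.representation (range b) w (b i)) (\<phi> i))"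

lemma independent_family_by_coeff:
  fixes b :: "'i \<Rightarrow> 'f :: field path_alg"
  assumes "\<And>i j. path_coeff (b i) (p j) \<noteq> 0 \<longleftrightarrow> i = j"
  shows "inj b" "qalg.independent (range b)"
proof -
  show inj: "inj b"
    by (rule injI) (metis assms)
  show "qalg.independent (range b)"
  proof (rule ccontr)
    assume "\<not> qalg.independent (range b)"
    then obtain S u v where S: "finite S" "S \<subseteq> range b"
      and zero: "(\<Sum>w\<in>S. path_scale (u w) w) = 0" and v: "v \<in> S" "u v \<noteq> 0"
      unfolding qalg.dependent_explicit by blast
    obtain j where j: "v = b j" using S(2) v(1) by blast
    have "0 = path_coeff (\<Sum>w\<in>S. path_scale (u w) w) (p j)"
      by (simp add: zero)
    also have "\<dots> = (\<Sum>w\<in>S. u w * path_coeff w (p j))"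
      by (simp add: path_coeff_sum)
    also have "\<dots> = (\<Sum>w\<in>{v}. u w * path_coeff w (p j))"
    proof (rule sum.mono_neutral_right)
      show "\<forall>w\<in>S - {v}. u w * path_coeff w (p j) = 0"
      proof
        fix w assume w: "w \<in> S - {v}"
        then obtain i where i: "w = b i" using S(2) by blast
        with w j have "i \<noteq> j" by auto
        then show "u w * path_coeff w (p j) = 0" using assms[of i j] i by simp
      qed
    qed (use S v in auto)
    also have "\<dots> \<noteq> 0" using v(2) assms[of j j] j by simp
    finally show False by simp
  qed
qed

lemma independent_idem:
  "inj (idem :: _ \<Rightarrow> 'f :: field path_alg)"
  "qalg.independent (range (idem :: _ \<Rightarrow> 'f :: field path_alg))"
proof -
  have "path_coeff (idem i :: 'f path_alg) (j, []) \<noteq> 0 \<longleftrightarrow> i = j" for i j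
    by transfer auto
  then show "inj (idem :: _ \<Rightarrow> 'f path_alg)" "qalg.independent (range (idem :: _ \<Rightarrow> 'f path_alg))"
    by (rule independent_family_by_coeff)+
qed

lemma independent_arrow_elt:
  "inj (arrow_elt :: _ \<Rightarrow> 'f :: field path_alg)"
  "qalg.independent (range (arrow_elt :: _ \<Rightarrow> 'f :: field path_alg))"
proof -
  have "path_coeff (arrow_elt i :: 'f path_alg) (tgt j, [j]) \<noteq> 0 \<longleftrightarrow> i = j" for i j
    by (auto simp: path_coeff_arrow_elt)
  then show "inj (arrow_elt :: _ \<Rightarrow> 'f path_alg)"
    "qalg.independent (range (arrow_elt :: _ \<Rightarrow> 'f path_alg))"
    by (rule independent_family_by_coeff)+
qed

lemma independent_relator:
  "inj (relator :: _ \<Rightarrow> 'f :: field path_alg)"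
  "qalg.independent (range (relator :: _ \<Rightarrow> 'f :: field path_alg))"
proof -
  let ?p = "\<lambda>j. (j, case_vertex [Rev A0, Fwd A0] [Rev A1, Fwd A1] [Rev A2, Fwd A2] [Rev A3, Fwd A3]
    [Rev A4, Fwd A4] [Rev A5, Fwd A5] [Fwd A5, Rev A5] j)"
  have "path_coeff (relator i :: 'f path_alg) (?p j) \<noteq> 0 \<longleftrightarrow> i = j" for i j
    by (cases i; cases j) (simp_all add: path_coeff_arrow_elt_mult path_coeff_arrow_elt)
  then show "inj (relator :: _ \<Rightarrow> 'f path_alg)"
    "qalg.independent (range (relator :: _ \<Rightarrow> 'f path_alg))"
    by (rule independent_family_by_coeff)+
qed

lemma cochain_on_eq:
  assumes "inj b" "qalg.independent (range b)"
  shows "cochain_on b \<phi> (b i) = \<phi> i"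
proof -
  have "cochain_on b \<phi> (b i) = (\<Sum>j\<in>UNIV. if j = i then \<phi> j else 0)"
    unfolding cochain_on_def qalg.representation_basis[OF assms(2) rangeI[of b i]]
    by (rule sum.cong) (use assms(1) in \<open>auto dest: injD\<close>)
  then show ?thesis by simp
qed

text \<open>Evaluation at \<open>1 = e\<^sub>0 + \<dots> + e\<^sub>6\<close> identifies \<open>HK\<^sup>0(A)\<close> with the centre of \<open>A\<close>; the
  cocycle corresponding to a central element \<open>z\<close> sends \<open>e\<^sub>i\<close> to \<open>e\<^sub>i z\<close>.\<close>

definition central_cochain :: "'f :: field preproj \<Rightarrow> 'f cochain" where
  "central_cochain z = cochain_on idem (\<lambda>i. preproj_class (idem i) * z)"

abbreviation arrow_cochain :: "(arrow \<Rightarrow> 'f :: field preproj) \<Rightarrow> 'f cochain" where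
  "arrow_cochain \<equiv> cochain_on arrow_elt"

abbreviation relator_cochain :: "(vertex \<Rightarrow> 'f :: field preproj) \<Rightarrow> 'f cochain" where
  "relator_cochain \<equiv> cochain_on relator"


section \<open>Elements and cochains\<close>

abbreviation vx :: "vertex \<Rightarrow> 'f :: field preproj" where "vx i \<equiv> preproj_class (idem i)"
abbreviation ar :: "edge \<Rightarrow> 'f :: field preproj" where "ar i \<equiv> preproj_class (qar i)"
abbreviation st :: "edge \<Rightarrow> 'f :: field preproj" where "st i \<equiv> preproj_class (qst i)"

definition c0 :: "'f :: field preproj" where "c0 = ar A0 * st A0"
definition c2 :: "'f :: field preproj" where "c2 = ar A2 * st A2"
definition c3 :: "'f :: field preproj" where "c3 = st A3 * ar A3"

fun socle_elt :: "vertex \<Rightarrow> 'f :: field preproj" where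
  "socle_elt V0 = (st A0 * c3 * ar A0) ^ 4"
| "socle_elt V1 = - (st A1 * st A2 * c0 * c3 * (c3 * c0)\<^sup>2 * ar A2 * ar A1)"
| "socle_elt V2 = - ((st A2 * c0 * ar A2) ^ 4)"
| "socle_elt V3 = (c3 * c0) ^ 3 * c3\<^sup>2"
| "socle_elt V4 = - ((ar A3 * c0 * st A3) ^ 4)"
| "socle_elt V5 = - (ar A4 * ar A3 * (c3 * c0) ^ 3 * st A3 * st A4)"
| "socle_elt V6 = - (ar A5 * ar A4 * (ar A3 * c0 * st A3) ^ 3 * st A4 * st A5)"

definition z0 :: "'f :: field preproj" where "z0 = 1"

definition z8 :: "'f :: field preproj" where
  "z8 = st A0 * c2 * c0 * c2 * ar A0 - st A2 * c2 * c0 * c2 * ar A2 - c2 * c3\<^sup>2 * c2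
      + ar A3 * c0 * c2 * c0 * st A3 - ar A4 * ar A3 * c2\<^sup>2 * st A3 * st A4
      + ar A5 * ar A4 * ar A3 * c0 * st A3 * st A4 * st A5"

definition z12 :: "'f :: field preproj" where
  "z12 = st A0 * (c2 * c0)\<^sup>2 * c2 * ar A0 + st A2 * (c0 * c2)\<^sup>2 * c0 * ar A2 - (c3 * c0 * c3)\<^sup>2
      + ar A3 * c3 * (c0 * c3)\<^sup>2 * st A3"

definition zeta :: "'f :: field preproj \<Rightarrow> 'f cochain" where
  "zeta z = arrow_cochain (case_arrow (\<lambda>i. ar i * z) (\<lambda>_. 0))"

definition rho3 :: "'f :: field cochain" where
  "rho3 = arrow_cochain ((\<lambda>_. 0)(
     Fwd A2 := c0 * ar A2,
     Fwd A3 := ar A3 * c3,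
     Fwd A4 := ar A4 * ar A3 * st A3,
     Rev A2 := st A2 * c3))"

definition rho7 :: "'f :: field cochain" where
  "rho7 = arrow_cochain ((\<lambda>_. 0)(
     Fwd A0 := c3 ^ 3 * ar A0 + c3 * c0 * c3 * ar A0,
     Fwd A3 := ar A3 * c3 * c0 * c3,
     Rev A3 := c3 * c0 * c3 * st A3))"

definition rho15 :: "'f :: field cochain" where
  "rho15 = arrow_cochain ((\<lambda>_. 0)(
     Fwd A0 := (c2 * c0) ^ 3 * c2 * ar A0,
     Rev A0 := st A0 * c2 * (c0 * c2) ^ 3))"

definition rho5 :: "'f :: field cochain" where
  "rho5 = arrow_cochain ((\<lambda>_. 0)(
     Fwd A0 := - (c2 * c3 * ar A0),
     Fwd A2 := c3 * c0 * ar A2,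
     Fwd A3 := ar A3 * c3\<^sup>2,
     Rev A0 := st A0 * c3\<^sup>2,
     Rev A2 := - (st A2 * c2 * c0)))"

definition h_cochain :: "vertex \<Rightarrow> 'f :: field cochain" where
  "h_cochain j = relator_cochain ((\<lambda>_. 0)(j := vx j))"

definition gamma4 :: "'f :: field cochain" where
  "gamma4 = relator_cochain ((\<lambda>_. 0)(V0 := st A0 * c3 * ar A0))"

definition gamma8 :: "'f :: field cochain" where
  "gamma8 = relator_cochain ((\<lambda>_. 0)(V0 := st A0 * c3 ^ 3 * ar A0))"

definition gamma16 :: "'f :: field cochain" where
  "gamma16 = relator_cochain ((\<lambda>_. 0)(V0 := socle_elt V0))"

definition gamma6 :: "'f :: field cochain" where
  "gamma6 = relator_cochain ((\<lambda>_. 0)(V0 := st A0 * c3\<^sup>2 * ar A0))"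

end

theory Submission imports Defs begin

text \<open>The algebra has a basis of 399 paths, closed under removing the leftmost arrow, such that an arrow
  times a basis path is a signed sum of basis paths. These products hold in \<open>A\<close> because each of them is
  an integer combination of relations times shorter basis paths. Conversely they define a left module in which
  the relations act as zero, so the basis paths are independent. Since \<open>W\<^sub>3 = 0\<close>, the Koszul complex up to degree
  two amounts to two integer matrices. Bases of cohomology are then certified by integral contracting
  homotopies: \<open>N = d Y + G C + P d\<close> with \<open>C G = N\<close> and \<open>C d = 0\<close>, where the columns of \<open>G\<close> are the given
  cocycles and \<open>N\<close> is invertible in the field; in characteristics 2 and 3 the identities hold modulo the
  characteristic.\<close>

section \<open>Sparse integer combinations\<close>

text \<open>The differentials raise the path length of values by one and have integer entries, so
  the complex splits by length into finite integral pieces. The characteristic enters through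
  torsion: in degree two the pieces of lengths 4, 8, 16 are killed by 2 and the piece of length 6 is
  killed by 3. Modulo 2 or 3 such torsion yields a class in degree two and a partner in degree one:
  \<open>gamma4\<close>, \<open>gamma8\<close>, \<open>gamma16\<close> belong with
  \<open>rho3\<close>, \<open>rho7\<close>, \<open>rho15\<close>, and \<open>gamma6\<close> with
  \<open>rho5\<close>. An integral identity with factor \<open>N\<close> settles all characteristics
  prime to \<open>N\<close> at once, where a rank would have to be recomputed for each.

  Only left multiplication is tabulated. Right multiplication is forced by associativity, because
  every basis path is built from a trivial path by adding arrows on the left. For the same reason a
  left module suffices for independence: each basis path acts on the trivial path at its source and
  returns itself.

  The number 399 is n h (h + 1) / 6 with n = 7 vertices and Coxeter number h = 18; the longest
  nonzero paths have length h - 2 = 16.\<close>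

type_synonym 'k comb = "('k \<times> int) list"

fun cscale :: "int \<Rightarrow> 'k comb \<Rightarrow> 'k comb" where
  "cscale a [] = []"
| "cscale a ((k, b) # c) = (k, a * b) # cscale a c"

fun cbind :: "('k \<Rightarrow> 'm comb) \<Rightarrow> 'k comb \<Rightarrow> 'm comb" where
  "cbind f [] = []"
| "cbind f ((k, a) # c) = cscale a (f k) @ cbind f c"

fun cins :: "'k \<Rightarrow> int \<Rightarrow> 'k comb \<Rightarrow> 'k comb" where
  "cins k a [] = [(k, a)]"
| "cins k a ((m, b) # c) = (if m = k then (m, b + a) # c else (m, b) # cins k a c)"

fun cnorm :: "'k comb \<Rightarrow> 'k comb" where
  "cnorm [] = []"
| "cnorm ((k, a) # c) = cins k a (cnorm c)"

text \<open>Divisibility by \<open>0\<close> is vanishing, so one test serves for identities over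
  the integers and modulo a characteristic.\<close>

definition czero :: "int \<Rightarrow> 'k comb \<Rightarrow> bool" where
  "czero p c \<longleftrightarrow> list_all (\<lambda>(k, a). p dvd a) (cnorm c)"

text \<open>Path indices are positive, so the sign of an entry is free to carry the coefficient;
  coefficients of larger absolute value are written by repeating the entry.\<close>

fun signed :: "(int \<Rightarrow> 'k) \<Rightarrow> int list \<Rightarrow> 'k comb" where
  "signed q [] = []"
| "signed q (n # ns) = (if n < 0 then (q (- n), -1) else (q n, 1)) # signed q ns"

abbreviation "scomb \<equiv> signed (\<lambda>n. n)"

lemma signed_Nil_iff [simp]: "signed q ns = [] \<longleftrightarrow> ns = []"
  by (cases ns) auto

text \<open>With \<open>t\<close> a constant and \<open>l\<close> its expansion, a table becomes one
  lookup equation per key, and no computation has to scan the list.\<close>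

lemma map_of_eqs:
  assumes "l = t" "distinct (map fst t)"
  shows "list_all (\<lambda>(k, v). map_of t k = Some v) l"
  using assms by (auto simp: list_all_iff)

text \<open>An entry \<open>(k, c, w)\<close> of the table of an arrow \<open>x\<close> says that \<open>x\<close> times the basis path \<open>k\<close> is
  the signed sum \<open>c\<close> of basis paths. It is again a basis path if \<open>w\<close> is empty; otherwise the product
  follows from the relations at the target of \<open>x\<close> times the basis paths in \<open>w\<close>.\<close>

type_synonym left_table = "(int \<times> int list \<times> int list) list"

text \<open>Entries are (path, source, target, leftmost arrow and remaining path).\<close>

type_synonym path_table = "(int \<times> vertex \<times> vertex \<times> (arrow \<times> int) option) list"

abbreviation (input) "a0 \<equiv> Fwd A0"
abbreviation (input) "b0 \<equiv> Rev A0"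
abbreviation (input) "a1 \<equiv> Fwd A1"
abbreviation (input) "b1 \<equiv> Rev A1"
abbreviation (input) "a2 \<equiv> Fwd A2"
abbreviation (input) "b2 \<equiv> Rev A2"
abbreviation (input) "a3 \<equiv> Fwd A3"
abbreviation (input) "b3 \<equiv> Rev A3"
abbreviation (input) "a4 \<equiv> Fwd A4"
abbreviation (input) "b4 \<equiv> Rev A4"
abbreviation (input) "a5 \<equiv> Fwd A5"
abbreviation (input) "b5 \<equiv> Rev A5"

section \<open>Left multiplication of the basis paths by the twelve arrows\<close>

definition la0 :: "left_table" where
  "la0 = [
(1,[2],[]),(8,[12],[]),(15,[20],[]),(23,[29],[]),(32,[36],[]),(39,[44],[]),(49,[],[48]),(53,[55],[]),
(63,[66],[]),(68,[72],[]),(79,[81],[]),(87,[90],[]),(93,[99],[]),(103,[110],[]),(114,[121],[]),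
(115,[122],[]),(125,[132],[]),(136,[141],[]),(144,[148],[]),(151,[155],[]),(158,[165],[]),
(170,[179],[]),(171,[180],[]),(185,[196],[]),(186,[197],[]),(202,[212],[]),(203,[213],[]),
(218,[227],[]),(219,[228],[]),(232,[239],[]),(242,[245],[]),(249,[254],[]),(257,[263],[]),
(267,[275],[]),(268,[276],[]),(280,[288],[]),(293,[301],[]),(294,[302],[]),(305,[311],[]),
(314,[318],[]),(326,[330],[]),(332,[337],[]),(340,[345],[]),(349,[355],[]),(358,[363],[]),
(365,[368],[]),(377,[380],[]),(385,[388],[]),(394,[396],[])]"

definition la1 :: "left_table" where
  "la1 = [
(5,[9],[]),(19,[24],[]),(28,[33],[]),(43,[46],[]),(50,[51],[]),(60,[64],[]),(71,[74],[]),
(83,[],[82]),(85,[88],[]),(98,[104],[]),(109,[116],[]),(120,[126],[]),(131,[137],[]),(147,[149],[]),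
(154,[159],[]),(164,[172],[]),(178,[187],[]),(194,[204],[]),(195,[205],[]),(211,[220],[]),
(226,[233],[]),(238,[243],[]),(253,[258],[]),(262,[269],[]),(274,[281],[]),(287,[295],[]),
(300,[306],[]),(310,[315],[]),(329,[333],[]),(336,[341],[]),(354,[359],[]),(362,[366],[]),
(379,[381],[]),(392,[395],[])]"

definition la2_0 :: "left_table" where
  "la2_0 = [
(3,[6],[]),(9,[13],[]),(16,[21],[]),(24,[30],[]),(25,[-29,-30],[20,21]),(33,[37],[]),
(40,[44],[36,-37]),(46,[48],[]),(51,[52],[]),(57,[61],[]),(64,[67],[]),(69,[-72],[66,67]),
(74,[77],[]),(82,[],[81]),(84,[86],[]),(88,[91],[]),(94,[100],[]),(104,[111],[]),(105,[112],[]),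
(116,[123],[]),(117,[-121,-122,-123],[110,111,112]),(126,[133],[]),(127,[132,-133],[-122,-123]),
(137,[142],[]),(145,[148],[141,-142]),(149,[],[148]),(152,[156],[]),(159,[166],[]),(160,[167],[]),
(172,[181],[]),(173,[182],[]),(187,[198],[]),(188,[199],[]),
(189,[-196,-197,-198,-199],[179,180,181,182]),(204,[214],[]),(205,[215],[]),
(206,[212,213,-215],[-197,-198,-199]),(220,[229],[]),(221,[227,229],[-213,-214]),(233,[240],[]),
(234,[239],[228,-229]),(243,[-245],[239,240]),(250,[255],[]),(258,[264],[]),(259,[265],[]),
(269,[277],[]),(270,[-275,-276,-277],[263,264,265]),(281,[289],[]),(282,[290],[]),(295,[303],[]),
(296,[301,302,303],[288,-289,-290]),(306,[312],[]),(307,[311,312],[-302,-303]),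
(315,[-318],[311,312]),(327,[331],[]),(333,[338],[]),(334,[-337,-338],[330,331]),(341,[346],[]),
(350,[356],[]),(359,[364],[])]"

definition la2_1 :: "left_table" where
  "la2_1 = [
(360,[363,364],[355,-356]),(366,[-368],[363,364]),(378,[-380],[376]),(381,[383],[]),(390,[393],[]),
(395,[-396],[393])]"

definition la2 :: "left_table" where
  "la2 = la2_0 @ la2_1"

definition la3_0 :: "left_table" where
  "la3_0 = [
(2,[4],[]),(6,[10],[]),(12,[17],[]),(13,[18],[]),(20,[26],[]),(21,[-26],[17,18]),(29,[34],[]),
(30,[35],[]),(36,[41],[]),(37,[41],[-34,-35]),(44,[47],[]),(48,[],[47]),(52,[54],[]),(55,[58],[]),
(61,[65],[]),(66,[70],[]),(67,[-70],[65]),(72,[75],[]),(77,[80],[]),(81,[],[80]),(86,[89],[]),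
(90,[95],[]),(91,[96],[]),(99,[106],[]),(100,[107],[]),(110,[118],[]),(111,[119],[]),
(112,[-118,-119],[106,107]),(121,[128],[]),(122,[129],[]),(123,[-129],[-118,-119]),(132,[138],[]),
(133,[139],[]),(141,[146],[]),(142,[146],[138,-139]),(148,[],[146]),(150,[153],[]),(155,[161],[]),
(156,[162],[]),(165,[174],[]),(166,[175],[]),(167,[176],[]),(179,[190],[]),(180,[191],[]),
(181,[192],[]),(182,[-190,-191,-192],[174,175,176]),(196,[207],[]),(197,[208],[]),(198,[209],[]),
(199,[-208,-209],[-191,-192]),(212,[222],[]),(213,[223],[]),(214,[-223],[-208,-209]),(215,[224],[]),
(227,[235],[]),(228,[236],[]),(229,[236],[222,223,-224]),(239,[244],[]),(240,[-244],[235,236]),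
(245,[],[-244])]"

definition la3_1 :: "left_table" where
  "la3_1 = [
(247,[251],[]),(254,[260],[]),(255,[261],[]),(263,[271],[]),(264,[272],[]),
(265,[-271,-272],[260,261]),(275,[283],[]),(276,[284],[]),(277,[285],[]),(288,[297],[]),
(289,[298],[]),(290,[297,-298],[-284,-285]),(301,[308],[]),(302,[309],[]),(303,[-309],[297,-298]),
(311,[316],[]),(312,[-316],[308]),(318,[320],[]),(324,[328],[]),(330,[335],[]),(331,[-335],[328]),
(337,[342],[]),(338,[343],[]),(345,[351],[]),(346,[352],[]),(355,[361],[]),(356,[361],[351,-352]),
(363,[367],[]),(364,[-367],[361]),(368,[370],[]),(376,[],[375]),(380,[382],[]),(383,[386],[]),
(388,[391],[]),(393,[],[391]),(396,[397],[])]"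

definition la3 :: "left_table" where
  "la3 = la3_0 @ la3_1"

definition la4_0 :: "left_table" where
  "la4_0 = [
(4,[7],[]),(10,[14],[]),(17,[22],[]),(18,[-22],[14]),(26,[31],[]),(34,[38],[]),(35,[-38],[-31]),
(41,[45],[]),(47,[],[45]),(54,[56],[]),(58,[62],[]),(65,[],[62]),(70,[73],[]),(75,[78],[]),
(80,[],[-78]),(89,[92],[]),(95,[101],[]),(96,[102],[]),(106,[113],[]),(107,[-113],[101,102]),
(118,[124],[]),(119,[-124],[-113]),(128,[134],[]),(129,[135],[]),(138,[143],[]),(139,[143],[-134]),
(146,[],[143]),(153,[157],[]),(161,[168],[]),(162,[169],[]),(174,[183],[]),(175,[184],[]),
(176,[-183,-184],[168,169]),(190,[200],[]),(191,[201],[]),(192,[-201],[-183,-184]),(207,[216],[]),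
(208,[217],[]),(209,[-217],[-200]),(222,[230],[]),(223,[231],[]),(224,[230,231],[-216]),
(235,[241],[]),(236,[-241],[230]),(244,[],[-241]),(246,[248],[]),(251,[256],[]),(260,[266],[]),
(261,[-266],[256]),(271,[278],[]),(272,[279],[]),(283,[291],[]),(284,[292],[]),
(285,[-292],[-278,-279]),(297,[304],[]),(298,[304],[-291]),(308,[],[304]),(309,[313],[]),
(316,[319],[]),(320,[],[-319])]"

definition la4_1 :: "left_table" where
  "la4_1 = [
(322,[325],[]),(328,[],[325]),(335,[339],[]),(342,[347],[]),(343,[348],[]),(351,[357],[]),
(352,[357],[-347,-348]),(361,[],[357]),(367,[369],[]),(370,[372],[]),(375,[],[374]),(382,[384],[]),
(386,[389],[]),(391,[],[389]),(397,[398],[])]"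

definition la4 :: "left_table" where
  "la4 = la4_0 @ la4_1"

definition la5 :: "left_table" where
  "la5 = [
(7,[11],[]),(14,[],[11]),(22,[27],[]),(31,[],[-27]),(38,[42],[]),(45,[],[-42]),(56,[59],[]),
(62,[],[59]),(73,[76],[]),(78,[],[-76]),(92,[97],[]),(101,[108],[]),(102,[-108],[97]),
(113,[],[-108]),(124,[130],[]),(134,[],[-130]),(135,[140],[]),(143,[],[-140]),(157,[163],[]),
(168,[177],[]),(169,[-177],[163]),(183,[193],[]),(184,[-193],[-177]),(200,[],[-193]),(201,[210],[]),
(216,[],[-210]),(217,[225],[]),(230,[],[-225]),(231,[237],[]),(241,[],[-237]),(248,[252],[]),
(256,[],[252]),(266,[273],[]),(278,[286],[]),(279,[-286],[-273]),(291,[],[-286]),(292,[299],[]),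
(304,[],[-299]),(313,[317],[]),(319,[],[-317]),(321,[323],[]),(325,[],[323]),(339,[344],[]),
(347,[353],[]),(348,[-353],[-344]),(357,[],[-353]),(369,[371],[]),(372,[],[-371]),(374,[],[373]),
(384,[387],[]),(389,[],[-387]),(398,[399],[])]"

definition lb0_0 :: "left_table" where
  "lb0_0 = [
(2,[],[-1]),(6,[8],[]),(12,[],[-8]),(13,[15],[]),(20,[],[-15]),(21,[23],[]),(29,[],[-23]),
(30,[32],[]),(36,[],[-32]),(37,[39],[]),(44,[],[-39]),(48,[49],[]),(52,[53],[]),(55,[],[-53]),
(61,[63],[]),(66,[],[-63]),(67,[68],[]),(72,[],[-68]),(77,[79],[]),(81,[],[-79]),(86,[87],[]),
(90,[],[-87]),(91,[93],[]),(99,[],[-93]),(100,[103],[]),(110,[],[-103]),(111,[114],[]),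
(112,[115],[]),(121,[],[-114]),(122,[],[-115]),(123,[125],[]),(132,[],[-125]),(133,[136],[]),
(141,[],[-136]),(142,[144],[]),(148,[],[-144]),(150,[151],[]),(155,[],[-151]),(156,[158],[]),
(165,[],[-158]),(166,[170],[]),(167,[171],[]),(179,[],[-170]),(180,[],[-171]),(181,[185],[]),
(182,[186],[]),(196,[],[-185]),(197,[],[-186]),(198,[202],[]),(199,[203],[]),(212,[],[-202]),
(213,[],[-203]),(214,[218],[]),(215,[219],[]),(227,[],[-218]),(228,[],[-219]),(229,[232],[]),
(239,[],[-232]),(240,[242],[]),(245,[],[-242])]"

definition lb0_1 :: "left_table" where
  "lb0_1 = [
(247,[249],[]),(254,[],[-249]),(255,[257],[]),(263,[],[-257]),(264,[267],[]),(265,[268],[]),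
(275,[],[-267]),(276,[],[-268]),(277,[280],[]),(288,[],[-280]),(289,[293],[]),(290,[294],[]),
(301,[],[-293]),(302,[],[-294]),(303,[305],[]),(311,[],[-305]),(312,[314],[]),(318,[],[-314]),
(324,[326],[]),(330,[],[-326]),(331,[332],[]),(337,[],[-332]),(338,[340],[]),(345,[],[-340]),
(346,[349],[]),(355,[],[-349]),(356,[358],[]),(363,[],[-358]),(364,[365],[]),(368,[],[-365]),
(376,[377],[]),(380,[],[-377]),(383,[385],[]),(388,[],[-385]),(393,[394],[]),(396,[],[-394])]"

definition lb0 :: "left_table" where
  "lb0 = lb0_0 @ lb0_1"

definition lb1_0 :: "left_table" where
  "lb1_0 = [
(3,[5],[]),(9,[],[-5]),(16,[19],[]),(24,[],[-19]),(25,[28],[]),(33,[],[-28]),(40,[43],[]),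
(46,[],[-43]),(51,[],[-50]),(57,[60],[]),(64,[],[-60]),(69,[71],[]),(74,[],[-71]),(82,[83],[]),
(84,[85],[]),(88,[],[-85]),(94,[98],[]),(104,[],[-98]),(105,[109],[]),(116,[],[-109]),(117,[120],[]),
(126,[],[-120]),(127,[131],[]),(137,[],[-131]),(145,[147],[]),(149,[],[-147]),(152,[154],[]),
(159,[],[-154]),(160,[164],[]),(172,[],[-164]),(173,[178],[]),(187,[],[-178]),(188,[194],[]),
(189,[195],[]),(204,[],[-194]),(205,[],[-195]),(206,[211],[]),(220,[],[-211]),(221,[226],[]),
(233,[],[-226]),(234,[238],[]),(243,[],[-238]),(250,[253],[]),(258,[],[-253]),(259,[262],[]),
(269,[],[-262]),(270,[274],[]),(281,[],[-274]),(282,[287],[]),(295,[],[-287]),(296,[300],[]),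
(306,[],[-300]),(307,[310],[]),(315,[],[-310]),(327,[329],[]),(333,[],[-329]),(334,[336],[]),
(341,[],[-336]),(350,[354],[]),(359,[],[-354])]"

definition lb1_1 :: "left_table" where
  "lb1_1 = [
(360,[362],[]),(366,[],[-362]),(378,[379],[]),(381,[],[-379]),(390,[392],[]),(395,[],[-392])]"

definition lb1 :: "left_table" where
  "lb1 = lb1_0 @ lb1_1"

definition lb2_0 :: "left_table" where
  "lb2_0 = [
(2,[3],[]),(6,[9],[-3]),(12,[16],[]),(13,[],[-9]),(20,[25],[]),(21,[24],[-16]),(29,[-33],[24,25]),
(30,[],[-24]),(36,[40],[]),(37,[],[-33]),(44,[46],[-40]),(48,[],[-46]),(52,[],[-51]),(55,[57],[]),
(61,[64],[-57]),(66,[69],[]),(67,[],[-64]),(72,[-74],[69]),(77,[],[-74]),(81,[82],[]),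
(86,[88],[-84]),(90,[94],[]),(91,[],[-88]),(99,[105],[]),(100,[104],[-94]),(110,[117],[]),
(111,[],[-104]),(112,[116],[-105]),(121,[127],[]),(122,[-126,-127],[116,117]),(123,[],[-116]),
(132,[137],[-126,-127]),(133,[],[-126]),(141,[145],[]),(142,[],[-137]),(148,[149],[-145]),
(150,[152],[]),(155,[160],[]),(156,[159],[-152]),(165,[173],[]),(166,[],[-159]),(167,[172],[-160]),
(179,[188],[]),(180,[189],[]),(181,[],[-172]),(182,[187],[-173]),(196,[206],[]),
(197,[-204,-205,-206],[187,188,189]),(198,[],[-187]),(199,[204],[-188]),(212,[221],[]),
(213,[220,-221],[-205,-206]),(214,[],[-204]),(215,[],[-205]),(227,[233],[220,-221]),(228,[234],[]),
(229,[],[-220]),(239,[243],[-234]),(240,[],[-233]),(245,[],[243])]"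

definition lb2_1 :: "left_table" where
  "lb2_1 = [
(247,[250],[]),(254,[259],[]),(255,[258],[-250]),(263,[270],[]),(264,[],[-258]),(265,[269],[-259]),
(275,[282],[]),(276,[-281,-282],[269,270]),(277,[],[-269]),(288,[296],[]),(289,[],[-281]),
(290,[295],[-282]),(301,[307],[]),(302,[306,-307],[295,-296]),(303,[],[-295]),(311,[315],[306,-307]),
(312,[],[-306]),(318,[],[315]),(324,[327],[]),(330,[334],[]),(331,[333],[-327]),
(337,[-341],[333,334]),(338,[],[-333]),(345,[350],[]),(346,[],[-341]),(355,[360],[]),
(356,[359],[-350]),(363,[366],[359,-360]),(364,[],[-359]),(368,[],[366]),(376,[378],[]),
(380,[-381],[378]),(383,[],[-381]),(388,[390],[]),(393,[395],[-390]),(396,[],[395])]"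

definition lb2 :: "left_table" where
  "lb2 = lb2_0 @ lb2_1"

definition lb3_0 :: "left_table" where
  "lb3_0 = [
(4,[6],[-2]),(10,[12,13],[-6]),(17,[21],[-12]),(18,[20],[-13]),(26,[-29,-30],[21]),(34,[-37],[-29]),
(35,[36],[-30]),(41,[44],[-37]),(47,[48],[-44]),(54,[55],[-52]),(58,[61],[-55]),(65,[66,67],[-61]),
(70,[-72],[67]),(75,[-77],[-72]),(80,[81],[-77]),(89,[90,91],[-86]),(95,[100],[-90]),(96,[99],[-91]),
(106,[112],[-99]),(107,[110,111],[-100]),(118,[-121,-122,-123],[111,112]),(119,[121],[-111]),
(128,[132,-133],[-121,-122,-123]),(129,[-132],[123]),(138,[142],[-132]),(139,[141],[-133]),
(146,[148],[-142]),(153,[155,156],[-150]),(161,[167],[-155]),(162,[165,166],[-156]),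
(174,[182],[-165]),(175,[179],[-166]),(176,[180,181],[-167]),(190,[199],[-179]),
(191,[-196,-197,-198,-199],[179,181,182]),(192,[196],[-181]),
(207,[212,213,-215],[-196,-197,-198,-199]),(208,[-212,-213,-214],[198,199]),(209,[212],[-198]),
(222,[227,229],[-212,-213,-214]),(223,[-227],[214]),(224,[228],[-215]),(235,[240],[-227]),
(236,[239],[-229]),(244,[-245],[240]),(246,[247],[]),(251,[254,255],[-247]),(260,[265],[-254]),
(261,[263,264],[-255]),(271,[-275,-276,-277],[264,265]),(272,[275],[-264]),(283,[290],[-275]),
(284,[-289,-290],[-276]),(285,[288],[-277]),(297,[301,302,303],[-289,-290]),(298,[301],[-289]),
(308,[311,312],[-301,-302,-303]),(309,[-311],[303]),(316,[-318],[312]),(320,[],[-318])]"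

definition lb3_1 :: "left_table" where
  "lb3_1 = [
(322,[324],[]),(328,[330,331],[-324]),(335,[-337,-338],[331]),(342,[-346],[-337]),(343,[345],[-338]),
(351,[356],[-345]),(352,[355],[-346]),(361,[363,364],[-356]),(367,[-368],[364]),(370,[],[-368]),
(375,[376],[]),(382,[-383],[-380]),(386,[388],[-383]),(391,[393],[-388]),(397,[],[-396])]"

definition lb3 :: "left_table" where
  "lb3 = lb3_0 @ lb3_1"

definition lb4 :: "left_table" where
  "lb4 = [
(7,[10],[-4]),(14,[17,18],[-10]),(22,[-26],[18]),(31,[-34,-35],[-26]),(38,[-41],[35]),
(45,[47],[-41]),(56,[58],[-54]),(62,[65],[-58]),(73,[-75],[-70]),(78,[-80],[-75]),(92,[95,96],[-89]),
(101,[107],[-95]),(102,[106],[-96]),(113,[-118,-119],[107]),(124,[-128],[119]),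
(134,[138,-139],[-128]),(135,[-138],[-129]),(143,[146],[-139]),(157,[161,162],[-153]),
(168,[176],[-161]),(169,[174,175],[-162]),(183,[-190,-191,-192],[175,176]),(184,[190],[-175]),
(200,[-208,-209],[-190,-191,-192]),(201,[-207],[192]),(216,[222,223,-224],[-207]),(217,[-222],[209]),
(230,[235,236],[223,-224]),(231,[-235],[-223]),(241,[-244],[236]),(248,[251],[-246]),
(256,[260,261],[-251]),(266,[-271,-272],[261]),(278,[-283,-284,-285],[-271]),(279,[283],[-272]),
(291,[297,-298],[-283,-284,-285]),(292,[-297],[285]),(304,[308],[-298]),(313,[-316],[-309]),
(319,[-320],[-316]),(321,[322],[]),(325,[328],[-322]),(339,[-342,-343],[-335]),(347,[-352],[-342]),
(348,[351],[-343]),(357,[361],[-352]),(369,[-370],[-367]),(372,[],[-370]),(374,[375],[]),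
(384,[-386],[-382]),(389,[391],[-386]),(398,[],[-397])]"

definition lb5 :: "left_table" where
  "lb5 = [
(11,[14],[-7]),(27,[-31],[-22]),(42,[-45],[-38]),(59,[62],[-56]),(76,[-78],[-73]),
(97,[101,102],[-92]),(108,[-113],[102]),(130,[-134],[-124]),(140,[-143],[-135]),
(163,[168,169],[-157]),(177,[-183,-184],[169]),(193,[-200],[184]),(210,[-216],[-201]),
(225,[-230],[-217]),(237,[-241],[-231]),(252,[256],[-248]),(273,[-278,-279],[-266]),
(286,[-291],[279]),(299,[-304],[-292]),(317,[-319],[-313]),(323,[325],[-321]),
(344,[-347,-348],[-339]),(353,[-357],[348]),(371,[-372],[-369]),(373,[374],[]),(387,[-389],[-384]),
(399,[],[-398])]"

fun ltab :: "arrow \<Rightarrow> left_table" where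
  "ltab (Fwd A0) = la0"
| "ltab (Fwd A1) = la1"
| "ltab (Fwd A2) = la2"
| "ltab (Fwd A3) = la3"
| "ltab (Fwd A4) = la4"
| "ltab (Fwd A5) = la5"
| "ltab (Rev A0) = lb0"
| "ltab (Rev A1) = lb1"
| "ltab (Rev A2) = lb2"
| "ltab (Rev A3) = lb3"
| "ltab (Rev A4) = lb4"
| "ltab (Rev A5) = lb5"

section \<open>The tree of basis paths\<close>

text \<open>Left multiplication keeps the starting vertex, so the paths are numbered in blocks by
  it. The block sizes 49, 34, 66, 96, 75, 52, 27 are the dimensions of the left ideals
  \<open>A e_j\<close>.\<close>

definition root :: "int \<Rightarrow> vertex" where
  "root m = (if m < 50 then V0
     else if m < 84 then V1
     else if m < 150 then V2
     else if m < 246 then V3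
     else if m < 321 then V4
     else if m < 373 then V5
     else V6)"

text \<open>Entries with empty witness list are the edges of the tree: there \<open>c\<close> is a
  single path, whose parent is \<open>k\<close>. The other entries define no new path.\<close>

fun path_rows :: "arrow \<Rightarrow> left_table \<Rightarrow> path_table" where
  "path_rows x [] = []"
| "path_rows x ((k, c, []) # l) = (hd c, root (hd c), tgt x, Some (x, k)) # path_rows x l"
| "path_rows x ((k, c, _ # _) # l) = path_rows x l"

definition ptable :: path_table where
  "ptable = [(1, V0, V0, None), (50, V1, V1, None), (84, V2, V2, None), (150, V3, V3, None),
     (246, V4, V4, None), (321, V5, V5, None), (373, V6, V6, None)]
     @ concat (map (\<lambda>x. path_rows x (ltab x))
     [Fwd A0, Fwd A1, Fwd A2, Fwd A3, Fwd A4, Fwd A5, Rev A0, Rev A1, Rev A2, Rev A3, Rev A4, Rev A5])"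

text \<open>A missing entry stands for a non-composable pair, since \<open>check_key\<close> demands
  an entry for every arrow leaving the end of a basis path.\<close>

definition lmul :: "arrow \<Rightarrow> int \<Rightarrow> int comb" where
  "lmul x k = (case map_of (ltab x) k of None \<Rightarrow> [] | Some (c, w) \<Rightarrow> scomb c)"

definition reducible :: "arrow \<Rightarrow> int \<Rightarrow> bool" where
  "reducible x k = (case map_of (ltab x) k of None \<Rightarrow> False | Some (c, w) \<Rightarrow> w \<noteq> [])"

definition psrc :: "int \<Rightarrow> vertex" where
  "psrc k = (case map_of ptable k of None \<Rightarrow> V0 | Some (j, i, p) \<Rightarrow> j)"

definition ptgt :: "int \<Rightarrow> vertex" where
  "ptgt k = (case map_of ptable k of None \<Rightarrow> V0 | Some (j, i, p) \<Rightarrow> i)"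

definition parent :: "int \<Rightarrow> (arrow \<times> int) option" where
  "parent k = (case map_of ptable k of None \<Rightarrow> None | Some (j, i, p) \<Rightarrow> p)"

definition is_key :: "int \<Rightarrow> bool" where
  "is_key k \<longleftrightarrow> map_of ptable k \<noteq> None"

fun rel_terms :: "vertex \<Rightarrow> (int \<times> arrow \<times> arrow) list" where
  "rel_terms V0 = [(-1, Rev A0, Fwd A0)]"
| "rel_terms V1 = [(-1, Rev A1, Fwd A1)]"
| "rel_terms V2 = [(1, Fwd A1, Rev A1), (-1, Rev A2, Fwd A2)]"
| "rel_terms V3 = [(1, Fwd A0, Rev A0), (1, Fwd A2, Rev A2), (-1, Rev A3, Fwd A3)]"
| "rel_terms V4 = [(1, Fwd A3, Rev A3), (-1, Rev A4, Fwd A4)]"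
| "rel_terms V5 = [(1, Fwd A4, Rev A4), (-1, Rev A5, Fwd A5)]"
| "rel_terms V6 = [(1, Fwd A5, Rev A5)]"

fun rel_left :: "int \<Rightarrow> (int \<times> arrow \<times> arrow) list \<Rightarrow> int comb" where
  "rel_left k [] = []"
| "rel_left k ((s, y, z) # r) = cscale s (cbind (lmul y) (lmul z k)) @ rel_left k r"

text \<open>If the product of a pair is itself a basis path, nothing has to be proved about it. The
  remaining pairs are collected with their multiplicities, so that their cancellation can be tested
  formally.\<close>

fun red_pairs :: "int \<Rightarrow> arrow \<Rightarrow> int comb \<Rightarrow> (arrow \<times> int) comb" where
  "red_pairs s y [] = []"
| "red_pairs s y ((m, a) # c) =
    (if reducible y m then ((y, m), s * a) # red_pairs s y c else red_pairs s y c)"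

fun rel_pairs :: "int \<Rightarrow> (int \<times> arrow \<times> arrow) list \<Rightarrow> (arrow \<times> int) comb" where
  "rel_pairs k [] = []"
| "rel_pairs k ((s, y, z) # r) = red_pairs s y (lmul z k) @ rel_pairs k r"

section \<open>Finite checks on the tables\<close>

definition keys_ok :: "vertex \<Rightarrow> vertex \<Rightarrow> int comb \<Rightarrow> bool" where
  "keys_ok i j c \<longleftrightarrow> list_all (\<lambda>(k, a). is_key k \<and> ptgt k = i \<and> psrc k = j) c"

text \<open>In the sum of the relation multiples named by \<open>w\<close>, all reducible pairs must
  cancel except \<open>(x, k)\<close>, which keeps coefficient one. The bound \<open>m < k\<close>
  makes this elimination a well-founded recursion on paths.\<close>

fun check_left :: "arrow \<Rightarrow> int \<Rightarrow> int comb \<Rightarrow> int comb \<Rightarrow> bool" where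
  "check_left x k c w \<longleftrightarrow> is_key k \<and> src x = ptgt k \<and> keys_ok (tgt x) (psrc k) c \<and>
     (if w = [] then (case c of [] \<Rightarrow> False | (m, a) # c' \<Rightarrow> c' = [] \<and> a = 1 \<and> parent m = Some (x, k))
      else keys_ok (tgt x) (psrc k) w \<and> list_all (\<lambda>(m, a). m < k) w \<and>
        czero 0 (((x, k), -1) # cbind (\<lambda>m. rel_pairs m (rel_terms (tgt x))) w))"

fun out_arrows :: "vertex \<Rightarrow> arrow list" where
  "out_arrows V0 = [Fwd A0]"
| "out_arrows V1 = [Fwd A1]"
| "out_arrows V2 = [Fwd A2, Rev A1]"
| "out_arrows V3 = [Fwd A3, Rev A0, Rev A2]"
| "out_arrows V4 = [Fwd A4, Rev A3]"
| "out_arrows V5 = [Fwd A5, Rev A4]"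
| "out_arrows V6 = [Rev A5]"

fun in_arrows :: "vertex \<Rightarrow> arrow list" where
  "in_arrows V0 = [Rev A0]"
| "in_arrows V1 = [Rev A1]"
| "in_arrows V2 = [Fwd A1, Rev A2]"
| "in_arrows V3 = [Fwd A0, Fwd A2, Rev A3]"
| "in_arrows V4 = [Fwd A3, Rev A4]"
| "in_arrows V5 = [Fwd A4, Rev A5]"
| "in_arrows V6 = [Fwd A5]"

fun ekey :: "vertex \<Rightarrow> int" where
  "ekey V0 = 1" | "ekey V1 = 50" | "ekey V2 = 84" | "ekey V3 = 150" | "ekey V4 = 246" | "ekey V5 = 321" | "ekey V6 = 373"

text \<open>The last conjunct is the module axiom: the relation at the end of the path acts on it as
  zero. The other conjuncts give totality of the tables and the chain of parents down to a trivial
  path.\<close>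

fun check_key :: "int \<Rightarrow> vertex \<Rightarrow> vertex \<Rightarrow> (arrow \<times> int) option \<Rightarrow> bool" where
  "check_key k j i p \<longleftrightarrow> 0 < k \<and>
     list_all (\<lambda>x. map_of (ltab x) k \<noteq> None) (out_arrows i) \<and>
     (case p of None \<Rightarrow> i = j \<and> k = ekey j
      | Some (x, m) \<Rightarrow> 0 < m \<and> m < k \<and> is_key m \<and> src x = ptgt m \<and> tgt x = i \<and> psrc m = j \<and> lmul x m = [(k, 1)]) \<and>
     czero 0 (rel_left k (rel_terms i))"

text \<open>Associativity dictates the recursion: if \<open>k\<close> is \<open>x m\<close>, then
  \<open>k y = x (m y)\<close>. At a trivial path the value is \<open>y\<close> itself, read as
  \<open>y\<close> times the trivial path at its source. The bounds on \<open>m\<close> secure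
  termination and hold for every basis path.\<close>

function rmul :: "arrow \<Rightarrow> int \<Rightarrow> int comb" where
  "rmul y k = (if tgt y = psrc k then
     (case parent k of None \<Rightarrow> lmul y (ekey (src y))
      | Some (x, m) \<Rightarrow> if 0 < m \<and> m < k then cnorm (cbind (lmul x) (rmul y m)) else [])
     else [])"
  by auto
termination
  by (relation "measure (\<lambda>(y, k). nat k)") auto

declare rmul.simps [simp del]

declare check_left.simps [simp del] check_key.simps [simp del]

lemmas tab_defs = la0_def la1_def la2_0_def la2_1_def la2_def la3_0_def la3_1_def la3_def la4_0_def la4_1_def la4_def la5_def lb0_0_def lb0_1_def lb0_def lb1_0_def lb1_1_def lb1_def lb2_0_def lb2_1_def lb2_def lb3_0_def lb3_1_def lb3_def lb4_def lb5_def

declare ltab.simps [simp del]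

text \<open>Comparing neighbours only makes the test of sortedness, and with it that of
  distinctness, linear in the length of a table.\<close>

lemma sorted_wrt_less_Cons2:
  "sorted_wrt (<) ((a :: int) # b # xs) \<longleftrightarrow> a < b \<and> sorted_wrt (<) (b # xs)"
  by auto

lemma ltab_sorted: "sorted_wrt (<) (map fst (ltab x))"
proof (cases x)
  case (Fwd e)
  then show ?thesis
    by (cases e) (simp_all add: tab_defs ltab.simps sorted_wrt_less_Cons2 sorted_wrt1 del: sorted_wrt.simps(2))
next
  case (Rev e)
  then show ?thesis
    by (cases e) (simp_all add: tab_defs ltab.simps sorted_wrt_less_Cons2 sorted_wrt1 del: sorted_wrt.simps(2))
qed

lemmas ptable_rows = ptable_def[unfolded ltab.simps tab_defs append.simps list.map concat.simps,
  simplified path_rows.simps root_def append.simps list.sel list.distinct tgt.simps edge_tgt.simps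
    src.simps edge_src.simps simp_thms if_True if_False rel_simps]

lemma ptable_distinct: "distinct (map fst ptable)"
  by (simp add: ptable_rows)

lemma strict_sorted_imp_distinct: "sorted_wrt (<) (xs :: int list) \<Longrightarrow> distinct xs"
  by (simp add: strict_sorted_iff)

lemmas ltab_eqs = ltab.simps[symmetric, THEN map_of_eqs, OF strict_sorted_imp_distinct[OF ltab_sorted],
  unfolded tab_defs append.simps list.pred_inject prod.case]

lemmas ptab_eqs = map_of_eqs[OF ptable_rows[symmetric] ptable_distinct,
  unfolded list.pred_inject prod.case]

lemmas table_simps = ltab_eqs ptab_eqs lmul_def rmul.simps reducible_def psrc_def ptgt_def
  parent_def is_key_def keys_ok_def czero_def check_left.simps check_key.simps

context
  notes table_simps [simp]
begin

lemma check_left_all: "list_all (\<lambda>(k, c, w). check_left x k (scomb c) (scomb w)) (ltab x)"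
proof (cases x)
  case (Fwd e)
  then show ?thesis
    by (cases e; simp only: ltab.simps tab_defs append.simps; simp)
next
  case (Rev e)
  then show ?thesis
    by (cases e; simp only: ltab.simps tab_defs append.simps; simp)
qed

lemma check_key_all: "list_all (\<lambda>(k, j, i, p). check_key k j i p) ptable"
  by (simp only: ptable_rows; simp)

lemma ekey_key: "is_key (ekey i)" "parent (ekey i) = None" "psrc (ekey i) = i" "ptgt (ekey i) = i"
  by (cases i; simp)+

end

section \<open>Evaluation of sparse combinations\<close>

definition lc :: "('k \<Rightarrow> 'a :: ring_1) \<Rightarrow> 'k comb \<Rightarrow> 'a" where
  "lc g c = (\<Sum>(k, a)\<leftarrow>c. of_int a * g k)"

lemma lc_simps [simp]:
  "lc g [] = 0"
  "lc g ((k, a) # c) = of_int a * g k + lc g c"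
  "lc g (c @ d) = lc g c + lc g d"
  by (simp_all add: lc_def)

lemma lc_cong: "(\<And>k a. (k, a) \<in> set c \<Longrightarrow> g k = h k) \<Longrightarrow> lc g c = lc h c"
  by (induction c) (auto, metis)

lemma lc_zero [simp]: "lc (\<lambda>k. 0) c = 0"
  by (induction c) auto

lemma lc_cscale [simp]: "lc g (cscale a c) = of_int a * lc g c"
  by (induction a c rule: cscale.induct) (auto simp: algebra_simps)

lemma lc_cbind [simp]: "lc g (cbind f c) = lc (\<lambda>k. lc g (f k)) c"
  by (induction f c rule: cbind.induct) auto

lemma lc_cins: "lc g (cins k a c) = of_int a * g k + lc g c"
  by (induction k a c rule: cins.induct) (auto simp: algebra_simps)

lemma lc_cnorm: "lc g (cnorm c) = lc g c"
  by (induction c rule: cnorm.induct) (auto simp: lc_cins)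

text \<open>This carries the integer tests into characteristic \<open>p\<close>: every collected
  coefficient is a multiple of \<open>p\<close>, which is zero in the target ring.\<close>

lemma lc_czero:
  fixes g :: "'k \<Rightarrow> 'a :: ring_1"
  assumes "czero p c" and p: "of_int p = (0 :: 'a)"
  shows "lc g c = 0"
proof -
  have "lc g d = 0" if "list_all (\<lambda>(k, a). p dvd a) d" for d
    using that p by (induction d) (auto elim!: dvdE)
  then show ?thesis
    using assms(1) unfolding czero_def by (metis lc_cnorm)
qed

lemma lc_mult_left: "u * lc g c = lc (\<lambda>k. u * g k) c"
  by (induction c) (auto simp: algebra_simps mult_of_int_commute)

lemma lc_add: "lc (\<lambda>k. g k + h k) c = lc g c + lc h c"
  by (induction c) (auto simp: algebra_simps)

lemma lc_diff: "lc (\<lambda>k. g k - h k) c = lc g c - lc h c"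
  by (induction c) (auto simp: algebra_simps)

section \<open>Path algebra and quotient\<close>

lemma preproj_class_hom:
  "preproj_class (f + g) = preproj_class f + preproj_class g"
  "preproj_class (f - g) = preproj_class f - preproj_class g"
  "preproj_class (f * g) = preproj_class f * preproj_class g"
  "preproj_class (- f) = - preproj_class f"
  "preproj_class 0 = 0"
  "preproj_class 1 = 1"
  "preproj_class (path_scale c f) = preproj_scale c (preproj_class f)"
  by (simp_all add: plus_preproj.abs_eq minus_preproj.abs_eq times_preproj.abs_eq
      uminus_preproj.abs_eq zero_preproj.abs_eq one_preproj.abs_eq preproj_scale.abs_eq)

lemma preproj_scale_mult [simp]:
  "preproj_scale c a * b = preproj_scale c (a * b)"
  "a * preproj_scale c b = preproj_scale c (a * b)"
  by (transfer; simp add: qalg.subspace_0[OF rel_ideal_subspace])+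

abbreviation arr :: "arrow \<Rightarrow> 'f :: field preproj" where "arr x \<equiv> preproj_class (arrow_elt x)"

lemma path_coeff_idem: "path_coeff (idem i) (t, xs) = (if t = i \<and> xs = [] then 1 else 0)"
  by transfer auto

lemma path_coeff_idem_mult:
  "path_coeff (idem i * f) (t, xs) = (if t = i then path_coeff f (t, xs) else 0)"
proof -
  have "path_coeff (idem i * f) (t, xs) =
      (\<Sum>(ys, zs) | ys @ zs = xs. if ys = [] then (if t = i then path_coeff f (t, zs) else 0) else 0)"
    by (auto simp: path_coeff_times path_coeff_idem intro!: sum.cong)
  then show ?thesis
    by (simp only: sum_splits_Nil_left)
qed

lemma path_coeff_mult_idem:
  "path_coeff (f * idem i) (t, xs) = (if path_src t xs = i then path_coeff f (t, xs) else 0)"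
proof -
  have "path_coeff (f * idem i) (t, xs) =
      (\<Sum>(ys, zs) | ys @ zs = xs. if zs = [] then (if path_src t ys = i then path_coeff f (t, ys) else 0) else 0)"
    by (auto simp: path_coeff_times path_coeff_idem intro!: sum.cong)
  then show ?thesis
    by (simp only: sum_splits_Nil_right)
qed

lemma idem_mult:
  "idem i * idem j = (if i = j then idem i else 0)"
  "idem i * arrow_elt x = (if i = tgt x then arrow_elt x else 0)"
  "arrow_elt x * idem i = (if i = src x then arrow_elt x else 0)"
  by (rule path_alg_eqI; auto simp: path_coeff_idem_mult path_coeff_mult_idem path_coeff_idem
      path_coeff_arrow_elt)+

lemma vx_mult:
  "vx i * vx j = (if i = j then vx i else 0)"
  "vx i * arr x = (if i = tgt x then arr x else 0)"
  "arr x * vx i = (if i = src x then arr x else 0)"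
  unfolding preproj_class_hom(3)[symmetric] idem_mult by (simp_all add: preproj_class_hom)

lemma vx_mult_assoc:
  "vx i * (vx j * a) = (if i = j then vx i * a else 0)"
  "vx i * (arr x * a) = (if i = tgt x then arr x * a else 0)"
  "arr x * (vx i * a) = (if i = src x then arr x * a else 0)"
  unfolding mult.assoc[symmetric] vx_mult by simp_all

lemma sum_idem: "(\<Sum>i\<in>UNIV. idem i) = 1"
  by (rule path_alg_eqI) (simp add: path_coeff_sum path_coeff_idem path_coeff_one)

lemma path_coeff_parts:
  "path_coeff (init_part x f) (t, xs) = path_coeff f (t, xs @ [x])"
  "path_coeff (tail_part x f) (t, xs) = (if t = src x then path_coeff f (tgt x, x # xs) else 0)"
  by (transfer; simp)+

text \<open>Paths are extended on the left, matching the direction of the tables. The induction runs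
  on a strict bound for the lengths of the paths in the support, which exists because the support is
  finite.\<close>

lemma path_alg_induct [case_names zero add scale idem arrow]:
  fixes P :: "'f :: field path_alg \<Rightarrow> bool"
  assumes zero: "P 0" and add: "\<And>f g. P f \<Longrightarrow> P g \<Longrightarrow> P (f + g)"
    and scale: "\<And>c f. P f \<Longrightarrow> P (path_scale c f)"
    and idem: "\<And>i. P (idem i)" and arrow: "\<And>x f. P f \<Longrightarrow> P (arrow_elt x * f)"
  shows "P f"
proof -
  have sum: "P (\<Sum>i\<in>I. g i)" if "\<And>i. i \<in> I \<Longrightarrow> P (g i)" for g :: "'i \<Rightarrow> 'f path_alg" and I
    using that by (induction I rule: infinite_finite_induct) (auto simp: zero add)
  have "P f" if "\<And>t xs. path_coeff f (t, xs) \<noteq> 0 \<Longrightarrow> length xs < n" for n and f :: "'f path_alg"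
    using that
  proof (induction n arbitrary: f)
    case 0
    then have "f = 0" by (intro path_alg_eqI) auto
    then show ?case by (simp add: zero)
  next
    case (Suc n)
    \<comment> \<open>The part on trivial paths is split off; the rest is a sum of arrows times
      tails, whose paths are shorter by one.\<close>
    define g where "g = (\<Sum>i\<in>UNIV. path_scale (path_coeff f (i, [])) (idem i))"
    have nil: "path_coeff (f - g) (t, []) = 0" for t
    proof -
      have "path_coeff g (t, []) = (\<Sum>i\<in>UNIV. if i = t then path_coeff f (i, []) else 0)"
        unfolding g_def path_coeff_sum by (rule sum.cong) (auto simp: path_coeff_idem)
      then show ?thesis by simp
    qed
    have gpos: "path_coeff g (t, x # xs) = 0" for t x xs
      by (simp add: g_def path_coeff_sum path_coeff_idem)
    have "P (tail_part x (f - g))" for x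
    proof (rule Suc.IH)
      fix t xs assume "path_coeff (tail_part x (f - g)) (t, xs) \<noteq> 0"
      then have "path_coeff (f - g) (tgt x, x # xs) \<noteq> 0"
        by (auto simp: path_coeff_parts split: if_splits)
      then have "path_coeff f (tgt x, x # xs) \<noteq> 0"
        by (simp add: gpos)
      then show "length xs < n" using Suc.prems by fastforce
    qed
    then have "P (\<Sum>x\<in>UNIV. arrow_elt x * tail_part x (f - g))"
      by (intro sum arrow)
    then have "P (f - g)"
      using parts_decomposition(2)[OF nil] by simp
    moreover have "P g"
      unfolding g_def by (intro sum scale idem)
    ultimately have "P (f - g + g)" by (rule add)
    then show ?case by simp
  qed
  moreover have "\<exists>n. \<forall>t xs. path_coeff f (t, xs) \<noteq> 0 \<longrightarrow> length xs < n"
  proof -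
    have "finite ((\<lambda>(t, xs). length xs) ` {p. path_coeff f p \<noteq> 0})"
      using path_coeff[of f] by auto
    then obtain n where "\<forall>m \<in> (\<lambda>(t, xs). length xs) ` {p. path_coeff f p \<noteq> 0}. m < n"
      by (metis finite_nat_bounded lessThan_iff subset_iff)
    then have "\<forall>t xs. path_coeff f (t, xs) \<noteq> 0 \<longrightarrow> length xs < n" by auto
    then show ?thesis ..
  qed
  ultimately show ?thesis by blast
qed

lemma rel_terms_sum:
  "lc (\<lambda>(y, z). arr y * arr z) (map (\<lambda>(s, y, z). ((y, z), s)) (rel_terms i)) = (0 :: 'f :: field preproj)"
proof -
  have "relator i = 1 * relator i * (1 :: 'f path_alg)" by simp
  moreover have "relator i \<in> (rel_space :: 'f path_alg set)"
    unfolding rel_space_def by (rule qalg.span_base) simp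
  ultimately have "relator i \<in> (rel_ideal :: 'f path_alg set)"
    unfolding rel_ideal_def by (intro qalg.span_base) blast
  then have "preproj_class (relator i :: 'f path_alg) = 0"
    by (metis diff_zero preproj_class_eq_iff preproj_class_hom(5))
  then show ?thesis
    by (cases i) (simp_all add: preproj_class_hom algebra_simps)
qed

section \<open>The basis\<close>

lemma left_entry: "map_of (ltab x) k = Some (c, w) \<Longrightarrow> check_left x k (scomb c) (scomb w)"
  using check_left_all[of x] by (auto simp: list_all_iff dest!: map_of_SomeD)

lemma key_entry: "map_of ptable k = Some (j, i, p) \<Longrightarrow> check_key k j i p"
  using check_key_all by (auto simp: list_all_iff dest!: map_of_SomeD)

lemma is_keyD: "is_key k \<Longrightarrow> check_key k (psrc k) (ptgt k) (parent k)"
  by (cases "map_of ptable k") (auto simp: is_key_def psrc_def ptgt_def parent_def dest: key_entry)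

lemma is_key_pos: "is_key k \<Longrightarrow> 0 < k"
  by (auto dest!: is_keyD simp: check_key.simps)

lemma parentD:
  assumes "is_key k" "parent k = Some (x, m)"
  shows "0 < m" "m < k" "is_key m" "src x = ptgt m" "tgt x = ptgt k" "psrc m = psrc k" "lmul x m = [(k, 1)]"
  using is_keyD[OF assms(1)] assms(2) by (auto simp: check_key.simps)

lemma key_induct [consumes 1, case_names key]:
  assumes "is_key k" "\<And>k. is_key k \<Longrightarrow> (\<And>m. is_key m \<Longrightarrow> m < k \<Longrightarrow> P m) \<Longrightarrow> P k"
  shows "P k"
  using assms(1)
proof (induction "nat k" arbitrary: k rule: less_induct)
  case less
  show ?case
    by (rule assms(2)[OF less.prems]) (use less is_key_pos in auto)
qed

lemma set_arrows:
  "x \<in> set (out_arrows i) \<longleftrightarrow> src x = i"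
  "y \<in> set (in_arrows i) \<longleftrightarrow> tgt y = i"
proof -
  show "x \<in> set (out_arrows i) \<longleftrightarrow> src x = i"
  proof (cases x)
    case (Fwd e) then show ?thesis by (cases e; cases i; simp)
  next
    case (Rev e) then show ?thesis by (cases e; cases i; simp)
  qed
  show "y \<in> set (in_arrows i) \<longleftrightarrow> tgt y = i"
  proof (cases y)
    case (Fwd e) then show ?thesis by (cases e; cases i; simp)
  next
    case (Rev e) then show ?thesis by (cases e; cases i; simp)
  qed
qed

lemma ltab_key:
  assumes "is_key k" "src x = ptgt k"
  obtains c w where "map_of (ltab x) k = Some (c, w)"
proof -
  have "x \<in> set (out_arrows (ptgt k))" using assms(2) by (simp add: set_arrows)
  with is_keyD[OF assms(1)] show ?thesis
    using that by (fastforce simp: check_key.simps list_all_iff)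
qed

lemma lmul_off: "src x \<noteq> ptgt k \<Longrightarrow> lmul x k = []"
  by (auto simp: lmul_def check_left.simps split: option.splits dest!: left_entry)

lemma lmul_keys: "(m, a) \<in> set (lmul x k) \<Longrightarrow> is_key m \<and> ptgt m = tgt x \<and> psrc m = psrc k"
  by (cases "map_of (ltab x) k")
    (auto simp: lmul_def check_left.simps keys_ok_def list_all_iff dest!: left_entry)

section \<open>Basis paths as elements of \<open>A\<close>\<close>

function bas :: "int \<Rightarrow> 'f :: field preproj" where
  "bas k = (case parent k of None \<Rightarrow> vx (psrc k)
     | Some (x, m) \<Rightarrow> if 0 < m \<and> m < k then arr x * bas m else 0)"
  by auto
termination
  by (relation "measure nat") auto

declare bas.simps [simp del]

lemma bas_parent: "is_key k \<Longrightarrow> parent k = Some (x, m) \<Longrightarrow> bas k = arr x * bas m"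
  by (subst bas.simps) (simp add: parentD)

lemma bas_root: "parent k = None \<Longrightarrow> bas k = vx (psrc k)"
  by (subst bas.simps) simp

lemma bas_ekey: "bas (ekey i) = vx i"
  by (simp add: bas_root ekey_key)

lemma root_ekey: "is_key k \<Longrightarrow> parent k = None \<Longrightarrow> k = ekey (psrc k)"
  by (auto dest!: is_keyD simp: check_key.simps)

lemma bas_ends:
  assumes "is_key k"
  shows "vx i * bas k = (if i = ptgt k then bas k else 0 :: 'f :: field preproj)"
    and "bas k * vx j = (if j = psrc k then bas k else 0 :: 'f :: field preproj)"
proof -
  from assms have "vx i * bas k = (if i = ptgt k then bas k else 0 :: 'f preproj) \<and>
      bas k * vx j = (if j = psrc k then bas k else 0 :: 'f preproj)"
  proof (induction k rule: key_induct)
    case (key k)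
    show ?case
    proof (cases "parent k")
      case None
      then have "bas k = (vx (psrc k) :: 'f preproj)" "ptgt k = psrc k"
        using bas_root[OF None] root_ekey[OF key(1) None] ekey_key(4) by (blast, metis)
      then show ?thesis by (simp add: vx_mult)
    next
      case (Some p)
      then obtain x m where p: "parent k = Some (x, m)" by (cases p) auto
      from key(2)[OF parentD(3,2)[OF key(1) p]] show ?thesis
        by (simp add: bas_parent[OF key(1) p] mult.assoc vx_mult_assoc
            parentD(4-6)[OF key(1) p] flip: parentD(5,6)[OF key(1) p])
    qed
  qed
  then show "vx i * bas k = (if i = ptgt k then bas k else 0 :: 'f preproj)"
    "bas k * vx j = (if j = psrc k then bas k else 0 :: 'f preproj)" by auto
qed

lemma arr_bas_off:
  assumes "is_key k" "src x \<noteq> ptgt k"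
  shows "arr x * bas k = 0"
proof -
  have "arr x * bas k = arr x * (vx (ptgt k) * bas k)" using assms(1) by (simp add: bas_ends)
  also have "\<dots> = 0" using assms(2) by (simp add: vx_mult_assoc)
  finally show ?thesis .
qed

lemma rel_terms_src: "(s, y, z) \<in> set (rel_terms i) \<Longrightarrow> tgt y = i \<and> src z = i \<and> src y = tgt z"
  by (cases i) auto

lemma rel_left_lc:
  "lc g (rel_left k r) = lc (\<lambda>(y, z). lc (\<lambda>n. lc g (lmul y n)) (lmul z k)) (map (\<lambda>(s, y, z). ((y, z), s)) r)"
  by (induction k r rule: rel_left.induct) auto

lemma rel_left_zero:
  assumes "is_key k"
  shows "lc g (rel_left k (rel_terms (ptgt k))) = 0"
  using is_keyD[OF assms] by (intro lc_czero[of 0]) (auto simp: check_key.simps)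

text \<open>The defect of a table entry. The certificate of a reducible pair \<open>(x, k)\<close> is a combination
  of relations \<open>\<sigma>\<^sub>i m\<close> whose reducible part is exactly \<open>(x, k)\<close>; all other pairs have defect zero.\<close>

definition defect :: "arrow \<Rightarrow> int \<Rightarrow> 'f :: field preproj" where
  "defect y n = arr y * bas n - lc bas (lmul y n)"

text \<open>A composable irreducible pair produces the child of \<open>n\<close> in the tree, and
  \<open>bas\<close> was defined along the tree. For a non-composable pair both terms
  vanish.\<close>

lemma defect_irreducible:
  assumes "is_key n" "\<not> reducible y n"
  shows "defect y n = 0"
proof (cases "src y = ptgt n")
  case True
  then obtain c w where cw: "map_of (ltab y) n = Some (c, w)" using ltab_key assms(1) by blast
  with assms(2) have "w = []" by (simp add: reducible_def)
  with left_entry[OF cw] obtain m where m: "scomb c = [(m, 1)]" "parent m = Some (y, n)" "is_key m"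
    by (auto simp: check_left.simps keys_ok_def split: list.splits)
  then show ?thesis
    by (simp add: defect_def lmul_def cw bas_parent)
next
  case False
  then show ?thesis
    by (simp add: defect_def arr_bas_off assms lmul_off)
qed

lemma red_pairs_defect:
  "(\<And>n a. (n, a) \<in> set c \<Longrightarrow> is_key n) \<Longrightarrow>
    lc (\<lambda>(y, n). defect y n) (red_pairs s y c) = of_int s * lc (defect y) c"
proof (induction s y c rule: red_pairs.induct)
  case (2 s y m a c)
  have "is_key m" by (rule 2(3)[of m a]) simp
  with 2 show ?case
    by (auto simp: defect_irreducible distrib_left mult.assoc)
qed simp

text \<open>A relation acts on \<open>bas k\<close> in two stages. The first stage agrees with the
  table by \<open>IH\<close>, so the difference between the product in \<open>A\<close> and the
  tabulated action consists of second-stage defects alone.\<close>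

lemma rel_pairs_defect:
  assumes r: "\<And>s y z. (s, y, z) \<in> set r \<Longrightarrow> src z = ptgt k" and "is_key k"
    and IH: "\<And>z. defect z k = (0 :: 'f preproj)"
  shows "lc (\<lambda>(y, n). defect y n :: 'f :: field preproj) (rel_pairs k r) =
    lc (\<lambda>(y, z). arr y * arr z) (map (\<lambda>(s, y, z). ((y, z), s)) r) * bas k
    - lc bas (rel_left k r)"
  using r
proof (induction r)
  case Nil
  then show ?case by simp
next
  case (Cons p r)
  obtain s y z where p: "p = (s, y, z)" by (cases p) auto
  have zk: "arr z * bas k = (lc bas (lmul z k) :: 'f preproj)"
    using IH[of z] by (simp add: defect_def)
  have "lc (\<lambda>(y, n). defect y n :: 'f preproj) (red_pairs s y (lmul z k)) =
      of_int s * lc (defect y) (lmul z k)"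
    by (rule red_pairs_defect) (use lmul_keys in blast)
  also have "(lc (defect y) (lmul z k) :: 'f preproj) = arr y * (arr z * bas k) - lc (\<lambda>n. lc bas (lmul y n)) (lmul z k)"
    unfolding zk lc_mult_left lc_diff[symmetric] defect_def[abs_def] ..
  finally show ?case
    using Cons.IH[OF Cons.prems[OF list.set_intros(2)]] by (simp add: p algebra_simps)
qed

text \<open>Each relation in the certificate is multiplied with a smaller path, where first-stage
  products are correct by induction. It vanishes in \<open>A\<close> and also in the table, so its
  defects sum to zero. Summed over the certificate, these defects are exactly the one of
  \<open>(x, k)\<close>.\<close>

lemma defect_zero: "is_key k \<Longrightarrow> defect x k = (0 :: 'f :: field preproj)"
proof (induction k arbitrary: x rule: key_induct)
  case (key k)
  show ?case
  proof (cases "reducible x k")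
    case False
    then show ?thesis by (rule defect_irreducible[OF key(1)])
  next
    case True
    then obtain c w where cw: "map_of (ltab x) k = Some (c, w)" "w \<noteq> []"
      by (auto simp: reducible_def split: option.splits)
    have chk: "check_left x k (scomb c) (scomb w)" by (rule left_entry[OF cw(1)])
    let ?d = "\<lambda>(y, n). defect y n :: 'f preproj"
    have "lc ?d (rel_pairs m (rel_terms (tgt x))) = 0" if "(m, a) \<in> set (scomb w)" for m a
    proof -
      from chk cw(2) that have m: "is_key m" "ptgt m = tgt x" "m < k"
        by (auto simp: check_left.simps keys_ok_def list_all_iff)
      have "lc ?d (rel_pairs m (rel_terms (tgt x))) =
          lc (\<lambda>(y, z). arr y * arr z) (map (\<lambda>(s, y, z). ((y, z), s)) (rel_terms (tgt x))) * bas m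
          - lc bas (rel_left m (rel_terms (tgt x)))"
        using m by (intro rel_pairs_defect key(2)) (auto dest: rel_terms_src)
      then show ?thesis
        using rel_left_zero[OF m(1), of "bas :: _ \<Rightarrow> 'f preproj"] by (simp add: rel_terms_sum m(2))
    qed
    then have "lc ?d (cbind (\<lambda>m. rel_pairs m (rel_terms (tgt x))) (scomb w)) = 0"
      by (simp cong: lc_cong)
    \<comment> \<open>The cancellation was tested on formal pairs, so it survives evaluation at the
      defects.\<close>
    moreover have "lc ?d (((x, k), -1) # cbind (\<lambda>m. rel_pairs m (rel_terms (tgt x))) (scomb w)) = 0"
      using chk cw(2) by (intro lc_czero[of 0]) (auto simp: check_left.simps)
    ultimately show ?thesis by simp
  qed
qed

lemma arr_bas: "is_key k \<Longrightarrow> arr x * bas k = lc bas (lmul x k)"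
  using defect_zero[of k x] by (simp add: defect_def)

section \<open>Right multiplication by arrows\<close>

lemma set_cscale: "(k, a) \<in> set (cscale s c) \<Longrightarrow> \<exists>b. (k, b) \<in> set c"
  by (induction s c rule: cscale.induct) auto

lemma set_cbind: "(k, a) \<in> set (cbind f c) \<Longrightarrow> \<exists>n b d. (n, b) \<in> set c \<and> (k, d) \<in> set (f n)"
proof (induction f c rule: cbind.induct)
  case (2 f n b c)
  then consider "(k, a) \<in> set (cscale b (f n))" | "(k, a) \<in> set (cbind f c)" by auto
  then show ?case
  proof cases
    case 1
    then show ?thesis using set_cscale by fastforce
  next
    case 2
    with "2.IH" show ?thesis by auto
  qed
qed simp

lemma set_cins: "(k, a) \<in> set (cins n b c) \<Longrightarrow> k = n \<or> (\<exists>d. (k, d) \<in> set c)"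
  by (induction n b c rule: cins.induct) (auto split: if_splits)

lemma set_cnorm: "(k, a) \<in> set (cnorm c) \<Longrightarrow> \<exists>b. (k, b) \<in> set c"
proof (induction c arbitrary: a rule: cnorm.induct)
  case (2 n b c)
  then show ?case using set_cins[of k a n b "cnorm c"] by auto
qed simp

lemma rmul_off: "tgt y \<noteq> psrc k \<Longrightarrow> rmul y k = []"
  by (simp add: rmul.simps)

lemma rmul_parent:
  "is_key k \<Longrightarrow> parent k = Some (x, m) \<Longrightarrow> tgt y = psrc k \<Longrightarrow> rmul y k = cnorm (cbind (lmul x) (rmul y m))"
  by (subst rmul.simps) (simp add: parentD)

lemma rmul_root: "parent k = None \<Longrightarrow> tgt y = psrc k \<Longrightarrow> rmul y k = lmul y (ekey (src y))"
  by (subst rmul.simps) simp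

lemma rmul_keys: "is_key k \<Longrightarrow> (n, a) \<in> set (rmul y k) \<Longrightarrow> is_key n \<and> ptgt n = ptgt k \<and> psrc n = src y"
proof (induction k arbitrary: n a rule: key_induct)
  case (key k)
  then have y: "tgt y = psrc k" using rmul_off by fastforce
  show ?case
  proof (cases "parent k")
    case None
    then have "ptgt k = psrc k" using root_ekey[OF key(1) None] ekey_key(4) by metis
    then show ?thesis
      using key(3) lmul_keys[of n a y "ekey (src y)"] by (simp add: rmul_root[OF None y] y ekey_key)
  next
    case (Some p)
    then obtain x m where p: "parent k = Some (x, m)" by (cases p) auto
    note par = parentD[OF key(1) p]
    obtain l b d where l: "(l, b) \<in> set (rmul y m)" "(n, d) \<in> set (lmul x l)"
      using key(3) unfolding rmul_parent[OF key(1) p y] by (blast dest!: set_cnorm set_cbind)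
    then show ?thesis
      using key(2)[OF par(3,2) l(1)] lmul_keys[OF l(2)] par(5) by simp
  qed
qed

lemma bas_arr:
  "is_key k \<Longrightarrow> tgt y = psrc k \<Longrightarrow> bas k * arr y = (lc bas (rmul y k) :: 'f :: field preproj)"
proof (induction k rule: key_induct)
  case (key k)
  show ?case
  proof (cases "parent k")
    case None
    have "bas k * arr y = (arr y * bas (ekey (src y)) :: 'f preproj)"
      by (simp add: bas_root[OF None] bas_ekey vx_mult key(3))
    then show ?thesis
      by (simp add: rmul_root[OF None key(3)] arr_bas ekey_key)
  next
    case (Some p)
    then obtain x m where p: "parent k = Some (x, m)" by (cases p) auto
    note par = parentD[OF key(1) p]
    have "bas k * arr y = arr x * (lc bas (rmul y m) :: 'f preproj)"
      using key(2)[OF par(3,2)] key(3) by (simp add: bas_parent[OF key(1) p] mult.assoc par(6))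
    also have "\<dots> = lc (\<lambda>n. lc bas (lmul x n)) (rmul y m)"
      unfolding lc_mult_left by (rule lc_cong) (use rmul_keys[OF par(3)] arr_bas in blast)
    finally show ?thesis
      by (simp add: rmul_parent[OF key(1) p key(3)] lc_cnorm)
  qed
qed

section \<open>Coordinates\<close>

fun pcomb :: "vertex \<Rightarrow> arrow list \<Rightarrow> int comb" where
  "pcomb t [] = [(ekey t, 1)]"
| "pcomb t (x # xs) = cbind (lmul x) (pcomb (src x) xs)"

lemma pcomb_keys: "is_path t xs \<Longrightarrow> (k, a) \<in> set (pcomb t xs) \<Longrightarrow> is_key k \<and> ptgt k = t"
  by (cases xs) (auto simp: ekey_key dest!: set_cbind lmul_keys)

text \<open>A linear form on the path algebra with prescribed values on the basis; its vanishing on the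
  ideal of relations is the left module structure encoded in the table.\<close>

definition path_form :: "(int \<Rightarrow> 'f) \<Rightarrow> 'f :: field path_alg \<Rightarrow> 'f" where
  "path_form h f = (\<Sum>p | path_coeff f p \<noteq> 0. path_coeff f p * lc h (pcomb (fst p) (snd p)))"

lemma finite_support: "finite {p. path_coeff f p \<noteq> 0}"
  using path_coeff[of f] by simp

lemma path_form_superset:
  assumes "finite S" "{p. path_coeff f p \<noteq> 0} \<subseteq> S"
  shows "path_form h f = (\<Sum>p\<in>S. path_coeff f p * lc h (pcomb (fst p) (snd p)))"
  unfolding path_form_def by (rule sum.mono_neutral_left) (use assms in auto)

lemma path_form_linear:
  "path_form h 0 = 0"
  "path_form h (f + g) = path_form h f + path_form h g"
  "path_form h (f - g) = path_form h f - path_form h g"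
  "path_form h (- f) = - path_form h f"
  "path_form h (path_scale c f) = c * path_form h f"
proof -
  let ?S = "{p. path_coeff f p \<noteq> 0} \<union> {p. path_coeff g p \<noteq> 0}"
  have fin: "finite ?S" by (simp add: finite_support)
  show "path_form h 0 = 0" by (simp add: path_form_def)
  show "path_form h (f + g) = path_form h f + path_form h g"
    using path_form_superset[OF fin, of f h] path_form_superset[OF fin, of g h]
      path_form_superset[OF fin, of "f + g" h]
    by (force simp: sum.distrib distrib_right)
  show "path_form h (f - g) = path_form h f - path_form h g"
    using path_form_superset[OF fin, of f h] path_form_superset[OF fin, of g h]
      path_form_superset[OF fin, of "f - g" h]
    by (force simp: sum_subtractf left_diff_distrib)
  show "path_form h (- f) = - path_form h f"
    by (simp add: path_form_def sum_negf)
  show "path_form h (path_scale c f) = c * path_form h f"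
    using path_form_superset[OF finite_support, of "path_scale c f" f h]
    by (force simp: path_form_def sum_distrib_left mult.assoc)
qed

lemma path_form_cong:
  assumes "\<And>k. is_key k \<Longrightarrow> g k = h k"
  shows "path_form g f = path_form h f"
  unfolding path_form_def
proof (rule sum.cong)
  fix p assume "p \<in> {p. path_coeff f p \<noteq> 0}"
  then have "is_path (fst p) (snd p)" using path_coeff_is_path[of f "fst p" "snd p"] by simp
  then have "lc g (pcomb (fst p) (snd p)) = lc h (pcomb (fst p) (snd p))"
    by (intro lc_cong assms) (auto dest: pcomb_keys)
  then show "path_coeff f p * lc g (pcomb (fst p) (snd p)) = path_coeff f p * lc h (pcomb (fst p) (snd p))"
    by simp
qed simp

lemma path_form_values:
  "path_form (\<lambda>k. 0) f = 0"
  "path_form (\<lambda>k. g k + h k) f = path_form g f + path_form h f"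
  "path_form (\<lambda>k. g k - h k) f = path_form g f - path_form h f"
  "path_form (\<lambda>k. - h k) f = - path_form h f"
proof -
  show "path_form (\<lambda>k. 0) f = 0" by (simp add: path_form_def)
  show "path_form (\<lambda>k. g k + h k) f = path_form g f + path_form h f"
    by (simp add: path_form_def lc_add distrib_left sum.distrib)
  show diff: "path_form (\<lambda>k. g k - h k) f = path_form g f - path_form h f" for g
    by (simp add: path_form_def lc_diff right_diff_distrib sum_subtractf)
  show "path_form (\<lambda>k. - h k) f = - path_form h f"
    using diff[of "\<lambda>_. 0"] by (simp add: path_form_def)
qed

lemma path_form_idem: "path_form h (idem i) = h (ekey i)"
proof -
  have "path_form h (idem i) = (\<Sum>p\<in>{(i, [])}. path_coeff (idem i) p * lc h (pcomb (fst p) (snd p)))"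
    by (rule path_form_superset) (auto simp: path_coeff_idem split: if_splits)
  then show ?thesis by (simp add: path_coeff_idem)
qed

text \<open>Left multiplication is transposed onto the values of the form. This is what lets
  relations be tested on the tables while the argument \<open>f\<close> stays arbitrary.\<close>

lemma path_form_arrow: "path_form h (arrow_elt x * f) = path_form (\<lambda>k. lc h (lmul x k)) f"
proof -
  let ?S = "{p. path_coeff f p \<noteq> 0}"
  \<comment> \<open>Only paths ending at the source of \<open>x\<close> contribute to the product.
    The others can be put back at the end, because \<open>lmul x\<close> is empty on their normal
    forms.\<close>
  let ?T = "{p \<in> ?S. fst p = src x}"
  let ?\<phi> = "\<lambda>p :: vertex \<times> arrow list. (tgt x, x # snd p)"
  have "{p. path_coeff (arrow_elt x * f) p \<noteq> 0} \<subseteq> ?\<phi> ` ?T"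
  proof
    fix p assume p: "p \<in> {p. path_coeff (arrow_elt x * f) p \<noteq> 0}"
    obtain t xs where tx: "p = (t, xs)" by (cases p)
    show "p \<in> ?\<phi> ` ?T"
      using p by (cases xs) (force simp: tx path_coeff_arrow_elt_mult split: if_splits)+
  qed
  then have "path_form h (arrow_elt x * f) =
      (\<Sum>q\<in>?\<phi> ` ?T. path_coeff (arrow_elt x * f) q * lc h (pcomb (fst q) (snd q)))"
    by (intro path_form_superset) (auto simp: finite_support)
  also have "\<dots> = (\<Sum>p\<in>?T. path_coeff (arrow_elt x * f) (?\<phi> p) * lc h (pcomb (tgt x) (x # snd p)))"
    by (subst sum.reindex) (auto simp: inj_on_def)
  also have "\<dots> = (\<Sum>p\<in>?T. path_coeff f p * lc (\<lambda>k. lc h (lmul x k)) (pcomb (fst p) (snd p)))"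
    by (rule sum.cong) (auto simp: path_coeff_arrow_elt_mult)
  also have "\<dots> = path_form (\<lambda>k. lc h (lmul x k)) f"
    unfolding path_form_def
  proof (rule sum.mono_neutral_left)
    show "\<forall>p\<in>?S - ?T. path_coeff f p * lc (\<lambda>k. lc h (lmul x k)) (pcomb (fst p) (snd p)) = 0"
    proof
      fix p assume p: "p \<in> ?S - ?T"
      then have "is_path (fst p) (snd p)" using path_coeff_is_path[of f "fst p" "snd p"] by simp
      then have "lc (\<lambda>k. lc h (lmul x k)) (pcomb (fst p) (snd p)) = lc (\<lambda>k. 0) (pcomb (fst p) (snd p))"
        using p by (intro lc_cong) (auto dest!: pcomb_keys simp: lmul_off)
      then show "path_coeff f p * lc (\<lambda>k. lc h (lmul x k)) (pcomb (fst p) (snd p)) = 0" by simp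
    qed
  qed (auto simp: finite_support)
  finally show ?thesis .
qed

lemma path_form_idem_mult:
  "path_form h (idem j * f) = path_form (\<lambda>k. if ptgt k = j then h k else 0) f"
proof -
  let ?S = "{p. path_coeff f p \<noteq> 0}"
  have "path_form h (idem j * f) = (\<Sum>p\<in>?S. path_coeff (idem j * f) p * lc h (pcomb (fst p) (snd p)))"
    by (rule path_form_superset[OF finite_support]) (auto simp: path_coeff_idem_mult split: if_splits)
  also have "\<dots> = path_form (\<lambda>k. if ptgt k = j then h k else 0) f"
    unfolding path_form_def
  proof (rule sum.cong)
    fix p assume p: "p \<in> ?S"
    obtain t xs where tx: "p = (t, xs)" by (cases p)
    have path: "is_path t xs" using path_coeff_is_path[of f t xs] p tx by simp
    have "lc (\<lambda>k. if ptgt k = j then h k else 0) (pcomb t xs) = lc (if t = j then h else (\<lambda>_. 0)) (pcomb t xs)"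
      by (rule lc_cong) (auto dest!: pcomb_keys[OF path])
    then show "path_coeff (idem j * f) p * lc h (pcomb (fst p) (snd p)) =
        path_coeff f p * lc (\<lambda>k. if ptgt k = j then h k else 0) (pcomb (fst p) (snd p))"
      by (simp add: tx path_coeff_idem_mult)
  qed simp
  finally show ?thesis .
qed

text \<open>Transposition replaces the relator by \<open>rel_left\<close> acting on the values. That
  is zero on paths ending at \<open>i\<close> by the finite check, and on all other paths because
  nothing composes.\<close>

lemma path_form_relator: "path_form h (relator i * f) = 0"
proof -
  have "path_form h (relator i * f) = path_form (\<lambda>k. lc h (rel_left k (rel_terms i))) f"
    by (cases i) (simp_all add: ring_distribs mult.assoc path_form_arrow path_form_linear path_form_values)
  also have "\<dots> = path_form (\<lambda>k. 0) f"
  proof (rule path_form_cong)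
    fix k assume k: "is_key k"
    show "lc h (rel_left k (rel_terms i)) = 0"
    proof (cases "ptgt k = i")
      case True
      then show ?thesis using rel_left_zero[OF k] by blast
    next
      case False
      have "lc h (rel_left k (rel_terms i)) = lc (\<lambda>(y, z). 0) (map (\<lambda>(s, y, z). ((y, z), s)) (rel_terms i))"
        unfolding rel_left_lc by (rule lc_cong) (use False in \<open>auto dest!: rel_terms_src simp: lmul_off\<close>)
      then show ?thesis by (simp add: split_def)
    qed
  qed
  finally show ?thesis by (simp add: path_form_values)
qed

text \<open>For a generator \<open>u * r * v\<close> the left factor is moved into the form by
  induction on \<open>u\<close>, which is why \<open>h\<close> must vary; the right factor is simply
  part of the argument.\<close>

lemma path_form_ideal:
  assumes "f \<in> rel_ideal"
  shows "path_form h f = 0"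
proof -
  have rel: "path_form h (r * v) = 0" if "r \<in> rel_space" for h r v
    using that unfolding rel_space_def
    by (induction rule: qalg.span_induct_alt)
      (auto simp: path_form_linear distrib_right path_form_relator)
  have "path_form h (u * (r * v)) = 0" if "r \<in> rel_space" for h u r v
    using that
    by (induction u arbitrary: h rule: path_alg_induct)
      (auto simp: path_form_linear distrib_right path_form_idem_mult path_form_arrow mult.assoc rel)
  then have gen: "path_form h (u * r * v) = 0" if "r \<in> rel_space" for u r v
    using that by (simp add: mult.assoc)
  show ?thesis
    using assms unfolding rel_ideal_def
    by (induction rule: qalg.span_induct_alt) (auto simp: path_form_linear gen)
qed

lift_definition alg_form :: "(int \<Rightarrow> 'f) \<Rightarrow> 'f :: field preproj \<Rightarrow> 'f" is path_form
proof -
  fix h :: "int \<Rightarrow> 'f" and f g :: "'f path_alg"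
  assume "f - g \<in> rel_ideal"
  from path_form_ideal[OF this, of h] show "path_form h f = path_form h g"
    by (simp add: path_form_linear)
qed

lemma alg_form_linear:
  "alg_form h 0 = 0"
  "alg_form h (a + b) = alg_form h a + alg_form h b"
  "alg_form h (preproj_scale c a) = c * alg_form h a"
  by (transfer; simp add: path_form_linear)+

lemma alg_form_sum: "alg_form h (\<Sum>i\<in>I. f i) = (\<Sum>i\<in>I. alg_form h (f i))"
  by (induction I rule: infinite_finite_induct) (simp_all add: alg_form_linear)

lemma alg_form_class: "alg_form h (preproj_class f) = path_form h f"
  by (simp add: alg_form.abs_eq)

lemma alg_form_arrow: "alg_form h (arr x * a) = alg_form (\<lambda>k. lc h (lmul x k)) a"
  by (induct a) (simp flip: preproj_class_hom(3) add: alg_form_class path_form_arrow)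

text \<open>Forms on \<open>A\<close> can take arbitrary values on the basis paths, which is their
  linear independence. The reason is that a basis path is reached from its parent with coefficient
  one and no further terms.\<close>

lemma alg_form_bas: "is_key k \<Longrightarrow> alg_form h (bas k) = h k"
proof (induction k arbitrary: h rule: key_induct)
  case (key k)
  show ?case
  proof (cases "parent k")
    case None
    show ?thesis
      using root_ekey[OF key(1) None] by (simp add: bas_root[OF None] alg_form_class path_form_idem)
  next
    case (Some p)
    then obtain x m where p: "parent k = Some (x, m)" by (cases p) auto
    show ?thesis
      using key(2)[OF parentD(3,2)[OF key(1) p]]
      by (simp add: bas_parent[OF key(1) p] alg_form_arrow parentD(7)[OF key(1) p])
  qed
qed

section \<open>Coordinates with respect to the basis paths\<close>

definition keys :: "int set" where "keys = {k. is_key k}"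

lemma finite_keys: "finite keys"
proof -
  have "keys = dom (map_of ptable)" by (auto simp: keys_def is_key_def)
  then show ?thesis by (metis finite_dom_map_of)
qed

lemma inj_bas: "inj_on (bas :: int \<Rightarrow> 'f :: field preproj) keys"
proof (rule inj_onI)
  fix k m assume "k \<in> keys" "m \<in> keys" and eq: "(bas k :: 'f preproj) = bas m"
  \<comment> \<open>The form dual to \<open>k\<close> separates \<open>bas k\<close> from every
    other basis path.\<close>
  let ?h = "\<lambda>n. if n = k then 1 else 0 :: 'f"
  have "?h k = ?h m"
    using alg_form_bas[of k ?h] alg_form_bas[of m ?h] \<open>k \<in> keys\<close> \<open>m \<in> keys\<close> eq
    unfolding keys_def by (metis mem_Collect_eq)
  then show "k = m" by (simp split: if_splits)
qed

lemma scale_of_int: "preproj_scale (of_int a) v = of_int a * v"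
proof -
  have nat: "preproj_scale (of_nat n) v = of_nat n * v" for n and v :: "'a preproj"
    by (induction n) (simp_all add: palg.scale_left_distrib algebra_simps)
  show ?thesis
    by (cases a rule: int_cases2) (simp_all add: nat palg.scale_minus_left)
qed

lemma lc_in_span:
  assumes "\<And>k a. (k, a) \<in> set c \<Longrightarrow> g k \<in> palg.span S"
  shows "lc g c \<in> palg.span S"
  using assms
proof (induction c)
  case (Cons q c)
  obtain k a where q: "q = (k, a)" by (cases q)
  have "g k \<in> palg.span S" "lc g c \<in> palg.span S"
    using Cons.prems by (auto simp: q intro: Cons.IH)
  then show ?case
    by (simp add: q palg.span_add palg.span_scale flip: scale_of_int)
qed (simp add: palg.span_zero)

lemma span_bas: "a \<in> palg.span (bas ` keys)"
proof -
  have arrow: "arr x * b \<in> palg.span (bas ` keys)" if "b \<in> palg.span (bas ` keys)" for x and b :: "'a preproj"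
    using that
  proof (induction rule: palg.span_induct_alt)
    case (step c b d)
    then obtain k where k: "is_key k" "b = bas k" by (auto simp: keys_def)
    have "arr x * b \<in> palg.span (bas ` keys)"
      unfolding k(2) arr_bas[OF k(1)]
      by (rule lc_in_span) (auto intro!: palg.span_base imageI simp: keys_def dest!: lmul_keys)
    with step show ?case
      by (simp add: distrib_left palg.span_add palg.span_scale)
  qed (simp add: palg.span_zero)
  have "preproj_class f \<in> palg.span (bas ` keys)" for f :: "'a path_alg"
  proof (induction f rule: path_alg_induct)
    case (idem i)
    have "bas (ekey i) \<in> (bas ` keys :: 'a preproj set)" by (simp add: keys_def ekey_key)
    then show ?case by (simp add: bas_ekey palg.span_base)
  qed (simp_all add: preproj_class_hom palg.span_zero palg.span_add palg.span_scale arrow)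
  then show ?thesis by (induct a) auto
qed

definition coord :: "'f :: field preproj \<Rightarrow> int \<Rightarrow> 'f" where
  "coord a k = alg_form (\<lambda>m. if m = k then 1 else 0) a"

lemma coord_linear:
  "coord 0 k = 0"
  "coord (a + b) k = coord a k + coord b k"
  "coord (preproj_scale c a) k = c * coord a k"
  "coord (\<Sum>i\<in>I. f i) k = (\<Sum>i\<in>I. coord (f i) k)"
  by (simp_all add: coord_def alg_form_linear alg_form_sum)

lemma coord_bas: "is_key m \<Longrightarrow> coord (bas m) k = (if m = k then 1 else 0)"
  by (simp add: coord_def alg_form_bas)

lemma expand_bas: "a = (\<Sum>k\<in>keys. preproj_scale (coord a k) (bas k))"
proof -
  obtain u where "a = (\<Sum>v\<in>bas ` keys. preproj_scale (u v) v)"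
    using span_bas[of a] unfolding palg.span_finite[OF finite_imageI[OF finite_keys]] by auto
  then have a: "a = (\<Sum>k\<in>keys. preproj_scale (u (bas k)) (bas k))"
    by (simp add: sum.reindex[OF inj_bas])
  have "coord a k = u (bas k)" if "k \<in> keys" for k
  proof -
    have "coord a k = (\<Sum>m\<in>keys. if m = k then u (bas m) else 0)"
      unfolding a coord_linear by (rule sum.cong) (auto simp: keys_def coord_bas)
    then show ?thesis using that finite_keys by simp
  qed
  then show ?thesis using a by simp
qed

section \<open>Koszul cochains\<close>

text \<open>Multiplication by a combination of vertices rescales each path by the coefficient at its
  end or at its start. The free \<open>g\<close> turns an equation of elements into one of
  coefficients.\<close>

lemma vertex_space_mult:
  assumes "a \<in> vertex_space"
  shows "a * f = g \<longleftrightarrow> (\<forall>t xs. path_coeff g (t, xs) = path_coeff a (t, []) * path_coeff f (t, xs))"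
    and "f * a = g \<longleftrightarrow> (\<forall>t xs. path_coeff g (t, xs) = path_coeff a (path_src t xs, []) * path_coeff f (t, xs))"
proof -
  have "path_coeff (a * f) (t, xs) = path_coeff a (t, []) * path_coeff f (t, xs) \<and>
      path_coeff (f * a) (t, xs) = path_coeff a (path_src t xs, []) * path_coeff f (t, xs)" for t xs
    using assms unfolding vertex_space_def
    by (induction rule: qalg.span_induct_alt)
      (auto simp: distrib_right distrib_left path_coeff_idem_mult path_coeff_mult_idem path_coeff_idem
        algebra_simps split: if_splits)
  then show "a * f = g \<longleftrightarrow> (\<forall>t xs. path_coeff g (t, xs) = path_coeff a (t, []) * path_coeff f (t, xs))"
    "f * a = g \<longleftrightarrow> (\<forall>t xs. path_coeff g (t, xs) = path_coeff a (path_src t xs, []) * path_coeff f (t, xs))"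
    by (auto intro: path_alg_eqI)
qed

lemma vertex_space_idem:
  assumes "a \<in> vertex_space"
  shows "a * idem v = path_scale (path_coeff a (v, [])) (idem v)"
    and "idem v * a = path_scale (path_coeff a (v, [])) (idem v)"
  by (auto simp: vertex_space_mult[OF assms] path_coeff_idem)

lemma one_vertex_space: "path_scale c 1 \<in> vertex_space"
proof -
  have "(\<Sum>i\<in>UNIV. idem i) \<in> (vertex_space :: 'a path_alg set)"
    unfolding vertex_space_def by (intro qalg.span_sum qalg.span_base) auto
  then show ?thesis
    unfolding sum_idem vertex_space_def by (rule qalg.span_scale)
qed

text \<open>Homogeneity over the field is hidden in the bimodule condition: scalar multiples of
  \<open>1\<close> lie in \<open>vertex_space\<close>.\<close>

lemma cochain_additive:
  fixes f :: "'f :: field cochain"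
  assumes "f \<in> cochains p"
  shows "v \<in> koszul_space p \<Longrightarrow> w \<in> koszul_space p \<Longrightarrow> f (v + w) = f v + f w"
    and "w \<in> koszul_space p \<Longrightarrow> f (path_scale c w) = preproj_scale c (f w)"
    and "w \<notin> koszul_space p \<Longrightarrow> f w = 0"
    and "(0 :: 'f path_alg) \<in> koszul_space p \<Longrightarrow> f 0 = 0"
proof -
  show add: "v \<in> koszul_space p \<Longrightarrow> w \<in> koszul_space p \<Longrightarrow> f (v + w) = f v + f w" for v w
    using assms unfolding cochains_def by blast
  show "w \<notin> koszul_space p \<Longrightarrow> f w = 0"
    using assms unfolding cochains_def by blast
  show "(0 :: 'f path_alg) \<in> koszul_space p \<Longrightarrow> f 0 = 0"
    using add[of 0 0] by simp
  assume "w \<in> koszul_space p"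
  then have "f (path_scale c 1 * w * path_scale 1 1) =
      preproj_class (path_scale c 1) * f w * preproj_class (path_scale 1 1)"
    using assms one_vertex_space unfolding cochains_def by blast
  then show "f (path_scale c w) = preproj_scale c (f w)"
    by (simp add: preproj_class_hom)
qed

text \<open>Common setting for \<open>W_0\<close>, \<open>W_1\<close> and \<open>W_2\<close>. Since
  every basis element \<open>b i\<close> has fixed ends, a bimodule map is a free choice of values
  in \<open>e_t A e_s\<close> with \<open>t = t i\<close> and \<open>s = s i\<close>.\<close>

locale bimodule_family =
  fixes b :: "'i :: finite \<Rightarrow> 'f :: field path_alg" and t s :: "'i \<Rightarrow> vertex" and p :: nat
  assumes inj: "inj b" and indep: "qalg.independent (range b)"
    and ends: "idem (t i) * b i = b i" "b i * idem (s i) = b i"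
    and space: "koszul_space p = qalg.span (range b)"
begin

lemma span_sum:
  assumes "w \<in> koszul_space p"
  obtains r where "w = (\<Sum>i\<in>UNIV. path_scale (r i) (b i))"
proof -
  obtain u where "w = (\<Sum>v\<in>range b. path_scale (u v) v)"
    using assms unfolding space qalg.span_finite[OF finite_imageI[OF finite]] by auto
  then have "w = (\<Sum>i\<in>UNIV. path_scale (u (b i)) (b i))"
    using inj by (simp add: sum.reindex)
  then show ?thesis by (rule that)
qed

lemma mem_space: "b i \<in> koszul_space p" "(0 :: 'f path_alg) \<in> koszul_space p" "- b i \<in> koszul_space p"
  "(\<Sum>i\<in>UNIV. path_scale (r i) (b i)) \<in> koszul_space p"
  unfolding space
  by (auto intro!: qalg.span_base qalg.span_zero qalg.span_neg qalg.span_sum qalg.span_scale)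

lemma cochain_on_add:
  assumes "v \<in> koszul_space p" "w \<in> koszul_space p"
  shows "cochain_on b \<phi> (v + w) = cochain_on b \<phi> v + cochain_on b \<phi> w"
  using assms unfolding space cochain_on_def
  by (simp add: qalg.representation_add[OF indep] palg.scale_left_distrib sum.distrib)

lemma cochain_on_scale:
  assumes "w \<in> koszul_space p"
  shows "cochain_on b \<phi> (path_scale c w) = preproj_scale c (cochain_on b \<phi> w)"
  using assms unfolding space cochain_on_def
  by (simp add: qalg.representation_scale[OF indep] palg.scale_sum_right)

lemma cochain_on_off: "w \<notin> koszul_space p \<Longrightarrow> cochain_on b \<phi> w = 0"
  unfolding space cochain_on_def qalg.representation_def by simp

lemma cochain_on_b [simp]:
  "cochain_on b \<phi> (b i) = \<phi> i" "cochain_on b \<phi> 0 = 0" "cochain_on b \<phi> (- b i) = - \<phi> i"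
proof -
  show b: "cochain_on b \<phi> (b i) = \<phi> i" by (rule cochain_on_eq[OF inj indep])
  show "cochain_on b \<phi> 0 = 0" using cochain_on_add[OF mem_space(2,2), of \<phi>] by simp
  show "cochain_on b \<phi> (- b i) = - \<phi> i"
    using cochain_on_scale[OF mem_space(1), of \<phi> "-1" i] b by simp
qed

lemma linear_on_sum:
  assumes "\<And>v w. v \<in> koszul_space p \<Longrightarrow> w \<in> koszul_space p \<Longrightarrow> f (v + w) = f v + (f w :: 'f preproj)"
    and "\<And>c w. w \<in> koszul_space p \<Longrightarrow> f (path_scale c w) = preproj_scale c (f w)"
  shows "f (\<Sum>i\<in>UNIV. path_scale (r i) (b i)) = (\<Sum>i\<in>UNIV. preproj_scale (r i) (f (b i)))"
proof -
  have "f (\<Sum>i\<in>I. path_scale (r i) (b i)) = (\<Sum>i\<in>I. preproj_scale (r i) (f (b i)))" for I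
  proof (induction I rule: infinite_finite_induct)
    case (insert i I)
    have "(\<Sum>i\<in>I. path_scale (r i) (b i)) \<in> koszul_space p" "path_scale (r i) (b i) \<in> koszul_space p"
      unfolding space by (intro qalg.span_sum qalg.span_scale qalg.span_base rangeI)+
    with insert show ?case by (simp add: assms mem_space)
  next
    case empty
    show ?case using assms(2)[OF mem_space(2), of 0] by simp
  qed simp
  then show ?thesis .
qed

lemma cochain_on_sum:
  "cochain_on b \<phi> (\<Sum>i\<in>UNIV. path_scale (r i) (b i)) = (\<Sum>i\<in>UNIV. preproj_scale (r i) (\<phi> i))"
  by (subst linear_on_sum) (auto simp: cochain_on_add cochain_on_scale)

lemma linear_on_eq:
  assumes "\<And>v w. v \<in> koszul_space p \<Longrightarrow> w \<in> koszul_space p \<Longrightarrow> f (v + w) = f v + (f w :: 'f preproj)"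
    and "\<And>c w. w \<in> koszul_space p \<Longrightarrow> f (path_scale c w) = preproj_scale c (f w)"
    and "\<And>w. w \<notin> koszul_space p \<Longrightarrow> f w = 0"
  shows "f = cochain_on b (\<lambda>i. f (b i))"
proof
  fix w
  show "f w = cochain_on b (\<lambda>i. f (b i)) w"
  proof (cases "w \<in> koszul_space p")
    case True
    then obtain r where w: "w = (\<Sum>i\<in>UNIV. path_scale (r i) (b i))" by (rule span_sum)
    show ?thesis unfolding w cochain_on_sum by (rule linear_on_sum) (auto intro: assms)
  qed (simp add: assms(3) cochain_on_off)
qed

lemma vertex_space_ends:
  assumes "a \<in> vertex_space"
  shows "a * b i = path_scale (path_coeff a (t i, [])) (b i)"
    and "b i * a = path_scale (path_coeff a (s i, [])) (b i)"
proof -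
  have "a * b i = a * idem (t i) * b i" by (simp add: mult.assoc ends)
  then show "a * b i = path_scale (path_coeff a (t i, [])) (b i)"
    by (simp add: vertex_space_idem[OF assms] ends)
  have "b i * a = b i * (idem (s i) * a)" by (simp add: ends flip: mult.assoc)
  then show "b i * a = path_scale (path_coeff a (s i, [])) (b i)"
    by (simp add: vertex_space_idem[OF assms] ends)
qed

text \<open>On a basis element with fixed ends, multiplying by vertex combinations on both sides
  amounts to the scalar \<open>?u i\<close>, and the same scalar appears on a value with the same
  ends.\<close>

lemma cochain_on_mem:
  assumes "\<And>i. vx (t i) * \<phi> i * vx (s i) = \<phi> i"
  shows "cochain_on b \<phi> \<in> cochains p"
proof -
  have "cochain_on b \<phi> (a * w * c) = preproj_class a * cochain_on b \<phi> w * preproj_class c"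
    if a: "a \<in> vertex_space" and c: "c \<in> vertex_space" and w: "w \<in> koszul_space p" for a c w
  proof -
    obtain r where r: "w = (\<Sum>i\<in>UNIV. path_scale (r i) (b i))" using w by (rule span_sum)
    let ?u = "\<lambda>i. path_coeff a (t i, []) * path_coeff c (s i, [])"
    have "a * b i * c = path_scale (?u i) (b i)" for i
      by (simp add: vertex_space_ends[OF a] vertex_space_ends[OF c] mult.assoc)
    then have "a * w * c = (\<Sum>i\<in>UNIV. path_scale (r i * ?u i) (b i))"
      by (simp add: r sum_distrib_left sum_distrib_right)
    moreover have "preproj_class a * \<phi> i * preproj_class c = preproj_scale (?u i) (\<phi> i)" for i
    proof -
      have "preproj_class a * \<phi> i * preproj_class c =
          (preproj_class (a * idem (t i))) * \<phi> i * (preproj_class (idem (s i) * c))"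
        by (subst assms[symmetric]) (simp add: preproj_class_hom mult.assoc)
      also have "\<dots> = preproj_scale (?u i) (vx (t i) * \<phi> i * vx (s i))"
        by (simp add: vertex_space_idem[OF a] vertex_space_idem[OF c] preproj_class_hom mult.commute)
      finally show ?thesis by (simp add: assms)
    qed
    ultimately show ?thesis
      by (simp add: cochain_on_sum r sum_distrib_left sum_distrib_right)
  qed
  then show ?thesis
    unfolding cochains_def by (auto simp: cochain_on_off cochain_on_add)
qed

lemma cochain_eq:
  assumes "f \<in> cochains p"
  shows "f = cochain_on b (\<lambda>i. f (b i))" and "vx (t i) * f (b i) * vx (s i) = f (b i)"
proof -
  show "f = cochain_on b (\<lambda>i. f (b i))"
    by (rule linear_on_eq) (auto intro: cochain_additive[OF assms])
  have "idem j \<in> vertex_space" for j unfolding vertex_space_def by (rule qalg.span_base) simp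
  then have "f (idem (t i) * b i * idem (s i)) = vx (t i) * f (b i) * vx (s i)"
    using assms mem_space(1) unfolding cochains_def by blast
  then show "vx (t i) * f (b i) * vx (s i) = f (b i)" by (simp add: ends)
qed

lemma cochain_on_lc:
  "lc (\<lambda>q. cochain_on b (\<Phi> q) w) c = cochain_on b (\<lambda>i. lc (\<lambda>q. \<Phi> q i) c) w"
  by (induction c)
    (auto simp: cochain_on_def palg.scale_right_distrib sum.distrib sum_distrib_left)

end

lemma parts_linear:
  "init_part x (f + g) = init_part x f + init_part x g"
  "init_part x (f - g) = init_part x f - init_part x g"
  "init_part x (- f) = - init_part x f"
  "init_part x (path_scale c f) = path_scale c (init_part x f)"
  "init_part x 0 = 0"
  "tail_part x (f + g) = tail_part x f + tail_part x g"
  "tail_part x (f - g) = tail_part x f - tail_part x g"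
  "tail_part x (- f) = - tail_part x f"
  "tail_part x (path_scale c f) = path_scale c (tail_part x f)"
  "tail_part x 0 = 0"
  by (rule path_alg_eqI; simp add: path_coeff_parts)+

lemma parts_arrow:
  "init_part x (arrow_elt y) = (if x = y then idem (tgt y) else 0)"
  "tail_part x (arrow_elt y) = (if x = y then idem (src y) else 0)"
  by (rule path_alg_eqI; auto simp: path_coeff_parts path_coeff_arrow_elt path_coeff_idem)+

lemma parts_arrow_mult:
  assumes "src y = tgt z"
  shows "init_part x (arrow_elt y * arrow_elt z) = (if x = z then arrow_elt y else 0)"
    and "tail_part x (arrow_elt y * arrow_elt z) = (if x = y then arrow_elt z else 0)"
proof -
  show "init_part x (arrow_elt y * arrow_elt z) = (if x = z then arrow_elt y else 0)"
    using assms
    by (intro path_alg_eqI) (auto simp: path_coeff_parts path_coeff_mult_arrow_elt path_coeff_arrow_elt)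
  show "tail_part x (arrow_elt y * arrow_elt z) = (if x = y then arrow_elt z else 0)"
    using assms
    by (intro path_alg_eqI) (auto simp: path_coeff_parts path_coeff_arrow_elt_mult path_coeff_arrow_elt)
qed

text \<open>Cochains are additive on \<open>W_p\<close> only, so linearity of the differential uses
  that removing an outer arrow from an element of \<open>W_(p+1)\<close> leads into
  \<open>W_p\<close>. This is checked on the basis and extends to the span.\<close>

lemma koszul_diff_eq:
  fixes b :: "'i :: finite \<Rightarrow> 'f :: field path_alg" and b' :: "'j :: finite \<Rightarrow> 'f path_alg"
  assumes B: "bimodule_family b t s p" and B': "bimodule_family b' t' s' (Suc p)"
    and f: "f \<in> cochains p"
    and parts: "\<And>x j. init_part x (b' j) \<in> koszul_space p" "\<And>x j. tail_part x (b' j) \<in> koszul_space p"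
  shows "koszul_diff p f = cochain_on b' (\<lambda>j. koszul_diff p f (b' j))"
proof -
  interpret B: bimodule_family b t s p by (rule B)
  interpret B': bimodule_family b' t' s' "Suc p" by (rule B')
  have mem: "init_part x w \<in> koszul_space p \<and> tail_part x w \<in> koszul_space p"
    if "w \<in> koszul_space (Suc p)" for x and w :: "'f path_alg"
    using that unfolding B'.space
    by (induction rule: qalg.span_induct_alt)
      (use parts in \<open>auto simp: parts_linear B.space qalg.span_zero intro!: qalg.span_add qalg.span_scale\<close>)
  have sub: "v + w \<in> koszul_space (Suc p)" "path_scale c w \<in> koszul_space (Suc p)"
    if "v \<in> koszul_space (Suc p)" "w \<in> koszul_space (Suc p)" for v w :: "'f path_alg" and c
    using that unfolding B'.space by (auto intro: qalg.span_add qalg.span_scale)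
  show ?thesis
  proof (rule B'.linear_on_eq)
    fix v w :: "'f path_alg" and c
    assume w: "w \<in> koszul_space (Suc p)"
    show "koszul_diff p f (path_scale c w) = preproj_scale c (koszul_diff p f w)"
      using w sub[OF w w] mem[OF w]
      by (simp add: koszul_diff_def parts_linear cochain_additive[OF f] palg.scale_right_diff_distrib
          palg.scale_sum_right sum_distrib_left)
    assume v: "v \<in> koszul_space (Suc p)"
    show "koszul_diff p f (v + w) = koszul_diff p f v + koszul_diff p f w"
      using v w sub[OF v w] mem[OF w] mem[OF v]
      by (simp add: koszul_diff_def parts_linear cochain_additive[OF f] distrib_right distrib_left
          sum.distrib)
  next
    fix w :: "'f path_alg" assume "w \<notin> koszul_space (Suc p)"
    then show "koszul_diff p f w = 0" by (simp add: koszul_diff_def)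
  qed
qed

section \<open>Bases of the bimodules \<open>W_0\<close>, \<open>W_1\<close> and
  \<open>W_2\<close>\<close>

lemma family_idem: "bimodule_family idem (\<lambda>i. i) (\<lambda>i. i) 0"
  by unfold_locales
    (auto simp: independent_idem idem_mult koszul_space_def vertex_space_def)

lemma family_arrow: "bimodule_family arrow_elt tgt src (Suc 0)"
  by unfold_locales
    (auto simp: independent_arrow_elt idem_mult koszul_space_def arrow_space_def)

lemma relator_ends: "idem i * relator i = relator i" "relator i * idem i = relator i"
  by (cases i; simp add: distrib_left distrib_right left_diff_distrib right_diff_distrib idem_mult mult.assoc;
      simp add: idem_mult flip: mult.assoc)+

lemma vertex_mult_rel:
  assumes "a \<in> vertex_space" "r \<in> rel_space"
  shows "a * r \<in> rel_space" "r * a \<in> rel_space"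
proof -
  have l: "a * relator i = path_scale (path_coeff a (i, [])) (relator i)" for i
  proof -
    have "a * relator i = a * idem i * relator i" by (simp add: mult.assoc relator_ends)
    then show ?thesis by (simp add: vertex_space_idem[OF assms(1)] relator_ends)
  qed
  have r: "relator i * a = path_scale (path_coeff a (i, [])) (relator i)" for i
  proof -
    have "relator i * a = relator i * (idem i * a)" by (simp add: relator_ends flip: mult.assoc)
    then show ?thesis by (simp add: vertex_space_idem[OF assms(1)] relator_ends)
  qed
  have "a * r \<in> rel_space \<and> r * a \<in> rel_space"
    using assms(2) unfolding rel_space_def
    by (induction rule: qalg.span_induct_alt)
      (auto simp: distrib_left distrib_right l r intro!: qalg.span_zero qalg.span_add qalg.span_scale
        intro: qalg.span_base[OF rangeI])
  then show "a * r \<in> rel_space" "r * a \<in> rel_space" by auto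
qed

lemma rel_space_subspace: "qalg.subspace rel_space"
  by (simp add: rel_space_def)

lemma tensor_vertex:
  "tensor_k vertex_space rel_space = rel_space" "tensor_k rel_space vertex_space = rel_space"
proof -
  have one: "1 \<in> vertex_space" using one_vertex_space[of 1] by simp
  have "tensor_k vertex_space rel_space \<subseteq> rel_space" "tensor_k rel_space vertex_space \<subseteq> rel_space"
    unfolding tensor_k_def
    by (intro qalg.span_minimal rel_space_subspace; auto intro: vertex_mult_rel)+
  moreover have "r \<in> tensor_k vertex_space rel_space" "r \<in> tensor_k rel_space vertex_space"
    if "r \<in> rel_space" for r
  proof -
    have "1 * r \<in> tensor_k vertex_space rel_space" "r * 1 \<in> tensor_k rel_space vertex_space"
      unfolding tensor_k_def using one that by (blast intro: qalg.span_base)+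
    then show "r \<in> tensor_k vertex_space rel_space" "r \<in> tensor_k rel_space vertex_space" by simp_all
  qed
  ultimately show "tensor_k vertex_space rel_space = rel_space" "tensor_k rel_space vertex_space = rel_space"
    by auto
qed

lemma koszul_space_2: "koszul_space (Suc (Suc 0)) = rel_space"
proof -
  have "{tensor_k (tensor_power i) (tensor_k rel_space (tensor_power j)) | i j. i + 2 + j = Suc (Suc 0)}
      = {tensor_k vertex_space (tensor_k rel_space vertex_space)}"
    by auto
  then show ?thesis by (simp add: koszul_space_def tensor_vertex)
qed

lemma family_relator: "bimodule_family relator (\<lambda>i. i) (\<lambda>i. i) (Suc (Suc 0))"
  by unfold_locales (auto simp: independent_relator relator_ends koszul_space_2 rel_space_def)

text \<open>\<open>W\<^sub>3 = 0\<close>: an element of \<open>V \<otimes> R \<inter> R \<otimes> V\<close> is supported on the paths \<open>x x\<^sup>* x\<close>, and the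
  coefficient of such a path equals, up to sign, that of \<open>y y\<^sup>* x\<close> or of \<open>x y y\<^sup>*\<close> for any other
  arrow \<open>y\<close>, which is not of this form.\<close>

fun star :: "arrow \<Rightarrow> arrow" where
  "star (Fwd e) = Rev e" | "star (Rev e) = Fwd e"

text \<open>With these signs the relation at a vertex is the sum of \<open>arrow_sign y\<close>
  times \<open>y (star y)\<close> over the arrows \<open>y\<close> ending there, so all seven
  relations have one formula.\<close>

fun arrow_sign :: "arrow \<Rightarrow> int" where
  "arrow_sign (Fwd e) = 1" | "arrow_sign (Rev e) = -1"

lemma star_simps [simp]: "src (star x) = tgt x" "tgt (star x) = src x" "star (star x) = x"
  by (cases x; simp)+

definition homogeneous :: "nat \<Rightarrow> 'f :: field path_alg \<Rightarrow> bool" where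
  "homogeneous n f \<longleftrightarrow> (\<forall>t xs. path_coeff f (t, xs) \<noteq> 0 \<longrightarrow> length xs = n)"

text \<open>A homogeneous left factor determines where a path can be cut, so the convolution sum has
  a single term.\<close>

lemma path_coeff_homogeneous_mult:
  assumes "homogeneous n f" "length us = n"
  shows "path_coeff (f * g) (t, us @ vs) = path_coeff f (t, us) * path_coeff g (path_src t us, vs)"
proof -
  have "path_coeff (f * g) (t, us @ vs) =
      (\<Sum>(ys, zs)\<in>{(us, vs)}. path_coeff f (t, ys) * path_coeff g (path_src t ys, zs))"
    unfolding path_coeff_times
  proof (rule sum.mono_neutral_right)
    show "\<forall>p\<in>{(ys, zs). ys @ zs = us @ vs} - {(us, vs)}.
        (case p of (ys, zs) \<Rightarrow> path_coeff f (t, ys) * path_coeff g (path_src t ys, zs)) = 0"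
    proof
      fix p assume p: "p \<in> {(ys, zs). ys @ zs = us @ vs} - {(us, vs)}"
      obtain ys zs where yz: "p = (ys, zs)" by (cases p)
      with p have "ys @ zs = us @ vs" "ys \<noteq> us \<or> zs \<noteq> vs" by auto
      then have "length ys \<noteq> n" using assms(2) by (metis append_eq_append_conv)
      then have "path_coeff f (t, ys) = 0" using assms(1) unfolding homogeneous_def by blast
      then show "(case p of (ys, zs) \<Rightarrow> path_coeff f (t, ys) * path_coeff g (path_src t ys, zs)) = 0"
        by (simp add: yz)
    qed
  qed (auto simp: finite_splits)
  then show ?thesis by simp
qed

lemma homogeneous_arrow_space:
  assumes "f \<in> tensor_power (Suc 0)"
  shows "homogeneous 1 f"
proof -
  have prod: "path_coeff (x * a) (t, xs) = 0" if "x \<in> arrow_space" "a \<in> vertex_space" "length xs \<noteq> 1" for x a t xs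
  proof -
    have "path_coeff x (t, xs) = 0"
      using that(1) unfolding arrow_space_def
      by (induction rule: qalg.span_induct_alt) (use that(3) in \<open>auto simp: path_coeff_arrow_elt split: if_splits\<close>)
    then show ?thesis
      using vertex_space_mult(2)[OF that(2), of x "x * a"] by simp
  qed
  have "path_coeff f (t, xs) = 0" if "length xs \<noteq> 1" for t xs
    using assms unfolding tensor_power.simps tensor_k_def
    by (induction rule: qalg.span_induct_alt) (use that in \<open>auto simp: prod\<close>)
  then show ?thesis unfolding homogeneous_def by blast
qed

lemma relator_coeff:
  "path_coeff (relator i) (t, xs) = (if t = i \<and> (\<exists>y. xs = [y, star y] \<and> tgt y = i)
     then of_int (arrow_sign (hd xs)) else 0)"
proof -
  consider "xs = []" | y where "xs = [y]" | y z where "xs = [y, z]" | y z u us where "xs = y # z # u # us"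
    by (metis list.exhaust)
  then show ?thesis
  proof cases
    case 3
    show ?thesis
      unfolding 3
      by (cases i; cases y; simp add: path_coeff_arrow_elt_mult path_coeff_arrow_elt; cases z; auto elim: edge_tgt.elims edge_src.elims)
  qed (cases i; simp add: path_coeff_arrow_elt_mult path_coeff_arrow_elt)+
qed

lemma rel_space_coeff:
  assumes "r \<in> rel_space"
  shows "\<exists>\<mu>. \<forall>t xs. path_coeff r (t, xs) =
    (if \<exists>y. xs = [y, star y] \<and> tgt y = t then of_int (arrow_sign (hd xs)) * \<mu> t else 0)"
  using assms unfolding rel_space_def
proof (induction rule: qalg.span_induct_alt)
  case base
  show ?case by (rule exI[of _ "\<lambda>_. 0"]) simp
next
  case (step c x y)
  then obtain i \<mu> where x: "x = relator i" and y: "\<forall>t xs. path_coeff y (t, xs) =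
    (if \<exists>y. xs = [y, star y] \<and> tgt y = t then of_int (arrow_sign (hd xs)) * \<mu> t else 0)" by blast
  show ?case
    by (rule exI[of _ "\<lambda>t. (if t = i then c else 0) + \<mu> t"])
      (auto simp: x y relator_coeff algebra_simps)
qed

lemma homogeneous_rel_space:
  assumes "r \<in> rel_space"
  shows "homogeneous 2 r"
proof -
  obtain \<mu> where "\<And>t xs. path_coeff r (t, xs) =
      (if \<exists>y. xs = [y, star y] \<and> tgt y = t then of_int (arrow_sign (hd xs)) * \<mu> t else 0)"
    using rel_space_coeff[OF assms] by blast
  then show ?thesis
    unfolding homogeneous_def by (auto split: if_splits)
qed

lemma homogeneous_mult: "homogeneous m f \<Longrightarrow> homogeneous n g \<Longrightarrow> homogeneous (m + n) (f * g)"
  unfolding homogeneous_def path_coeff_times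
  by (fastforce elim: sum.not_neutral_contains_not_neutral)

lemma arrow_sign_square: "of_int (arrow_sign y) * (of_int (arrow_sign y) * a) = (a :: 'f :: field)"
  by (cases y) simp_all

text \<open>An element of \<open>R\<close> has one scalar for each vertex, so after removal of the
  sign the coefficient of \<open>y (star y) x\<close> is the same for all \<open>y\<close> with a
  common target.\<close>

lemma tensor_rel_arrow_coeff:
  assumes "u \<in> tensor_k rel_space (tensor_power (Suc 0))"
  shows "homogeneous 3 u"
    and "z \<noteq> star y \<Longrightarrow> path_coeff u (t, [y, z, x]) = 0"
    and "tgt y = t \<Longrightarrow> tgt y' = t \<Longrightarrow> of_int (arrow_sign y) * path_coeff u (t, [y, star y, x]) =
      of_int (arrow_sign y') * path_coeff u (t, [y', star y', x])"
proof -
  have "(length xs \<noteq> 3 \<longrightarrow> path_coeff u (t, xs) = 0) \<and>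
    (z \<noteq> star y \<longrightarrow> path_coeff u (t, [y, z, x]) = 0) \<and>
    (tgt y = t \<longrightarrow> tgt y' = t \<longrightarrow> of_int (arrow_sign y) * path_coeff u (t, [y, star y, x]) =
      of_int (arrow_sign y') * path_coeff u (t, [y', star y', x]))" for t xs x y y' z
    using assms unfolding tensor_k_def
  proof (induction rule: qalg.span_induct_alt)
    case (step c w v)
    then obtain r a where w: "w = r * a" "r \<in> rel_space" "a \<in> tensor_power (Suc 0)" by blast
    note hom = homogeneous_rel_space[OF w(2)] homogeneous_arrow_space[OF w(3)]
    obtain \<mu> where r: "\<And>t xs. path_coeff r (t, xs) =
      (if \<exists>y. xs = [y, star y] \<and> tgt y = t then of_int (arrow_sign (hd xs)) * \<mu> t else 0)"
      using rel_space_coeff[OF w(2)] by blast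
    have "length xs \<noteq> 3 \<Longrightarrow> path_coeff w (t, xs) = 0"
      using homogeneous_mult[OF hom] unfolding w(1) homogeneous_def by auto
    moreover have "path_coeff w (t, [y, z, x]) = path_coeff r (t, [y, z]) * path_coeff a (src z, [x])" for y z
      using path_coeff_homogeneous_mult[OF hom(1), of "[y, z]" a t "[x]"] by (simp add: w(1))
    ultimately show ?case
      using step(2) by (auto simp: r algebra_simps arrow_sign_square)
  qed simp
  then show "homogeneous 3 u"
    and "z \<noteq> star y \<Longrightarrow> path_coeff u (t, [y, z, x]) = 0"
    and "tgt y = t \<Longrightarrow> tgt y' = t \<Longrightarrow> of_int (arrow_sign y) * path_coeff u (t, [y, star y, x]) =
      of_int (arrow_sign y') * path_coeff u (t, [y', star y', x])"
    unfolding homogeneous_def by blast+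
qed

lemma tensor_arrow_rel_coeff:
  assumes "u \<in> tensor_k (tensor_power (Suc 0)) rel_space"
  shows "z \<noteq> star y \<Longrightarrow> path_coeff u (t, [x, y, z]) = 0"
    and "tgt y = src x \<Longrightarrow> tgt y' = src x \<Longrightarrow> of_int (arrow_sign y) * path_coeff u (t, [x, y, star y]) =
      of_int (arrow_sign y') * path_coeff u (t, [x, y', star y'])"
proof -
  have "(z \<noteq> star y \<longrightarrow> path_coeff u (t, [x, y, z]) = 0) \<and>
    (tgt y = src x \<longrightarrow> tgt y' = src x \<longrightarrow> of_int (arrow_sign y) * path_coeff u (t, [x, y, star y]) =
      of_int (arrow_sign y') * path_coeff u (t, [x, y', star y']))" for t x y y' z
    using assms unfolding tensor_k_def
  proof (induction rule: qalg.span_induct_alt)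
    case (step c w v)
    then obtain r a where w: "w = a * r" "r \<in> rel_space" "a \<in> tensor_power (Suc 0)" by blast
    note hom = homogeneous_arrow_space[OF w(3)]
    obtain \<mu> where r: "\<And>t xs. path_coeff r (t, xs) =
      (if \<exists>y. xs = [y, star y] \<and> tgt y = t then of_int (arrow_sign (hd xs)) * \<mu> t else 0)"
      using rel_space_coeff[OF w(2)] by blast
    have "path_coeff w (t, [x, y, z]) = path_coeff a (t, [x]) * path_coeff r (src x, [y, z])" for y z
      using path_coeff_homogeneous_mult[OF hom, of "[x]" r t "[y, z]"] by (simp add: w(1))
    then show ?case
      using step(2) by (auto simp: r algebra_simps arrow_sign_square)
  qed simp
  then show "z \<noteq> star y \<Longrightarrow> path_coeff u (t, [x, y, z]) = 0"
    and "tgt y = src x \<Longrightarrow> tgt y' = src x \<Longrightarrow> of_int (arrow_sign y) * path_coeff u (t, [x, y, star y]) =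
      of_int (arrow_sign y') * path_coeff u (t, [x, y', star y'])"
    by blast+
qed

text \<open>Every edge of the diagram has an endpoint of valency at least two. The second arrow at
  that endpoint is what forces the coefficient of \<open>x (star x) x\<close> to vanish.\<close>

lemma other_arrow: "(\<exists>y. y \<noteq> x \<and> tgt y = tgt x) \<or> (\<exists>y. y \<noteq> star x \<and> tgt y = src x)"
proof (cases x)
  case (Fwd e)
  have "\<exists>y. y \<noteq> x \<and> tgt y = tgt x" if "e \<noteq> A5"
    using that unfolding Fwd
    by (cases e) (auto intro: exI[of _ "Fwd A2"] exI[of _ "Rev A2"] exI[of _ "Fwd A0"] exI[of _ "Rev A4"] exI[of _ "Rev A5"])
  moreover have "\<exists>y. y \<noteq> star x \<and> tgt y = src x" if "e = A5"
    using that unfolding Fwd by (auto intro: exI[of _ "Fwd A4"])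
  ultimately show ?thesis by blast
next
  case (Rev e)
  have "\<exists>y. y \<noteq> star x \<and> tgt y = src x" if "e \<noteq> A5"
    using that unfolding Rev
    by (cases e) (auto intro: exI[of _ "Fwd A2"] exI[of _ "Rev A2"] exI[of _ "Fwd A0"] exI[of _ "Rev A4"] exI[of _ "Rev A5"])
  moreover have "\<exists>y. y \<noteq> x \<and> tgt y = tgt x" if "e = A5"
    using that unfolding Rev by (auto intro: exI[of _ "Fwd A4"])
  ultimately show ?thesis by blast
qed

lemma koszul_space_3:
  assumes "w \<in> koszul_space (Suc (Suc (Suc 0)))"
  shows "w = (0 :: 'f :: field path_alg)"
proof -
  let ?T = "\<lambda>i j. tensor_k (tensor_power i) (tensor_k rel_space (tensor_power j)) :: 'f path_alg set"
  from assms have "w \<in> \<Inter> {?T i j | i j. i + 2 + j = Suc (Suc (Suc 0))}"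
    unfolding koszul_space_def by simp
  then have T: "w \<in> ?T i j" if "i + 2 + j = Suc (Suc (Suc 0))" for i j
    using that by blast
  have "w \<in> ?T 0 (Suc 0)" "w \<in> ?T (Suc 0) 0" by (rule T; simp)+
  then have w: "w \<in> tensor_k vertex_space (tensor_k rel_space (tensor_power (Suc 0)))"
    "w \<in> tensor_k (tensor_power (Suc 0)) rel_space"
    by (simp_all only: tensor_power.simps(1) tensor_vertex)
  \<comment> \<open>The extra factor \<open>vertex_space\<close> rescales by one scalar for each
    target, so it preserves the three properties of elements of
    \<open>R \<otimes> V\<close>.\<close>
  have left0: "(length xs \<noteq> 3 \<longrightarrow> path_coeff w (t, xs) = 0) \<and>
      (z \<noteq> star y \<longrightarrow> path_coeff w (t, [y, z, x]) = 0) \<and>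
      (tgt y = t \<longrightarrow> tgt y' = t \<longrightarrow> of_int (arrow_sign y) * path_coeff w (t, [y, star y, x]) =
        of_int (arrow_sign y') * path_coeff w (t, [y', star y', x]))" for t xs x y y' z
    using w(1) unfolding tensor_k_def[of vertex_space]
  proof (induction rule: qalg.span_induct_alt)
    case (step c v w)
    then obtain a u where v: "v = a * u" "a \<in> vertex_space" "u \<in> tensor_k rel_space (tensor_power (Suc 0))" by blast
    note u = tensor_rel_arrow_coeff[OF v(3)]
    have c: "path_coeff v (t, xs) = path_coeff a (t, []) * path_coeff u (t, xs)" for xs
      using vertex_space_mult(1)[OF v(2), of u v] v(1) by blast
    have "length xs \<noteq> 3 \<Longrightarrow> path_coeff u (t, xs) = 0"
      using u(1) unfolding homogeneous_def by blast
    moreover have "of_int e * path_coeff (path_scale c v + w) (t, xs) =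
        c * (path_coeff a (t, []) * (of_int e * path_coeff u (t, xs))) + of_int e * path_coeff w (t, xs)" for e xs
      by (simp add: c algebra_simps)
    ultimately show ?case
      using step(2) u(2)[of z y t x] u(3)[of y t y' x] by (simp add: c)
  qed simp
  have left: "length xs \<noteq> 3 \<Longrightarrow> path_coeff w (t, xs) = 0"
      "z \<noteq> star y \<Longrightarrow> path_coeff w (t, [y, z, x]) = 0"
      "tgt y = t \<Longrightarrow> tgt y' = t \<Longrightarrow> of_int (arrow_sign y) * path_coeff w (t, [y, star y, x]) =
        of_int (arrow_sign y') * path_coeff w (t, [y', star y', x])" for t xs x y y' z
    using left0[of xs t z y x y'] by simp_all
  note right = tensor_arrow_rel_coeff[OF w(2)]
  have sign: "of_int (arrow_sign x) * a = 0 \<Longrightarrow> a = (0 :: 'f)" for x a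
    by (cases x) simp_all
  have "path_coeff w (t, [x, y, z]) = 0" for t x y z
  proof (rule ccontr)
    assume nz: "path_coeff w (t, [x, y, z]) \<noteq> 0"
    have "y = star x" using left(2) nz by metis
    moreover have "z = star y" using right(1) nz by metis
    ultimately have xyz: "y = star x" "z = x" "t = tgt x"
      using path_coeff_is_path[OF nz] by simp_all
    from other_arrow[of x] show False
    proof
      assume "\<exists>y. y \<noteq> x \<and> tgt y = tgt x"
      then obtain v where v: "v \<noteq> x" "tgt v = tgt x" by blast
      \<comment> \<open>Membership in \<open>V \<otimes> R\<close> would require the last arrow to
        be \<open>star (star v)\<close>, which is \<open>v\<close> and differs from
        \<open>x\<close>.\<close>
      then have "path_coeff w (t, [v, star v, x]) = 0" by (intro right(1)) simp
      with left(3)[of x t v x] v(2) xyz(3)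
      have "of_int (arrow_sign x) * path_coeff w (t, [x, star x, x]) = 0" by simp
      with nz sign show False unfolding xyz(1,2) by blast
    next
      assume "\<exists>y. y \<noteq> star x \<and> tgt y = src x"
      then obtain v where v: "v \<noteq> star x" "tgt v = src x" by blast
      \<comment> \<open>Here membership in \<open>R \<otimes> V\<close> fails, since
        \<open>v\<close> is not \<open>star x\<close>.\<close>
      then have "path_coeff w (t, [x, v, star v]) = 0" by (intro left(2))
      with right(2)[of "star x" x v t] v(2)
      have "of_int (arrow_sign (star x)) * path_coeff w (t, [x, star x, x]) = 0" by simp
      with nz sign show False unfolding xyz(1,2) by blast
    qed
  qed
  then have "path_coeff w (t, xs) = 0" for t xs
  proof (cases "length xs = 3")
    case True
    then obtain x y z where "xs = [x, y, z]" by (auto simp: numeral_3_eq_3 length_Suc_conv)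
    then show ?thesis by (simp add: \<open>\<And>z y x t. path_coeff w (t, [x, y, z]) = 0\<close>)
  qed (rule left(1))
  then show ?thesis by (intro path_alg_eqI) simp
qed

lemma koszul_diff_2: "f \<in> cochains (Suc (Suc 0)) \<Longrightarrow> koszul_diff (Suc (Suc 0)) f = (\<lambda>_. 0)"
proof
  fix w assume f: "f \<in> cochains (Suc (Suc 0))"
  have "f 0 = 0"
    by (rule cochain_additive(4)[OF f]) (simp add: koszul_space_2 rel_space_def qalg.span_zero)
  then show "koszul_diff (Suc (Suc 0)) f w = 0"
    by (auto simp: koszul_diff_def parts_linear dest!: koszul_space_3)
qed

section \<open>The Koszul differential in degrees zero and one\<close>

lemma sum_arrows:
  "(\<Sum>x\<in>UNIV. g x) = (\<Sum>e\<in>UNIV. g (Fwd e)) + (\<Sum>e\<in>UNIV. g (Rev e))"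
  unfolding UNIV_arrow by (subst sum.union_disjoint) (auto simp: sum.reindex inj_on_def)

lemma koszul_diff_0:
  assumes "cochain_on idem \<phi> \<in> cochains 0"
  shows "koszul_diff 0 (cochain_on idem \<phi>) =
    cochain_on arrow_elt (\<lambda>x. \<phi> (tgt x) * arr x - arr x * \<phi> (src x) :: 'f :: field preproj)"
proof -
  interpret I: bimodule_family "idem :: _ \<Rightarrow> 'f path_alg" "\<lambda>i. i" "\<lambda>i. i" 0 by (rule family_idem)
  interpret A: bimodule_family "arrow_elt :: _ \<Rightarrow> 'f path_alg" tgt src "Suc 0" by (rule family_arrow)
  have "koszul_diff 0 (cochain_on idem \<phi>) (arrow_elt y) = \<phi> (tgt y) * arr y - arr y * \<phi> (src y)" for y
  proof -
    have "(\<Sum>x\<in>UNIV. cochain_on idem \<phi> (init_part x (arrow_elt y)) * arr x) =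
        (\<Sum>x\<in>UNIV. if x = y then \<phi> (tgt y) * arr x else 0)"
      by (rule sum.cong) (auto simp: parts_arrow)
    moreover have "(\<Sum>x\<in>UNIV. arr x * cochain_on idem \<phi> (tail_part x (arrow_elt y))) =
        (\<Sum>x\<in>UNIV. if x = y then arr x * \<phi> (src y) else 0)"
      by (rule sum.cong) (auto simp: parts_arrow)
    ultimately show ?thesis
      by (simp add: koszul_diff_def A.mem_space)
  qed
  then show ?thesis
    using koszul_diff_eq[OF family_idem family_arrow assms] by (simp add: parts_arrow I.mem_space)
qed

text \<open>In degree one the sign -(-1)^p is positive, so the differential extends a cochain to the
  relations by the Leibniz rule.\<close>

lemma koszul_diff_1:
  assumes "cochain_on arrow_elt \<phi> \<in> cochains (Suc 0)"
  shows "koszul_diff (Suc 0) (cochain_on arrow_elt \<phi>) =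
    cochain_on relator (\<lambda>i. lc (\<lambda>(y, z). \<phi> y * arr z + arr y * \<phi> z)
      (map (\<lambda>(s, y, z). ((y, z), s)) (rel_terms i)) :: 'f :: field preproj)"
proof -
  interpret A: bimodule_family "arrow_elt :: _ \<Rightarrow> 'f path_alg" tgt src "Suc 0" by (rule family_arrow)
  interpret R: bimodule_family "relator :: _ \<Rightarrow> 'f path_alg" "\<lambda>i. i" "\<lambda>i. i" "Suc (Suc 0)"
    by (rule family_relator)
  have "koszul_diff (Suc 0) (cochain_on arrow_elt \<phi>) (relator i) =
      lc (\<lambda>(y, z). \<phi> y * arr z + arr y * \<phi> z) (map (\<lambda>(s, y, z). ((y, z), s)) (rel_terms i))" for i
    using R.mem_space(1)[of i]
    by (cases i) (simp_all add: koszul_diff_def sum_arrows UNIV_edge parts_linear parts_arrow_mult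
        algebra_simps)
  moreover have "init_part x (relator i :: 'f path_alg) \<in> koszul_space (Suc 0)"
    "tail_part x (relator i :: 'f path_alg) \<in> koszul_space (Suc 0)" for x i
    by (cases i; simp add: parts_linear parts_arrow_mult A.mem_space)+
  ultimately show ?thesis
    using koszul_diff_eq[OF family_arrow family_relator assms] by simp
qed

section \<open>The differentials in coordinates\<close>

definition index_set :: "('i \<Rightarrow> vertex) \<Rightarrow> ('i \<Rightarrow> vertex) \<Rightarrow> ('i \<times> int) set" where
  "index_set t s = {q. is_key (snd q) \<and> ptgt (snd q) = t (fst q) \<and> psrc (snd q) = s (fst q)}"

definition basis_cochain :: "('i :: finite \<Rightarrow> 'f :: field path_alg) \<Rightarrow> 'i \<times> int \<Rightarrow> 'f cochain" where
  "basis_cochain b q = cochain_on b ((\<lambda>_. 0)(fst q := bas (snd q)))"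

definition comb_sum :: "('k \<Rightarrow> 'f :: field cochain) \<Rightarrow> 'k set \<Rightarrow> ('k \<Rightarrow> 'f) \<Rightarrow> 'f cochain" where
  "comb_sum E K \<alpha> = (\<lambda>w. \<Sum>k\<in>K. preproj_scale (\<alpha> k) (E k w))"

lemma finite_index_set: "finite (index_set t s :: ('i :: finite \<times> int) set)"
proof (rule finite_subset)
  show "index_set t s \<subseteq> UNIV \<times> keys" by (auto simp: index_set_def keys_def)
  show "finite (UNIV \<times> keys :: ('i \<times> int) set)" by (simp add: finite_keys)
qed

lemma sum_cochain_on:
  "(\<lambda>w. \<Sum>k\<in>K. preproj_scale (\<alpha> k) (cochain_on b (\<Phi> k) w)) =
    cochain_on b (\<lambda>i. \<Sum>k\<in>K. preproj_scale (\<alpha> k) (\<Phi> k i))"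
proof
  fix w
  have "(\<Sum>k\<in>K. preproj_scale (\<alpha> k) (cochain_on b (\<Phi> k) w)) =
      (\<Sum>k\<in>K. \<Sum>i\<in>UNIV. preproj_scale (qalg.representation (range b) w (b i)) (preproj_scale (\<alpha> k) (\<Phi> k i)))"
    by (simp add: cochain_on_def palg.scale_sum_right mult.commute)
  also have "\<dots> = cochain_on b (\<lambda>i. \<Sum>k\<in>K. preproj_scale (\<alpha> k) (\<Phi> k i)) w"
    unfolding cochain_on_def palg.scale_sum_right by (rule sum.swap)
  finally show "(\<Sum>k\<in>K. preproj_scale (\<alpha> k) (cochain_on b (\<Phi> k) w)) =
      cochain_on b (\<lambda>i. \<Sum>k\<in>K. preproj_scale (\<alpha> k) (\<Phi> k i)) w" .
qed

context bimodule_family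
begin

abbreviation "K \<equiv> index_set t s"
abbreviation "E \<equiv> basis_cochain b"

lemma comb_sum_eq: "comb_sum E K \<alpha> =
    cochain_on b (\<lambda>i. \<Sum>q\<in>K. preproj_scale (\<alpha> q) (((\<lambda>_. 0)(fst q := bas (snd q))) i))"
  unfolding comb_sum_def basis_cochain_def by (rule sum_cochain_on)

lemma basis_cochain_mem: "q \<in> K \<Longrightarrow> E q \<in> cochains p"
  unfolding basis_cochain_def by (rule cochain_on_mem) (auto simp: index_set_def bas_ends)

lemma comb_sum_mem: "comb_sum E K \<alpha> \<in> cochains p"
  unfolding comb_sum_eq
  by (rule cochain_on_mem)
    (auto simp: sum_distrib_left sum_distrib_right index_set_def bas_ends intro!: sum.cong)

lemma comb_sum_coord:
  assumes "q \<in> K"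
  shows "coord (comb_sum E K \<alpha> (b (fst q))) (snd q) = \<alpha> q"
proof -
  have "coord (comb_sum E K \<alpha> (b (fst q))) (snd q) =
      (\<Sum>q'\<in>K. if q' = q then \<alpha> q' else 0)"
    unfolding comb_sum_eq cochain_on_b coord_linear
    by (rule sum.cong) (use assms in \<open>auto simp: index_set_def coord_linear coord_bas prod_eq_iff\<close>)
  then show ?thesis using assms by (simp add: finite_index_set)
qed

lemma comb_sum_zero: "comb_sum E K \<alpha> = (\<lambda>_. 0) \<Longrightarrow> q \<in> K \<Longrightarrow> \<alpha> q = 0"
  using comb_sum_coord[of q \<alpha>] by (simp add: coord_linear)

text \<open>The value at \<open>b i\<close> is fixed by the idempotents at the ends of
  \<open>b i\<close>, so only basis paths parallel to \<open>b i\<close> occur in its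
  expansion.\<close>

lemma cochain_comb_sum:
  assumes "f \<in> cochains p"
  shows "f = comb_sum E K (\<lambda>q. coord (f (b (fst q))) (snd q))"
proof -
  have val: "f (b i) = (\<Sum>q\<in>K. preproj_scale (coord (f (b (fst q))) (snd q)) (((\<lambda>_. 0)(fst q := bas (snd q))) i))"
    (is "_ = ?r") for i
  proof -
    have "f (b i) = vx (t i) * (\<Sum>k\<in>keys. preproj_scale (coord (f (b i)) k) (bas k)) * vx (s i)"
      using cochain_eq(2)[OF assms, of i] expand_bas[of "f (b i)"] by simp
    also have "\<dots> = (\<Sum>k\<in>keys. if ptgt k = t i \<and> psrc k = s i then preproj_scale (coord (f (b i)) k) (bas k) else 0)"
      unfolding sum_distrib_left sum_distrib_right
      by (rule sum.cong) (auto simp: keys_def bas_ends)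
    also have "\<dots> = (\<Sum>k\<in>{k \<in> keys. ptgt k = t i \<and> psrc k = s i}. preproj_scale (coord (f (b i)) k) (bas k))"
      by (rule sum.inter_filter[symmetric, OF finite_keys])
    also have "\<dots> = (\<Sum>q\<in>{q \<in> K. fst q = i}. preproj_scale (coord (f (b (fst q))) (snd q)) (bas (snd q)))"
      by (rule sum.reindex_bij_witness[where i = snd and j = "\<lambda>k. (i, k)"])
        (auto simp: index_set_def keys_def)
    also have "\<dots> = ?r"
      by (rule sum.mono_neutral_cong_left) (auto simp: finite_index_set)
    finally show ?thesis .
  qed
  have "cochain_on b (\<lambda>i. f (b i)) = comb_sum E K (\<lambda>q. coord (f (b (fst q))) (snd q))"
    unfolding comb_sum_eq by (intro arg_cong[where f = "cochain_on b"] ext val)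
  with cochain_eq(1)[OF assms] show ?thesis by (rule trans)
qed

lemma cochain_ex_comb_sum: "f \<in> cochains p \<Longrightarrow> \<exists>\<alpha>. f = comb_sum E K \<alpha>"
  by (rule exI, rule cochain_comb_sum)

lemma lc_basis_cochain:
  "(\<lambda>w. lc (\<lambda>q. E q w) c) = cochain_on b (\<lambda>i. lc (\<lambda>q. if i = fst q then bas (snd q) else 0) c)"
  unfolding basis_cochain_def cochain_on_lc by (rule arg_cong[where f = "cochain_on b"]) (simp add: fun_upd_def)

end

section \<open>Integer matrices of the two differentials\<close>

fun tag :: "'i \<Rightarrow> int comb \<Rightarrow> ('i \<times> int) comb" where
  "tag x [] = []"
| "tag x ((k, a) # c) = ((x, k), a) # tag x c"

lemma lc_tag: "lc g (tag x c) = lc (\<lambda>k. g (x, k)) c"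
  by (induction x c rule: tag.induct) auto

lemma set_tag: "(q, a) \<in> set (tag x c) \<longleftrightarrow> fst q = x \<and> (snd q, a) \<in> set c"
  by (induction x c rule: tag.induct) auto

fun tags :: "(arrow \<Rightarrow> int comb) \<Rightarrow> arrow list \<Rightarrow> (arrow \<times> int) comb" where
  "tags f [] = []"
| "tags f (x # xs) = tag x (f x) @ tags f xs"

text \<open>A cochain supported at \<open>v\<close> is seen by the arrows ending at \<open>v\<close>
  through right multiplication and by those starting at \<open>v\<close> through left
  multiplication, with the commutator sign.\<close>

fun d0 :: "vertex \<times> int \<Rightarrow> (arrow \<times> int) comb" where
  "d0 (v, k) = tags (\<lambda>x. rmul x k) (in_arrows v) @ cscale (-1) (tags (\<lambda>x. lmul x k) (out_arrows v))"

text \<open>An arrow \<open>x\<close> occurs in exactly two relation terms: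
  \<open>x (star x)\<close> at its target and \<open>(star x) x\<close> at its source. Each has the
  sign of its left factor.\<close>

fun d1 :: "arrow \<times> int \<Rightarrow> (vertex \<times> int) comb" where
  "d1 (x, k) = cscale (arrow_sign x) (tag (tgt x) (rmul (star x) k)) @
    cscale (arrow_sign (star x)) (tag (src x) (lmul (star x) k))"

lemma lc_tags:
  assumes "distinct xs"
  shows "lc (\<lambda>q. if x = fst q then g (snd q) else 0) (tags f xs) = (if x \<in> set xs then lc g (f x) else 0)"
proof -
  have "lc (\<lambda>q. if x = fst q then g (snd q) else 0) (tag y c) = (if x = y then lc g c else 0)" for y c
    by (simp add: lc_tag)
  then show ?thesis using assms by (induction xs) auto
qed

lemma set_tags: "(q, a) \<in> set (tags f xs) \<longleftrightarrow> fst q \<in> set xs \<and> (snd q, a) \<in> set (f (fst q))"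
  by (induction xs) (auto simp: set_tag)

abbreviation "K0 \<equiv> index_set (\<lambda>v. v) (\<lambda>v. v)"
abbreviation "K1 \<equiv> index_set tgt src"

lemma d0_index: "k \<in> K0 \<Longrightarrow> (q, a) \<in> set (d0 k) \<Longrightarrow> q \<in> K1"
  using lmul_keys[of "snd q" _ "fst q" "snd k"] rmul_keys[of "snd k" "snd q" _ "fst q"]
  by (cases k) (fastforce simp: index_set_def set_tags set_arrows dest!: set_cscale)

lemma d1_index: "k \<in> K1 \<Longrightarrow> (q, a) \<in> set (d1 k) \<Longrightarrow> q \<in> K0"
  using lmul_keys[of "snd q" _ "star (fst k)" "snd k"] rmul_keys[of "snd k" "snd q" _ "star (fst k)"]
  by (cases k) (fastforce simp: index_set_def set_tag dest!: set_cscale)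

lemma koszul_diff_basis_0:
  assumes "k \<in> K0"
  shows "koszul_diff 0 (basis_cochain idem k) =
    (\<lambda>w. lc (\<lambda>q. basis_cochain arrow_elt q w) (d0 k) :: 'f :: field preproj)"
proof -
  interpret I: bimodule_family "idem :: _ \<Rightarrow> 'f path_alg" "\<lambda>i. i" "\<lambda>i. i" 0 by (rule family_idem)
  interpret A: bimodule_family "arrow_elt :: _ \<Rightarrow> 'f path_alg" tgt src "Suc 0" by (rule family_arrow)
  obtain v n where k: "k = (v, n)" by (cases k)
  have n: "is_key n" using assms by (simp add: k index_set_def)
  have dist: "distinct (in_arrows v)" "distinct (out_arrows v)" by (cases v; simp)+
  have "((\<lambda>_. 0)(v := bas n)) (tgt x) * arr x - arr x * ((\<lambda>_. 0)(v := bas n)) (src x) =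
      (lc (\<lambda>q. if x = fst q then bas (snd q) else 0) (d0 (v, n)) :: 'f preproj)" for x
    using assms by (auto simp: k index_set_def lc_tags[OF dist(1)] lc_tags[OF dist(2)] set_arrows bas_arr[OF n] arr_bas[OF n])
  then show ?thesis
    unfolding A.lc_basis_cochain
    using koszul_diff_0[OF I.basis_cochain_mem[OF assms, unfolded basis_cochain_def]]
    by (simp add: basis_cochain_def k)
qed

lemma koszul_diff_basis_1:
  assumes "k \<in> K1"
  shows "koszul_diff (Suc 0) (basis_cochain arrow_elt k) =
    (\<lambda>w. lc (\<lambda>q. basis_cochain relator q w) (d1 k) :: 'f :: field preproj)"
proof -
  interpret A: bimodule_family "arrow_elt :: _ \<Rightarrow> 'f path_alg" tgt src "Suc 0" by (rule family_arrow)
  interpret R: bimodule_family "relator :: _ \<Rightarrow> 'f path_alg" "\<lambda>i. i" "\<lambda>i. i" "Suc (Suc 0)"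
    by (rule family_relator)
  obtain x n where k: "k = (x, n)" by (cases k)
  have n: "is_key n" "psrc n = src x" using assms by (simp_all add: k index_set_def)
  let ?\<phi> = "(\<lambda>_. 0)(x := bas n) :: arrow \<Rightarrow> 'f preproj"
  have "lc (\<lambda>k. if i = y then bas k else 0) c = (if i = y then lc bas c else 0 :: 'f preproj)"
    for i y :: vertex and c by simp
  then have rhs: "lc (\<lambda>q. if i = fst q then bas (snd q) else 0) (d1 (x, n)) =
      (if i = tgt x then of_int (arrow_sign x) * (bas n * arr (star x)) else 0) +
      (if i = src x then of_int (arrow_sign (star x)) * (arr (star x) * bas n) else 0 :: 'f preproj)" for i
    by (simp add: lc_tag bas_arr[OF n(1)] arr_bas[OF n(1)] n(2))
  have "lc (\<lambda>(y, z). ?\<phi> y * arr z + arr y * ?\<phi> z) (map (\<lambda>(s, y, z). ((y, z), s)) (rel_terms i)) =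
      lc (\<lambda>q. if i = fst q then bas (snd q) else 0) (d1 (x, n))" for i
    unfolding rhs
  proof (cases x)
    case (Fwd e)
    then show "lc (\<lambda>(y, z). ?\<phi> y * arr z + arr y * ?\<phi> z) (map (\<lambda>(s, y, z). ((y, z), s)) (rel_terms i)) =
      (if i = tgt x then of_int (arrow_sign x) * (bas n * arr (star x)) else 0) +
      (if i = src x then of_int (arrow_sign (star x)) * (arr (star x) * bas n) else 0 :: 'f preproj)"
      by (cases e; cases i; simp)
  next
    case (Rev e)
    then show "lc (\<lambda>(y, z). ?\<phi> y * arr z + arr y * ?\<phi> z) (map (\<lambda>(s, y, z). ((y, z), s)) (rel_terms i)) =
      (if i = tgt x then of_int (arrow_sign x) * (bas n * arr (star x)) else 0) +
      (if i = src x then of_int (arrow_sign (star x)) * (arr (star x) * bas n) else 0 :: 'f preproj)"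
      by (cases e; cases i; simp)
  qed
  then show ?thesis
    unfolding R.lc_basis_cochain
    using koszul_diff_1[OF A.basis_cochain_mem[OF assms, unfolded basis_cochain_def]]
    by (simp add: basis_cochain_def k)
qed

definition comb_coeff :: "'k comb \<Rightarrow> 'k \<Rightarrow> 'f :: field" where
  "comb_coeff c m = lc (\<lambda>k. if k = m then 1 else 0) c"

lemma lc_comb_coeff:
  assumes "finite M" "\<And>k a. (k, a) \<in> set c \<Longrightarrow> k \<in> M"
  shows "lc g c = (\<Sum>m\<in>M. preproj_scale (comb_coeff c m) (g m))"
  using assms(2)
proof (induction c)
  case (Cons q c)
  obtain k a where q: "q = (k, a)" by (cases q)
  have "k \<in> M" using Cons.prems[of k a] by (simp add: q)
  have "(\<Sum>m\<in>M. preproj_scale (comb_coeff (q # c) m) (g m)) =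
      (\<Sum>m\<in>M. (if m = k then of_int a * g m else 0) + preproj_scale (comb_coeff c m) (g m))"
    by (rule sum.cong) (auto simp: comb_coeff_def q palg.scale_left_distrib scale_of_int)
  also have "\<dots> = of_int a * g k + (\<Sum>m\<in>M. preproj_scale (comb_coeff c m) (g m))"
    using \<open>k \<in> M\<close> assms(1) by (simp add: sum.distrib)
  also have "(\<Sum>m\<in>M. preproj_scale (comb_coeff c m) (g m)) = lc g c"
    by (rule Cons.IH[symmetric]) (meson Cons.prems list.set_intros(2))
  finally show ?case
    by (simp add: q)
qed (simp add: comb_coeff_def)

text \<open>Exchanging the two summations is application of the matrix \<open>D\<close> to the
  coefficient vector.\<close>

lemma comb_sum_lc:
  assumes "finite K'" "\<And>k q a. k \<in> K \<Longrightarrow> (q, a) \<in> set (D k) \<Longrightarrow> q \<in> K'"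
  shows "(\<lambda>w. \<Sum>k\<in>K. preproj_scale (\<alpha> k) (lc (\<lambda>q. E' q w) (D k))) =
    comb_sum E' K' (\<lambda>q. \<Sum>k\<in>K. \<alpha> k * comb_coeff (D k) q)"
proof
  fix w
  have "(\<Sum>k\<in>K. preproj_scale (\<alpha> k) (lc (\<lambda>q. E' q w) (D k))) =
      (\<Sum>k\<in>K. \<Sum>q\<in>K'. preproj_scale (\<alpha> k * comb_coeff (D k) q) (E' q w))"
    using assms by (intro sum.cong) (simp_all add: lc_comb_coeff[of K'] palg.scale_sum_right)
  also have "\<dots> = comb_sum E' K' (\<lambda>q. \<Sum>k\<in>K. \<alpha> k * comb_coeff (D k) q) w"
    unfolding comb_sum_def by (subst sum.swap) (simp add: palg.scale_sum_left)
  finally show "(\<Sum>k\<in>K. preproj_scale (\<alpha> k) (lc (\<lambda>q. E' q w) (D k))) =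
    comb_sum E' K' (\<lambda>q. \<Sum>k\<in>K. \<alpha> k * comb_coeff (D k) q) w" .
qed

section \<open>Bases of Koszul cohomology\<close>

lemma koszul_diff_linear:
  "koszul_diff p (\<lambda>w. f w + g w) = (\<lambda>w. koszul_diff p f w + koszul_diff p g w)"
  "koszul_diff p (\<lambda>w. preproj_scale c (f w)) = (\<lambda>w. preproj_scale c (koszul_diff p f w))"
  "koszul_diff p (\<lambda>w. 0) = (\<lambda>w. 0)"
  by (auto simp: koszul_diff_def distrib_left distrib_right sum.distrib fun_eq_iff
      palg.scale_right_diff_distrib palg.scale_sum_right sum_distrib_left)

lemma cochains_linear:
  "(\<lambda>w. 0) \<in> cochains p"
  "f \<in> cochains p \<Longrightarrow> g \<in> cochains p \<Longrightarrow> (\<lambda>w. f w + g w) \<in> cochains p"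
  "f \<in> cochains p \<Longrightarrow> (\<lambda>w. preproj_scale c (f w)) \<in> cochains p"
  by (auto simp: cochains_def distrib_left distrib_right palg.scale_right_distrib)

lemma cocycles_linear:
  "(\<lambda>w. 0) \<in> cocycles p"
  "f \<in> cocycles p \<Longrightarrow> g \<in> cocycles p \<Longrightarrow> (\<lambda>w. f w + g w) \<in> cocycles p"
  "f \<in> cocycles p \<Longrightarrow> (\<lambda>w. preproj_scale c (f w)) \<in> cocycles p"
  by (auto simp: cocycles_def cochains_linear koszul_diff_linear)

lemma coboundaries_linear:
  "(\<lambda>w. 0) \<in> coboundaries p"
  "f \<in> coboundaries p \<Longrightarrow> g \<in> coboundaries p \<Longrightarrow> (\<lambda>w. f w + g w) \<in> coboundaries p"
  "f \<in> coboundaries p \<Longrightarrow> (\<lambda>w. preproj_scale c (f w)) \<in> coboundaries p"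
proof -
  show "(\<lambda>w. 0) \<in> coboundaries p"
    by (cases p) (auto simp: koszul_diff_linear cochains_linear intro!: image_eqI[of _ _ "\<lambda>w. 0"])
  show "(\<lambda>w. f w + g w) \<in> coboundaries p" if "f \<in> coboundaries p" "g \<in> coboundaries p"
  proof (cases p)
    case (Suc q)
    with that obtain f' g' where "f' \<in> cochains q" "g' \<in> cochains q"
      "f = koszul_diff q f'" "g = koszul_diff q g'" by auto
    then show ?thesis
      using Suc by (auto simp: koszul_diff_linear cochains_linear intro!: image_eqI[of _ _ "\<lambda>w. f' w + g' w"])
  qed (use that in auto)
  show "(\<lambda>w. preproj_scale c (f w)) \<in> coboundaries p" if "f \<in> coboundaries p"
  proof (cases p)
    case (Suc q)
    with that obtain f' where "f' \<in> cochains q" "f = koszul_diff q f'" by auto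
    then show ?thesis
      using Suc by (auto simp: koszul_diff_linear cochains_linear intro!: image_eqI[of _ _ "\<lambda>w. preproj_scale c (f' w)"])
  qed (use that in auto)
qed

lemma coboundaries_diff:
  assumes "f \<in> coboundaries p" "g \<in> coboundaries p"
  shows "(\<lambda>w. f w - g w) \<in> coboundaries p"
  using coboundaries_linear(2)[OF assms(1) coboundaries_linear(3)[OF assms(2), of "-1"]] by simp

lemma cohomology_class_mem: "h \<in> cohomology_class p f \<longleftrightarrow> (\<lambda>w. h w - f w) \<in> coboundaries p"
proof -
  have "cohomology_class p f = (\<Union>b\<in>coboundaries p. {\<lambda>w. b w + f w})"
    by (simp add: cohomology_class_def a_r_coset_def' cocycle_module_def)
  then show ?thesis by (force simp: fun_eq_iff)
qed

lemma cohomology_class_eq: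
  "cohomology_class p f = cohomology_class p g \<longleftrightarrow> (\<lambda>w. f w - g w) \<in> coboundaries p"
proof
  assume "cohomology_class p f = cohomology_class p g"
  moreover have "f \<in> cohomology_class p f" by (simp add: cohomology_class_mem coboundaries_linear)
  ultimately show "(\<lambda>w. f w - g w) \<in> coboundaries p" by (simp add: cohomology_class_mem)
next
  assume fg: "(\<lambda>w. f w - g w) \<in> coboundaries p"
  show "cohomology_class p f = cohomology_class p g"
  proof (intro Set.set_eqI)
    fix h
    show "h \<in> cohomology_class p f \<longleftrightarrow> h \<in> cohomology_class p g"
      unfolding cohomology_class_mem
      using coboundaries_linear(2)[OF _ fg, of "\<lambda>w. h w - f w"]
        coboundaries_diff[OF _ fg, of "\<lambda>w. h w - g w"] by auto
  qed
qed

text \<open>The quotient operations are unions over cosets; closure of the coboundaries under sums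
  and scalings lets them be computed on representatives.\<close>

lemma HK_simps:
  "carrier (HK p) = cohomology_class p ` cocycles p"
  "\<zero>\<^bsub>HK p\<^esub> = cohomology_class p (\<lambda>w. 0)"
  "cohomology_class p f \<oplus>\<^bsub>HK p\<^esub> cohomology_class p g = cohomology_class p (\<lambda>w. f w + g w)"
  "c \<odot>\<^bsub>HK p\<^esub> cohomology_class p f = cohomology_class p (\<lambda>w. preproj_scale c (f w))"
proof -
  show "carrier (HK p) = cohomology_class p ` cocycles p"
    by (auto simp: HK_def quotient_module_def A_RCOSETS_def' cohomology_class_def cocycle_module_def)
  show "\<zero>\<^bsub>HK p\<^esub> = cohomology_class p (\<lambda>w. 0)"
    by (auto simp: HK_def quotient_module_def cohomology_class_mem)
  have "cohomology_class p f \<oplus>\<^bsub>HK p\<^esub> cohomology_class p g =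
      (\<Union>h\<in>cohomology_class p f. \<Union>k\<in>cohomology_class p g. {\<lambda>w. h w + k w})"
    by (simp add: HK_def quotient_module_def set_add_def' cocycle_module_def)
  also have "\<dots> = cohomology_class p (\<lambda>w. f w + g w)"
  proof (intro Set.set_eqI iffI)
    fix h assume "h \<in> (\<Union>h\<in>cohomology_class p f. \<Union>k\<in>cohomology_class p g. {\<lambda>w. h w + k w})"
    then obtain u v where "(\<lambda>w. u w - f w) \<in> coboundaries p" "(\<lambda>w. v w - g w) \<in> coboundaries p"
      "h = (\<lambda>w. u w + v w)" by (auto simp: cohomology_class_mem)
    with coboundaries_linear(2)[of "\<lambda>w. u w - f w" p "\<lambda>w. v w - g w"]
    show "h \<in> cohomology_class p (\<lambda>w. f w + g w)" by (simp add: cohomology_class_mem algebra_simps)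
  next
    fix h assume "h \<in> cohomology_class p (\<lambda>w. f w + g w)"
    then have "(\<lambda>w. h w - g w) \<in> cohomology_class p f" by (simp add: cohomology_class_mem algebra_simps)
    moreover have "g \<in> cohomology_class p g" by (simp add: cohomology_class_mem coboundaries_linear)
    ultimately show "h \<in> (\<Union>h\<in>cohomology_class p f. \<Union>k\<in>cohomology_class p g. {\<lambda>w. h w + k w})"
      by force
  qed
  finally show "cohomology_class p f \<oplus>\<^bsub>HK p\<^esub> cohomology_class p g = cohomology_class p (\<lambda>w. f w + g w)" .
  have "c \<odot>\<^bsub>HK p\<^esub> cohomology_class p f =
      (\<Union>h\<in>cohomology_class p f. cohomology_class p (\<lambda>w. preproj_scale c (h w)))"
    by (simp add: HK_def quotient_module_def cohomology_class_def cocycle_module_def)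
  also have "\<dots> = (\<Union>h\<in>cohomology_class p f. cohomology_class p (\<lambda>w. preproj_scale c (f w)))"
  proof (rule SUP_cong)
    fix h assume "h \<in> cohomology_class p f"
    then have "(\<lambda>w. preproj_scale c (h w - f w)) \<in> coboundaries p"
      by (intro coboundaries_linear(3)) (simp add: cohomology_class_mem)
    then show "cohomology_class p (\<lambda>w. preproj_scale c (h w)) = cohomology_class p (\<lambda>w. preproj_scale c (f w))"
      by (simp add: cohomology_class_eq palg.scale_right_diff_distrib)
  qed simp
  also have "\<dots> = cohomology_class p (\<lambda>w. preproj_scale c (f w))"
    using cohomology_class_mem[of f p f] coboundaries_linear(1)[of p] by auto
  finally show "c \<odot>\<^bsub>HK p\<^esub> cohomology_class p f = cohomology_class p (\<lambda>w. preproj_scale c (f w))" .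
qed

lemma HK_vectorspace: "vectorspace (class_ring :: 'f :: field ring) (HK p)"
proof -
  let ?c = "cohomology_class p"
  have "abelian_group (HK p :: ('f, 'f cochain set) module)"
  proof (rule abelian_groupI)
    fix x :: "'f cochain set" assume "x \<in> carrier (HK p)"
    then obtain f where f: "f \<in> cocycles p" "x = ?c f" by (auto simp: HK_simps)
    have "?c (\<lambda>w. preproj_scale (-1) (f w)) \<oplus>\<^bsub>HK p\<^esub> x = \<zero>\<^bsub>HK p\<^esub>"
      by (simp add: f HK_simps)
    then show "\<exists>y\<in>carrier (HK p). y \<oplus>\<^bsub>HK p\<^esub> x = \<zero>\<^bsub>HK p\<^esub>"
      using cocycles_linear(3)[OF f(1), of "-1"] by (auto simp: HK_simps(1))
  qed (auto simp: HK_simps ac_simps intro!: imageI cocycles_linear)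
  then have "Module.module (class_ring :: 'f ring) (HK p)"
    by (intro moduleI class_cring.cring_axioms)
      (auto simp: HK_simps palg.scale_left_distrib palg.scale_right_distrib intro!: imageI cocycles_linear)
  then show ?thesis
    by (simp add: vectorspace_def class_field)
qed

text \<open>A basis of classes is reduced to two statements about cochains modulo coboundaries.
  Distinctness of the classes is itself a case of independence.\<close>

lemma HK_basisI:
  fixes fs :: "'f :: field cochain list"
  assumes sub: "coboundaries p \<subseteq> (cocycles p :: 'f cochain set)" and fs: "set fs \<subseteq> cocycles p"
    and indep: "\<And>c i. (\<lambda>w. \<Sum>i<length fs. preproj_scale (c i) ((fs ! i) w)) \<in> coboundaries p \<Longrightarrow>
      i < length fs \<Longrightarrow> c i = 0"
    and span: "\<And>f. f \<in> cocycles p \<Longrightarrow>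
      \<exists>c. (\<lambda>w. f w - (\<Sum>i<length fs. preproj_scale (c i) ((fs ! i) w))) \<in> coboundaries p"
  shows "HK_basis p fs"
proof -
  let ?n = "length fs"
  let ?cl = "\<lambda>i. cohomology_class p (fs ! i)"
  interpret HK: vectorspace "class_ring :: 'f ring" "HK p" by (rule HK_vectorspace)
  have cl_mem: "?cl i \<in> carrier (HK p)" if "i < ?n" for i
    unfolding HK_simps by (rule imageI) (use that fs in auto)
  have inj: "inj_on ?cl {..<?n}"
  proof (rule inj_onI)
    fix i j assume ij: "i \<in> {..<?n}" "j \<in> {..<?n}" "?cl i = ?cl j"
    show "i = j"
    proof (rule ccontr)
      assume "i \<noteq> j"
      \<comment> \<open>Two equal classes would give the relation with coefficients 1 and
        -1.\<close>
      let ?c = "\<lambda>k. if k = i then 1 else if k = j then -1 else 0 :: 'f"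
      have "(\<Sum>k<?n. preproj_scale (?c k) ((fs ! k) w)) = (fs ! i) w - (fs ! j) w" for w
      proof -
        have "(\<Sum>k<?n. preproj_scale (?c k) ((fs ! k) w)) = (\<Sum>k\<in>{i, j}. preproj_scale (?c k) ((fs ! k) w))"
          by (rule sum.mono_neutral_right) (use ij in auto)
        then show ?thesis using \<open>i \<noteq> j\<close> by simp
      qed
      then have "(\<lambda>w. \<Sum>k<?n. preproj_scale (?c k) ((fs ! k) w)) \<in> coboundaries p"
        using ij(3) by (simp add: cohomology_class_eq)
      from indep[OF this, of i] ij(1) show False by simp
    qed
  qed
  have lincomb: "HK.lincomb a (?cl ` I) =
      cohomology_class p (\<lambda>w. \<Sum>i\<in>I. preproj_scale (a (?cl i)) ((fs ! i) w))" if "I \<subseteq> {..<?n}" for a I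
  proof -
    have "finite I" using that finite_subset by blast
    then show ?thesis using that
    proof (induction I)
      case empty
      then show ?case by (simp add: HK.lincomb_def HK_simps)
    next
      case (insert i I)
      have "?cl i \<notin> ?cl ` I"
        using inj_on_image_mem_iff[OF inj, of i I] insert.hyps(2) insert.prems by simp
      moreover have "(\<lambda>v. a v \<odot>\<^bsub>HK p\<^esub> v) \<in> ?cl ` I \<rightarrow> carrier (HK p)"
        "a (?cl i) \<odot>\<^bsub>HK p\<^esub> ?cl i \<in> carrier (HK p)"
        using insert.prems cl_mem by (auto intro!: HK.smult_closed)
      ultimately have "HK.lincomb a (?cl ` insert i I) =
          a (?cl i) \<odot>\<^bsub>HK p\<^esub> ?cl i \<oplus>\<^bsub>HK p\<^esub> HK.lincomb a (?cl ` I)"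
        using insert.hyps(1) by (simp add: HK.lincomb_def HK.M.finsum_insert)
      then show ?case
        using insert by (simp add: HK_simps)
    qed
  qed
  have set_eq: "set (map (cohomology_class p) fs) = ?cl ` {..<?n}"
    unfolding set_map by (subst set_conv_nth) auto
  have "distinct (map (cohomology_class p) fs)"
    using inj by (auto simp: distinct_conv_nth inj_on_def)
  moreover have "HK.lin_indpt (?cl ` {..<?n})"
  proof
    assume "HK.lin_dep (?cl ` {..<?n})"
    then obtain A a v where A: "A \<subseteq> ?cl ` {..<?n}" "HK.lincomb a A = \<zero>\<^bsub>HK p\<^esub>" "v \<in> A" "a v \<noteq> 0"
      unfolding HK.lin_dep_def by auto
    \<comment> \<open>A linear dependence may involve only some of the classes; it is pulled back to
      indices and extended by zero.\<close>
    define I where "I = {i. i < ?n \<and> ?cl i \<in> A}"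
    have "A = ?cl ` I" "I \<subseteq> {..<?n}" using A(1) by (auto simp: I_def)
    with A(2) lincomb[of I a]
    have "(\<lambda>w. \<Sum>i\<in>I. preproj_scale (a (?cl i)) ((fs ! i) w)) \<in> coboundaries p"
      by (simp add: HK_simps cohomology_class_eq)
    moreover have "(\<Sum>i<?n. preproj_scale (if i \<in> I then a (?cl i) else 0) ((fs ! i) w)) =
        (\<Sum>i\<in>I. preproj_scale (a (?cl i)) ((fs ! i) w))" for w
      by (rule sum.mono_neutral_cong_right) (auto simp: I_def)
    ultimately have zero: "(if i \<in> I then a (?cl i) else 0) = 0" if "i < ?n" for i
      using that by (intro indep[of "\<lambda>i. if i \<in> I then a (?cl i) else 0"]) simp_all
    obtain i where i: "i \<in> I" "v = ?cl i" using A(3) \<open>A = ?cl ` I\<close> by blast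
    with zero[of i] A(4) show False by (simp add: I_def)
  qed
  moreover have "HK.span (?cl ` {..<?n}) = carrier (HK p)"
  proof
    show "HK.span (?cl ` {..<?n}) \<subseteq> carrier (HK p)"
      by (rule HK.span_is_subset2) (use cl_mem in auto)
    show "carrier (HK p) \<subseteq> HK.span (?cl ` {..<?n})"
    proof
      fix x :: "'f cochain set" assume "x \<in> carrier (HK p)"
      then obtain f where f: "f \<in> cocycles p" "x = cohomology_class p f" by (auto simp: HK_simps)
      obtain c where "(\<lambda>w. f w - (\<Sum>i<?n. preproj_scale (c i) ((fs ! i) w))) \<in> coboundaries p"
        using span[OF f(1)] by blast
      then have x: "x = cohomology_class p (\<lambda>w. \<Sum>i<?n. preproj_scale (c i) ((fs ! i) w))"
        unfolding f(2) cohomology_class_eq .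
      define a where "a = (\<lambda>v. c (the_inv_into {..<?n} ?cl v))"
      have "a (?cl i) = c i" if "i < ?n" for i
        using that the_inv_into_f_f[OF inj, of i] by (simp add: a_def)
      then have "x = HK.lincomb a (?cl ` {..<?n})"
        unfolding x lincomb[OF order_refl] by (intro arg_cong[where f = "cohomology_class p"] ext sum.cong) auto
      then show "x \<in> HK.span (?cl ` {..<?n})"
        unfolding HK.span_def by auto
    qed
  qed
  ultimately show ?thesis
    unfolding HK_basis_def HK.basis_def set_eq using cl_mem by auto
qed

lemma lc_comb_coeff_field:
  fixes g :: "'k \<Rightarrow> 'f :: field"
  assumes "finite M" "\<And>k a. (k, a) \<in> set c \<Longrightarrow> k \<in> M"
  shows "(\<Sum>m\<in>M. comb_coeff c m * g m) = lc g c"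
  using assms(2)
proof (induction c)
  case (Cons q c)
  obtain k a where q: "q = (k, a)" by (cases q)
  have "k \<in> M" using Cons.prems[of k a] by (simp add: q)
  have "(\<Sum>m\<in>M. comb_coeff (q # c) m * g m) =
      (\<Sum>m\<in>M. (if m = k then of_int a * g m else 0) + comb_coeff c m * g m)"
    by (rule sum.cong) (auto simp: comb_coeff_def q distrib_right)
  also have "\<dots> = of_int a * g k + (\<Sum>m\<in>M. comb_coeff c m * g m)"
    using \<open>k \<in> M\<close> assms(1) by (simp add: sum.distrib)
  also have "(\<Sum>m\<in>M. comb_coeff c m * g m) = lc g c"
    by (rule Cons.IH) (meson Cons.prems list.set_intros(2))
  finally show ?case
    by (simp add: q)
qed (simp add: comb_coeff_def)

lemma comb_sum_comb_coeff:
  assumes "finite K" "\<And>k a. (k, a) \<in> set c \<Longrightarrow> k \<in> K"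
  shows "(\<lambda>w. lc (\<lambda>k. E k w) c) = comb_sum E K (comb_coeff c)"
  unfolding comb_sum_def by (rule ext, rule lc_comb_coeff) (use assms in auto)

lemma comb_coeff_cbind: "comb_coeff (cbind f c) m = lc (\<lambda>k. comb_coeff (f k) m) c"
  by (simp add: comb_coeff_def)

lemma sum_mem_cocycles:
  "(\<And>i. i \<in> I \<Longrightarrow> f i \<in> cocycles p) \<Longrightarrow> (\<lambda>w. \<Sum>i\<in>I. preproj_scale (c i) (f i w)) \<in> cocycles p"
  by (induction I rule: infinite_finite_induct) (auto simp: cocycles_linear)

text \<open>The certificate is an integral homotopy: modulo the characteristic, \<open>N\<close> times the identity is
  \<open>d\<^sub>p\<^sub>-\<^sub>1 Y + G C + P d\<^sub>p\<close>, where the columns of \<open>G\<close> are the proposed basis, \<open>C d\<^sub>p\<^sub>-\<^sub>1 = 0\<close> and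
  \<open>C G = N\<close>. The first equation gives generation, the other two give independence.\<close>

lemma HK_basis_certificate:
  fixes E :: "'k \<Rightarrow> 'f :: field cochain" and En :: "'m \<Rightarrow> 'f cochain"
    and Dp :: "'j \<Rightarrow> 'k comb" and Dn :: "'k \<Rightarrow> 'm comb" and gs :: "'k comb list"
  assumes fin: "finite K" "finite Kp" "finite Kn"
    and mem: "\<And>\<alpha>. comb_sum E K \<alpha> \<in> cochains p"
    and exp: "\<And>f. f \<in> cochains p \<Longrightarrow> \<exists>\<alpha>. f = comb_sum E K \<alpha>"
    and indep: "\<And>\<alpha> k. comb_sum E K \<alpha> = (\<lambda>_. 0) \<Longrightarrow> k \<in> K \<Longrightarrow> \<alpha> k = 0"
    and cob: "coboundaries p = range (\<lambda>\<beta> w. \<Sum>j\<in>Kp. preproj_scale (\<beta> j) (lc (\<lambda>k. E k w) (Dp j)))"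
    and diff: "\<And>\<alpha>. koszul_diff p (comb_sum E K \<alpha>) =
      comb_sum En Kn (\<lambda>m. \<Sum>k\<in>K. \<alpha> k * comb_coeff (Dn k) m)"
    and indepn: "\<And>\<alpha> m. comb_sum En Kn \<alpha> = (\<lambda>_. 0) \<Longrightarrow> m \<in> Kn \<Longrightarrow> \<alpha> m = 0"
    and Dp: "\<And>j k a. j \<in> Kp \<Longrightarrow> (k, a) \<in> set (Dp j) \<Longrightarrow> k \<in> K"
    and Dn: "\<And>k m a. k \<in> K \<Longrightarrow> (m, a) \<in> set (Dn k) \<Longrightarrow> m \<in> Kn"
    and gs: "\<And>i k a. i < length gs \<Longrightarrow> (k, a) \<in> set (gs ! i) \<Longrightarrow> k \<in> K"
    and Y: "\<And>k j a. k \<in> K \<Longrightarrow> (j, a) \<in> set (Y k) \<Longrightarrow> j \<in> Kp"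
    and C: "\<And>k i a. k \<in> K \<Longrightarrow> (i, a) \<in> set (C k) \<Longrightarrow> i < length gs"
    and char: "of_int pc = (0 :: 'f)" "of_int N \<noteq> (0 :: 'f)"
    and DD: "\<And>j. j \<in> Kp \<Longrightarrow> czero 0 (cbind Dn (Dp j))"
    and Dg: "\<And>i. i < length gs \<Longrightarrow> czero pc (cbind Dn (gs ! i))"
    and CD: "\<And>j. j \<in> Kp \<Longrightarrow> czero pc (cbind C (Dp j))"
    and Cg: "\<And>i. i < length gs \<Longrightarrow> czero pc ((i, - N) # cbind C (gs ! i))"
    and cert: "\<And>k. k \<in> K \<Longrightarrow>
      czero pc ((k, - N) # cbind Dp (Y k) @ cbind (\<lambda>i. gs ! i) (C k) @ cbind P (Dn k))"
  shows "HK_basis p (map (\<lambda>g w. lc (\<lambda>k. E k w) g) gs)"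
proof -
  let ?n = "length gs"
  define d where "d = (\<lambda>j w. lc (\<lambda>k. E k w) (Dp j))"
  define G where "G = (\<lambda>i w. lc (\<lambda>k. E k w) (gs ! i))"
  have char': "of_int pc = (0 :: 'f preproj)"
    using char(1) scale_of_int[of pc "1 :: 'f preproj"] by simp
  have cocycle: "(\<lambda>w. lc (\<lambda>k. E k w) c) \<in> cocycles p"
    if c: "\<And>k a. (k, a) \<in> set c \<Longrightarrow> k \<in> K" and z: "czero q (cbind Dn c)" "of_int q = (0 :: 'f)" for c q
  proof -
    have "(\<Sum>k\<in>K. comb_coeff c k * comb_coeff (Dn k) m) = (0 :: 'f)" for m
    proof -
      have "(\<Sum>k\<in>K. comb_coeff c k * comb_coeff (Dn k) m) = (lc (\<lambda>k. comb_coeff (Dn k) m) c :: 'f)"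
        by (rule lc_comb_coeff_field[OF fin(1) c])
      also have "\<dots> = comb_coeff (cbind Dn c) m" by (simp add: comb_coeff_cbind)
      also have "\<dots> = 0" unfolding comb_coeff_def by (rule lc_czero[OF z])
      finally show ?thesis .
    qed
    then have "koszul_diff p (comb_sum E K (comb_coeff c)) = (\<lambda>_. 0)"
      unfolding diff by (simp add: comb_sum_def)
    moreover have "(\<lambda>w. lc (\<lambda>k. E k w) c) = comb_sum E K (comb_coeff c)"
      by (rule comb_sum_comb_coeff[OF fin(1) c])
    ultimately show ?thesis
      using mem by (simp add: cocycles_def)
  qed
  have d_cocycle: "d j \<in> cocycles p" if "j \<in> Kp" for j
    unfolding d_def by (rule cocycle[OF Dp[OF that] DD[OF that]]) auto
  have G_cocycle: "G i \<in> cocycles p" if "i < ?n" for i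
    unfolding G_def by (rule cocycle[OF gs[OF that] Dg[OF that] char(1)])
  have cob': "f \<in> coboundaries p \<longleftrightarrow> (\<exists>\<beta>. f = (\<lambda>w. \<Sum>j\<in>Kp. preproj_scale (\<beta> j) (d j w)))" for f
    unfolding cob d_def by auto
  have nth: "(map (\<lambda>g w. lc (\<lambda>k. E k w) g) gs) ! i = G i" if "i < ?n" for i
    using that by (simp add: G_def)
  have sumG: "(\<Sum>i<?n. preproj_scale (c i) ((map (\<lambda>g w. lc (\<lambda>k. E k w) g) gs ! i) w)) =
      (\<Sum>i<?n. preproj_scale (c i) (G i w))" for c :: "nat \<Rightarrow> 'f" and w
    by (rule sum.cong) (auto simp: G_def)
  show ?thesis
  proof (rule HK_basisI, unfold length_map sumG)
    show "coboundaries p \<subseteq> (cocycles p :: 'f cochain set)"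
      using d_cocycle by (auto simp: cob' intro!: sum_mem_cocycles)
    show "set (map (\<lambda>g w. lc (\<lambda>k. E k w) g) gs) \<subseteq> cocycles p"
      using G_cocycle nth by (fastforce simp: in_set_conv_nth)
  next
    fix c :: "nat \<Rightarrow> 'f" and i
    assume "(\<lambda>w. \<Sum>i<?n. preproj_scale (c i) (G i w)) \<in> coboundaries p" and i: "i < ?n"
    then obtain \<beta> where eq: "(\<lambda>w. \<Sum>i<?n. preproj_scale (c i) (G i w)) =
        (\<lambda>w. \<Sum>j\<in>Kp. preproj_scale (\<beta> j) (d j w))" using cob' by auto
    let ?a = "\<lambda>k. \<Sum>i<?n. c i * comb_coeff (gs ! i) k"
    let ?b = "\<lambda>k. \<Sum>j\<in>Kp. \<beta> j * comb_coeff (Dp j) k"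
    have "comb_sum E K ?a = comb_sum E K ?b"
      using eq unfolding G_def d_def
      by (subst (asm) comb_sum_lc[of K "{..<?n}" "\<lambda>i. gs ! i", OF fin(1)], use gs in blast)
        (subst (asm) comb_sum_lc[of K Kp Dp, OF fin(1) Dp], auto)
    then have "comb_sum E K (\<lambda>k. ?a k - ?b k) = (\<lambda>_. 0)"
      by (simp add: comb_sum_def palg.scale_left_diff_distrib sum_subtractf fun_eq_iff)
    from indep[OF this] have ab: "?a k = ?b k" if "k \<in> K" for k using that by simp
    have Ceq: "(\<Sum>k\<in>K. comb_coeff x k * comb_coeff (C k) i) = (comb_coeff (cbind C x) i :: 'f)"
      if "\<And>k a. (k, a) \<in> set x \<Longrightarrow> k \<in> K" for x
      unfolding comb_coeff_cbind by (rule lc_comb_coeff_field[OF fin(1) that])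
    have Cg': "comb_coeff (cbind C (gs ! l)) i = (if l = i then of_int N else 0 :: 'f)" if "l < ?n" for l
    proof -
      have "lc (\<lambda>k. if k = i then 1 else 0) ((l, - N) # cbind C (gs ! l)) = (0 :: 'f)"
        by (rule lc_czero[OF Cg[OF that] char(1)])
      then show ?thesis by (auto simp: comb_coeff_def split: if_splits)
    qed
    have CD': "comb_coeff (cbind C (Dp j)) i = (0 :: 'f)" if "j \<in> Kp" for j
      unfolding comb_coeff_def by (rule lc_czero[OF CD[OF that] char(1)])
    have swap: "(\<Sum>k\<in>K. (\<Sum>l\<in>L. u l * comb_coeff (x l) k) * comb_coeff (C k) i) =
        (\<Sum>l\<in>L. u l * (\<Sum>k\<in>K. comb_coeff (x l) k * comb_coeff (C k) i))"
      for L :: "'l set" and u :: "'l \<Rightarrow> 'f" and x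
      unfolding sum_distrib_left sum_distrib_right
      by (subst sum.swap) (simp add: mult.assoc)
    \<comment> \<open>The equal coordinate vectors are paired with row \<open>i\<close> of
      \<open>C\<close>. On the side of the generators \<open>C G = N\<close> leaves
      \<open>c i\<close> times \<open>N\<close>, and on the side of the coboundaries
      \<open>C d = 0\<close> leaves zero.\<close>
    have "(\<Sum>k\<in>K. ?a k * comb_coeff (C k) i) = (\<Sum>l<?n. if l = i then c i * of_int N else 0)"
      unfolding swap by (rule sum.cong) (auto simp: Ceq[OF gs] Cg')
    also have "\<dots> = c i * of_int N" using i by simp
    finally have "c i * of_int N = (\<Sum>k\<in>K. ?b k * comb_coeff (C k) i)" by (simp add: ab)
    also have "\<dots> = 0"
      unfolding swap by (rule sum.neutral) (auto simp: Ceq[OF Dp] CD')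
    finally show "c i = 0" using char(2) by simp
  next
    fix f :: "'f cochain" assume f: "f \<in> cocycles p"
    then obtain \<alpha> where \<alpha>: "f = comb_sum E K \<alpha>" using exp by (auto simp: cocycles_def)
    \<comment> \<open>The only division by \<open>N\<close> takes place here, in the field; the
      homotopy stays integral.\<close>
    define \<alpha>' where "\<alpha>' = (\<lambda>k. \<alpha> k / of_int N)"
    have "koszul_diff p (comb_sum E K \<alpha>) = (\<lambda>_. 0)"
      using f by (simp add: cocycles_def \<alpha>)
    from indepn[OF this[unfolded diff]] have Dn0: "(\<Sum>k\<in>K. \<alpha>' k * comb_coeff (Dn k) m) = 0" if "m \<in> Kn" for m
      using that by (simp add: \<alpha>'_def flip: sum_divide_distrib)
    have hom: "of_int N * E k w = lc (\<lambda>j. d j w) (Y k) + lc (\<lambda>i. G i w) (C k) +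
        lc (\<lambda>m. lc (\<lambda>k. E k w) (P m)) (Dn k)" if "k \<in> K" for k w
      using lc_czero[OF cert[OF that] char', of "\<lambda>k. E k w"] by (simp add: d_def G_def algebra_simps)
    let ?\<beta> = "\<lambda>j. \<Sum>k\<in>K. \<alpha>' k * comb_coeff (Y k) j"
    let ?\<gamma> = "\<lambda>i. \<Sum>k\<in>K. \<alpha>' k * comb_coeff (C k) i"
    have "f w = (\<Sum>j\<in>Kp. preproj_scale (?\<beta> j) (d j w)) + (\<Sum>i<?n. preproj_scale (?\<gamma> i) (G i w))" for w
    proof -
      have "f w = (\<Sum>k\<in>K. preproj_scale (\<alpha>' k) (of_int N * E k w))"
        unfolding \<alpha> comb_sum_def \<alpha>'_def using char(2) by (simp flip: scale_of_int)
      also have "\<dots> = (\<Sum>k\<in>K. preproj_scale (\<alpha>' k) (lc (\<lambda>j. d j w) (Y k))) +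
          (\<Sum>k\<in>K. preproj_scale (\<alpha>' k) (lc (\<lambda>i. G i w) (C k))) +
          (\<Sum>k\<in>K. preproj_scale (\<alpha>' k) (lc (\<lambda>m. lc (\<lambda>k. E k w) (P m)) (Dn k)))"
        by (simp add: hom palg.scale_right_distrib sum.distrib)
      also have "(\<Sum>k\<in>K. preproj_scale (\<alpha>' k) (lc (\<lambda>j. d j w) (Y k))) =
          (\<Sum>j\<in>Kp. preproj_scale (?\<beta> j) (d j w))"
        using comb_sum_lc[of Kp K Y \<alpha>' d, OF fin(2) Y] by (simp add: comb_sum_def fun_eq_iff)
      also have "(\<Sum>k\<in>K. preproj_scale (\<alpha>' k) (lc (\<lambda>i. G i w) (C k))) =
          (\<Sum>i<?n. preproj_scale (?\<gamma> i) (G i w))"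
        using comb_sum_lc[of "{..<?n}" K C \<alpha>' G] C by (simp add: comb_sum_def fun_eq_iff)
      \<comment> \<open>The term \<open>P d\<close> disappears because \<open>f\<close> is a
        cocycle.\<close>
      also have "(\<Sum>k\<in>K. preproj_scale (\<alpha>' k) (lc (\<lambda>m. lc (\<lambda>k. E k w) (P m)) (Dn k))) = 0"
        using comb_sum_lc[of Kn K Dn \<alpha>' "\<lambda>m w. lc (\<lambda>k. E k w) (P m)", OF fin(3) Dn] Dn0
        by (simp add: comb_sum_def fun_eq_iff)
      finally show ?thesis by simp
    qed
    then have "(\<lambda>w. f w - (\<Sum>i<?n. preproj_scale (?\<gamma> i) (G i w))) =
        (\<lambda>w. \<Sum>j\<in>Kp. preproj_scale (?\<beta> j) (d j w))" by simp
    then have "(\<lambda>w. f w - (\<Sum>i<?n. preproj_scale (?\<gamma> i) (G i w))) \<in> coboundaries p"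
      unfolding cob' by (rule exI[where x = ?\<beta>])
    then show "\<exists>c. (\<lambda>w. f w - (\<Sum>i<?n. preproj_scale (c i) (G i w))) \<in> coboundaries p"
      by (rule exI[where x = ?\<gamma>])
  qed
qed

section \<open>Cochains given by words\<close>

fun pword :: "vertex \<Rightarrow> arrow list \<Rightarrow> 'f :: field preproj" where
  "pword t [] = vx t"
| "pword t (x # xs) = arr x * pword (src x) xs"

lemma pword_pcomb: "pword t xs = (lc bas (pcomb t xs) :: 'f :: field preproj)"
proof (induction t xs rule: pword.induct)
  case (2 t x xs)
  have key: "is_key k" if "(k, a) \<in> set (pcomb s ys)" for k a s ys
    using that by (cases ys) (auto simp: ekey_key dest!: set_cbind lmul_keys)
  have "pword t (x # xs) = (lc (\<lambda>k. arr x * bas k) (pcomb (src x) xs) :: 'f preproj)"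
    by (simp add: 2 lc_mult_left)
  also have "\<dots> = lc bas (pcomb t (x # xs))"
    by (simp, rule lc_cong) (use key arr_bas in blast)
  finally show ?case .
qed (simp add: bas_ekey)

type_synonym 'i word_values = "('i \<times> (vertex \<times> arrow list) comb) list"

fun values_comb :: "'i word_values \<Rightarrow> ('i \<times> int) comb" where
  "values_comb [] = []"
| "values_comb ((i, ws) # r) = tag i (cbind (\<lambda>(t, xs). pcomb t xs) ws) @ values_comb r"

fun values_at :: "'i word_values \<Rightarrow> 'i \<Rightarrow> 'f :: field preproj" where
  "values_at [] i = 0"
| "values_at ((j, ws) # r) i = (if i = j then lc (\<lambda>(t, xs). pword t xs) ws else 0) + values_at r i"

lemma values_comb_at:
  "lc (\<lambda>q. if i = fst q then bas (snd q) else 0) (values_comb v) = (values_at v i :: 'f :: field preproj)"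
proof (induction v rule: values_comb.induct)
  case (2 j ws r)
  have "(\<lambda>(t, xs). pword t xs :: 'f preproj) = (\<lambda>(t, xs). lc bas (pcomb t xs))"
    by (simp add: pword_pcomb)
  then show ?case
    using 2 by (auto simp: lc_tag split_def)
qed simp

text \<open>The words are brought to normal form by the tables and compared with the claimed
  coordinates \<open>g\<close> over the integers, so the equality holds over every field.\<close>

lemma (in bimodule_family) cochain_on_values:
  assumes "\<And>i. \<phi> i = values_at v i" and z: "czero 0 (cscale (-1) g @ values_comb v)"
  shows "cochain_on b \<phi> = (\<lambda>w. lc (\<lambda>q. E q w) g)"
proof -
  have "lc (\<lambda>q. if i = fst q then bas (snd q) else 0) g = \<phi> i" for i
    using lc_czero[OF z, of "\<lambda>q. if i = fst q then bas (snd q) else 0 :: 'f preproj"]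
    by (simp add: values_comb_at assms(1))
  then show ?thesis unfolding lc_basis_cochain by simp
qed

section \<open>Certificates\<close>

text \<open>There is at most one arrow between two vertices, so the basis path determines the basis cochain.\<close>

definition q0 :: "int \<Rightarrow> vertex \<times> int" where "q0 n = (ptgt n, n)"

definition q1 :: "int \<Rightarrow> arrow \<times> int" where
  "q1 n = (hd (filter (\<lambda>x. tgt x = ptgt n) (out_arrows (psrc n))), n)"

definition v0 :: "int \<Rightarrow> bool" where "v0 n \<longleftrightarrow> is_key n \<and> ptgt n = psrc n"

definition v1 :: "int \<Rightarrow> bool" where
  "v1 n \<longleftrightarrow> is_key n \<and> list_ex (\<lambda>x. tgt x = ptgt n) (out_arrows (psrc n))"

lemma q0_index: "k \<in> K0 \<Longrightarrow> q0 (snd k) = k" "k \<in> K0 \<Longrightarrow> v0 (snd k)" "v0 n \<Longrightarrow> q0 n \<in> K0"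
  by (auto simp: q0_def v0_def index_set_def prod_eq_iff)

lemma filter_out_arrows: "filter (\<lambda>x. tgt x = tgt y) (out_arrows (src y)) = [y]"
proof (cases y)
  case (Fwd e)
  then show ?thesis by (cases e) simp_all
next
  case (Rev e)
  then show ?thesis by (cases e) simp_all
qed

lemma q1_index:
  "k \<in> K1 \<Longrightarrow> q1 (snd k) = k" "k \<in> K1 \<Longrightarrow> v1 (snd k)" "v1 n \<Longrightarrow> q1 n \<in> K1"
proof -
  show "q1 (snd k) = k" if "k \<in> K1"
    using that by (auto simp: q1_def index_set_def filter_out_arrows prod_eq_iff)
  show "v1 (snd k)" if "k \<in> K1"
    using that by (force simp: v1_def index_set_def list_ex_iff set_arrows)
  show "q1 n \<in> K1" if "v1 n"
  proof -
    from that obtain x where x: "src x = psrc n" "tgt x = ptgt n"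
      by (auto simp: v1_def list_ex_iff set_arrows)
    then show ?thesis
      using that filter_out_arrows[of x] by (simp add: q1_def v1_def index_set_def)
  qed
qed

lemma all_K0:
  assumes "list_all (\<lambda>(n, j, i, p). i = j \<longrightarrow> Q (j, n)) ptable" "k \<in> K0"
  shows "Q k"
proof -
  obtain v n where k: "k = (v, n)" by (cases k)
  with assms(2) obtain p where "map_of ptable n = Some (v, v, p)"
    by (cases "map_of ptable n") (auto simp: index_set_def is_key_def psrc_def ptgt_def)
  then show ?thesis using assms(1) by (auto simp: k list_all_iff dest!: map_of_SomeD)
qed

lemma all_K1:
  assumes "list_all (\<lambda>(n, j, i, p). list_all (\<lambda>x. tgt x = i \<longrightarrow> Q (x, n)) (out_arrows j)) ptable" "k \<in> K1"
  shows "Q k"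
proof -
  obtain x n where k: "k = (x, n)" by (cases k)
  with assms(2) obtain p where "map_of ptable n = Some (src x, tgt x, p)"
    by (cases "map_of ptable n") (auto simp: index_set_def is_key_def psrc_def ptgt_def)
  then show ?thesis using assms(1) by (fastforce simp: k list_all_iff set_arrows dest!: map_of_SomeD)
qed

definition scaled :: "int \<Rightarrow> (int \<times> 'v) list \<Rightarrow> (int \<times> int \<times> 'v) list" where
  "scaled s T = map (\<lambda>(n, v). (n, s, v)) T"

lemma set_signed: "(k, a) \<in> set (signed q ns) \<Longrightarrow> \<exists>n\<in>set ns. k = q \<bar>n\<bar>"
  by (induction q ns rule: signed.induct) (auto split: if_splits)

text \<open>An entry \<open>(n, s, Y, C)\<close> of a certificate stands for the columns \<open>s Y\<close> and \<open>s C\<close> at the basis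
  cochain with basis path \<open>n\<close>.\<close>

type_synonym columns = "(int \<times> int list \<times> (nat \<times> int) list) list"

type_synonym contraction = "(int \<times> int list) list"

type_synonym certificate = "(int \<times> int \<times> int list \<times> (nat \<times> int) list) list"

definition cert_Y :: "(int \<Rightarrow> 'j) \<Rightarrow> certificate \<Rightarrow> 'i \<times> int \<Rightarrow> 'j comb" where
  "cert_Y q T k = (case map_of T (snd k) of None \<Rightarrow> [] | Some (s, Y, C) \<Rightarrow> cscale s (signed q Y))"

definition cert_C :: "certificate \<Rightarrow> 'i \<times> int \<Rightarrow> nat comb" where
  "cert_C T k = (case map_of T (snd k) of None \<Rightarrow> [] | Some (s, Y, C) \<Rightarrow> cscale s C)"

text \<open>An index absent from the table is sent to zero, so only the nontrivial part of the
  homotopy is recorded.\<close>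

definition cert_P :: "(int \<Rightarrow> 'k) \<Rightarrow> (int \<times> int \<times> int list) list \<Rightarrow> 'i \<times> int \<Rightarrow> 'k comb" where
  "cert_P q T k = (case map_of T (snd k) of None \<Rightarrow> [] | Some (s, P) \<Rightarrow> cscale s (signed q P))"

definition cert_ok where
  "cert_ok p N q Dp qp vp gs P Dn (T :: certificate) \<longleftrightarrow> list_all (\<lambda>(n, s, Y, C).
     list_all (\<lambda>(i, c). i < length gs) C \<and> list_all (\<lambda>m. vp \<bar>m\<bar>) Y \<and>
     czero p ((q n, - N) # cbind Dp (cscale s (signed qp Y)) @ cbind (\<lambda>i. gs ! i) (cscale s C) @
       cbind P (Dn (q n)))) T"

lemma cert_okD:
  fixes k :: "'i \<times> int" and gs :: "('i \<times> int) comb list"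
  assumes ok: "cert_ok p N q Dp qp vp gs P Dn T" and k: "q (snd k) = k" "map_of T (snd k) \<noteq> None"
  shows "czero p ((k, - N) # cbind Dp (cert_Y qp T k) @ cbind (\<lambda>i. gs ! i) (cert_C T k) @ cbind P (Dn k))"
    and "(i, a) \<in> set (cert_C T k) \<Longrightarrow> i < length gs"
    and "(j, a) \<in> set (cert_Y qp T k) \<Longrightarrow> \<exists>n. vp n \<and> j = qp n"
proof -
  obtain s Y C where T: "map_of T (snd k) = Some (s, Y, C)" using k(2) by auto
  from ok map_of_SomeD[OF T] have
    "list_all (\<lambda>(i, c). i < length gs) C" "list_all (\<lambda>m. vp \<bar>m\<bar>) Y"
    "czero p ((k, - N) # cbind Dp (cscale s (signed qp Y)) @ cbind (\<lambda>i. gs ! i) (cscale s C) @ cbind P (Dn k))"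
    using k(1) unfolding cert_ok_def list_all_iff by force+
  then show "czero p ((k, - N) # cbind Dp (cert_Y qp T k) @ cbind (\<lambda>i. gs ! i) (cert_C T k) @ cbind P (Dn k))"
    "(i, a) \<in> set (cert_C T k) \<Longrightarrow> i < length gs"
    "(j, a) \<in> set (cert_Y qp T k) \<Longrightarrow> \<exists>n. vp n \<and> j = qp n"
    by (auto simp: cert_Y_def cert_C_def T list_all_iff dest!: set_cscale set_signed)
qed

lemma koszul_diff_comb_sum:
  assumes "finite K"
  shows "koszul_diff p (comb_sum E K \<alpha>) = (\<lambda>w. \<Sum>k\<in>K. preproj_scale (\<alpha> k) (koszul_diff p (E k) w))"
  using assms unfolding comb_sum_def
  by (induction K) (simp_all add: koszul_diff_linear)

lemma koszul_diff_index_0: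
  "koszul_diff 0 (comb_sum (basis_cochain idem) K0 \<alpha>) =
    comb_sum (basis_cochain arrow_elt) K1 (\<lambda>m. \<Sum>k\<in>K0. \<alpha> k * comb_coeff (d0 k) m :: 'f :: field)"
  unfolding koszul_diff_comb_sum[OF finite_index_set]
  by (subst comb_sum_lc[of K1 K0 d0, OF finite_index_set d0_index, symmetric])
    (auto simp: koszul_diff_basis_0 intro!: sum.cong)

lemma koszul_diff_index_1:
  "koszul_diff (Suc 0) (comb_sum (basis_cochain arrow_elt) K1 \<alpha>) =
    comb_sum (basis_cochain relator) K0 (\<lambda>m. \<Sum>k\<in>K1. \<alpha> k * comb_coeff (d1 k) m :: 'f :: field)"
  unfolding koszul_diff_comb_sum[OF finite_index_set]
  by (subst comb_sum_lc[of K0 K1 d1, OF finite_index_set d1_index, symmetric])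
    (auto simp: koszul_diff_basis_1 intro!: sum.cong)

lemma coboundaries_index:
  fixes b :: "'i :: finite \<Rightarrow> 'f :: field path_alg"
  assumes "bimodule_family b t s p"
  shows "coboundaries (Suc p) = range (\<lambda>\<alpha>. koszul_diff p (comb_sum (basis_cochain b) (index_set t s) \<alpha>))"
proof -
  interpret bimodule_family b t s p by (rule assms)
  show ?thesis
  proof (intro subset_antisym subsetI)
    fix g :: "'f cochain" assume "g \<in> coboundaries (Suc p)"
    then obtain f where "f \<in> cochains p" "g = koszul_diff p f" by auto
    then show "g \<in> range (\<lambda>\<alpha>. koszul_diff p (comb_sum E K \<alpha>))"
      using cochain_ex_comb_sum[of f] by auto
  next
    fix g :: "'f cochain" assume "g \<in> range (\<lambda>\<alpha>. koszul_diff p (comb_sum E K \<alpha>))"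
    then show "g \<in> coboundaries (Suc p)"
      using comb_sum_mem by auto
  qed
qed

lemma coboundaries_index_1:
  "coboundaries (Suc 0) = range (\<lambda>\<beta> w. \<Sum>j\<in>K0. preproj_scale (\<beta> j :: 'f :: field)
    (lc (\<lambda>k. basis_cochain arrow_elt k w) (d0 j)))"
  unfolding coboundaries_index[OF family_idem] koszul_diff_comb_sum[OF finite_index_set]
  by (intro arg_cong[where f = range] ext sum.cong) (simp_all add: koszul_diff_basis_0)

lemma coboundaries_index_2:
  "coboundaries (Suc (Suc 0)) = range (\<lambda>\<beta> w. \<Sum>j\<in>K1. preproj_scale (\<beta> j :: 'f :: field)
    (lc (\<lambda>k. basis_cochain relator k w) (d1 j)))"
  unfolding coboundaries_index[OF family_arrow] koszul_diff_comb_sum[OF finite_index_set]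
  by (intro arg_cong[where f = range] ext sum.cong) (simp_all add: koszul_diff_basis_1)

text \<open>The simplifier does not unfold these copies, so that it computes the values of \<open>d0\<close> and \<open>d1\<close> when
  it normalizes the equations below.\<close>

definition d0_value :: "vertex \<times> int \<Rightarrow> (arrow \<times> int) comb" where "d0_value = d0"
definition d1_value :: "arrow \<times> int \<Rightarrow> (vertex \<times> int) comb" where "d1_value = d1"

lemma d_value_rules:
  "list_all (\<lambda>(n, j, i, p). i = j \<longrightarrow> d0_value (j, n) = d0 (j, n)) ptable"
  "list_all (\<lambda>(n, j, i, p). list_all (\<lambda>x. tgt x = i \<longrightarrow> d1_value (x, n) = d1 (x, n)) (out_arrows j)) ptable"
  by (simp_all add: d0_value_def d1_value_def list_all_iff split_def)

context
  notes table_simps [simp]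
begin

lemmas d_value_eqs = d_value_rules[unfolded ptable_rows list.pred_inject prod.case,
    simplified out_arrows.simps list.pred_inject tgt.simps src.simps edge_tgt.simps edge_src.simps
      vertex.distinct simp_thms, simplified]

end

lemmas d_eqs = d_value_eqs[unfolded d0_value_def d1_value_def]

text \<open>A finite computation with the two integer matrices, hence valid in every
  characteristic.\<close>

lemma d1_d0: "list_all (\<lambda>(n, j, i, p). i = j \<longrightarrow> czero 0 (cbind d1 (d0 (j, n)))) ptable"
  supply table_simps [simp] d_eqs [simp] d0.simps [simp del] d1.simps [simp del]
  by (simp only: ptable_rows; simp)

definition nth_ok :: "int \<Rightarrow> int \<Rightarrow> 'k comb list \<Rightarrow> ('k \<Rightarrow> nat comb) \<Rightarrow> ('k \<Rightarrow> 'm comb) \<Rightarrow> bool" where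
  "nth_ok p N gs C Dn \<longleftrightarrow> list_all (\<lambda>i. czero p (cbind Dn (gs ! i)) \<and> czero p ((i, - N) # cbind C (gs ! i)))
     [0..<length gs]"

lemma nth_okD:
  assumes "nth_ok p N gs C Dn" "i < length gs"
  shows "czero p (cbind Dn (gs ! i))" "czero p ((i, - N) # cbind C (gs ! i))"
  using assms by (auto simp: nth_ok_def list_all_iff)

lemma signed_nth:
  assumes "list_all (list_all (\<lambda>n. v \<bar>n\<bar>)) ls" "i < length (map (signed q) ls)"
    "(k, a) \<in> set (map (signed q) ls ! i)"
  shows "\<exists>n. v n \<and> k = q n"
proof -
  have "(k, a) \<in> set (signed q (ls ! i))" "list_all (\<lambda>n. v \<bar>n\<bar>) (ls ! i)"
    using assms by (auto simp: list_all_length)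
  then show ?thesis by (auto dest!: set_signed simp: list_all_iff)
qed

text \<open>The homotopy identity is tested along the rows of \<open>T\<close>; completeness
  guarantees that no basis cochain is missed.\<close>

abbreviation "complete0 T \<equiv> list_all (\<lambda>(n, j, i, p). i = j \<longrightarrow> map_of T n \<noteq> None) ptable"

abbreviation "complete1 T \<equiv>
  list_all (\<lambda>(n, j, i, p). list_all (\<lambda>x. tgt x = i \<longrightarrow> map_of T n \<noteq> None) (out_arrows j)) ptable"

lemma complete: "complete0 T \<Longrightarrow> k \<in> K0 \<Longrightarrow> map_of T (snd k) \<noteq> None"
  "complete1 T \<Longrightarrow> l \<in> K1 \<Longrightarrow> map_of T (snd l) \<noteq> None"
  using all_K0[of "\<lambda>k. map_of T (snd k) \<noteq> None" k] all_K1[of "\<lambda>k. map_of T (snd k) \<noteq> None" l]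
  by simp_all

lemma (in bimodule_family) HK_basis_table:
  fixes ls :: "int list list" and En :: "'m \<Rightarrow> 'f cochain" and Dn :: "_ \<Rightarrow> 'm comb" and N :: int
    and q :: "int \<Rightarrow> 'i \<times> int"
  defines "gs \<equiv> map (signed q) ls"
  assumes q: "\<And>k. k \<in> K \<Longrightarrow> q (snd k) = k" "\<And>n. v n \<Longrightarrow> q n \<in> K" "\<And>n. vp n \<Longrightarrow> qp n \<in> Kp"
    and fin: "finite Kp" "finite Kn"
    and cob: "coboundaries p = range (\<lambda>\<beta> w. \<Sum>j\<in>Kp. preproj_scale (\<beta> j) (lc (\<lambda>k. E k w) (Dp j)))"
    and diff: "\<And>\<alpha>. koszul_diff p (comb_sum E K \<alpha>) =
      comb_sum En Kn (\<lambda>m. \<Sum>k\<in>K. \<alpha> k * comb_coeff (Dn k) m)"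
    and indepn: "\<And>\<alpha> m. comb_sum En Kn \<alpha> = (\<lambda>_. 0) \<Longrightarrow> m \<in> Kn \<Longrightarrow> \<alpha> m = 0"
    and Dp: "\<And>j k a. j \<in> Kp \<Longrightarrow> (k, a) \<in> set (Dp j) \<Longrightarrow> k \<in> K"
    and Dn: "\<And>k m a. k \<in> K \<Longrightarrow> (m, a) \<in> set (Dn k) \<Longrightarrow> m \<in> Kn"
    and DD: "\<And>j. j \<in> Kp \<Longrightarrow> czero 0 (cbind Dn (Dp j))"
    and CD: "\<And>j. j \<in> Kp \<Longrightarrow> czero c (cbind (cert_C T) (Dp j))"
    and total: "\<And>k. k \<in> K \<Longrightarrow> map_of T (snd k) \<noteq> None"
    and ls: "list_all (list_all (\<lambda>n. v \<bar>n\<bar>)) ls"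
    and char: "of_int c = (0 :: 'f)" "of_int N \<noteq> (0 :: 'f)"
    and g: "nth_ok c N gs (cert_C T) Dn"
    and ok: "cert_ok c N q Dp qp vp gs P Dn T"
  shows "HK_basis p (map (\<lambda>g w. lc (\<lambda>k. E k w) g) gs)"
proof (rule HK_basis_certificate[where K = K and Kp = Kp and Kn = Kn and Dp = Dp and Dn = Dn and En = En
      and C = "cert_C T" and Y = "cert_Y qp T" and P = P and pc = c and N = N])
  note okD = cert_okD[OF ok q(1) total]
  show "k \<in> K" if "i < length gs" "(k, a) \<in> set (gs ! i)" for i k a
    using signed_nth[OF ls that[unfolded gs_def]] q(2) by blast
  show "j \<in> Kp" if "k \<in> K" "(j, a) \<in> set (cert_Y qp T k)" for k j a
    using okD(3)[OF that(1,1,2)] q(3) by blast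
  show "i < length gs" if "k \<in> K" "(i, a) \<in> set (cert_C T k)" for k i a
    using that(2) by (rule okD(2)[OF that(1,1)])
  show "czero c ((k, - N) # cbind Dp (cert_Y qp T k) @ cbind (\<lambda>i. gs ! i) (cert_C T k) @ cbind P (Dn k))"
    if "k \<in> K" for k
    by (rule okD(1)[OF that that])
qed (rule finite_index_set fin comb_sum_mem cochain_ex_comb_sum comb_sum_zero cob diff indepn Dp Dn char
  DD nth_okD[OF g] CD; assumption)+

text \<open>Degree zero has no nonzero coboundaries, so \<open>Kp\<close> is empty and the homotopy
  identity reads \<open>N = G C + P d\<close>.\<close>

lemma HK0_basis:
  assumes ls: "list_all (list_all (\<lambda>n. v0 \<bar>n\<bar>)) ls" and char: "of_int N \<noteq> (0 :: 'f :: field)"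
    and total: "complete0 T" and g: "nth_ok 0 N (map (signed q0) ls) (cert_C T) d0"
    and ok: "cert_ok 0 N q0 (\<lambda>_ :: vertex \<times> int. []) q0 (\<lambda>_. False) (map (signed q0) ls) P d0 T"
  shows "HK_basis 0 (map (\<lambda>g w. lc (\<lambda>k. basis_cochain idem k w) g) (map (signed q0) ls) :: 'f cochain list)"
proof -
  interpret I: bimodule_family "idem :: _ \<Rightarrow> 'f path_alg" "\<lambda>i. i" "\<lambda>i. i" 0 by (rule family_idem)
  interpret A: bimodule_family "arrow_elt :: _ \<Rightarrow> 'f path_alg" tgt src "Suc 0" by (rule family_arrow)
  show ?thesis
    by (rule I.HK_basis_table[where Kp = "{}" and Kn = K1 and c = 0, OF _ _ _ _ _ _ _ _ _ _ _ _ _ ls _ char g ok])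
      ((rule q0_index finite_index_set koszul_diff_index_0 A.comb_sum_zero d0_index complete(1)[OF total];
        assumption) | simp)+
qed

lemma HK1_basis:
  assumes ls: "list_all (list_all (\<lambda>n. v1 \<bar>n\<bar>)) ls"
    and char: "of_int p = (0 :: 'f :: field)" "of_int N \<noteq> (0 :: 'f)"
    and total: "complete1 T" and g: "nth_ok p N (map (signed q1) ls) (cert_C T) d1"
    and CD: "list_all (\<lambda>(n, j, i, par). i = j \<longrightarrow> czero p (cbind (cert_C T) (d0 (j, n)))) ptable"
    and ok: "cert_ok p N q1 d0 q0 v0 (map (signed q1) ls) P d1 T"
  shows "HK_basis 1 (map (\<lambda>g w. lc (\<lambda>k. basis_cochain arrow_elt k w) g) (map (signed q1) ls) :: 'f cochain list)"
proof -
  interpret A: bimodule_family "arrow_elt :: _ \<Rightarrow> 'f path_alg" tgt src "Suc 0" by (rule family_arrow)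
  interpret R: bimodule_family "relator :: _ \<Rightarrow> 'f path_alg" "\<lambda>i. i" "\<lambda>i. i" "Suc (Suc 0)"
    by (rule family_relator)
  show ?thesis
    unfolding One_nat_def
    by (rule A.HK_basis_table[where Kp = K0 and Kn = K0, OF _ _ _ _ _ _ _ _ _ _ _ _ _ ls char g ok])
      (rule q1_index(1,3) q0_index(3) finite_index_set coboundaries_index_1 koszul_diff_index_1
        R.comb_sum_zero d0_index d1_index all_K0[OF d1_d0]
        all_K0[of "\<lambda>j. czero p (cbind (cert_C T) (d0 j))", OF CD] complete(2)[OF total]; assumption)+
qed

text \<open>Every cochain of degree two is a cocycle because \<open>W_3 = 0\<close>, so the identity
  reads \<open>N = d Y + G C\<close>.\<close>

lemma HK2_basis:
  assumes ls: "list_all (list_all (\<lambda>n. v0 \<bar>n\<bar>)) ls"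
    and char: "of_int p = (0 :: 'f :: field)" "of_int N \<noteq> (0 :: 'f)"
    and total: "complete0 T"
    and g: "nth_ok p N (map (signed q0) ls) (cert_C T) (\<lambda>_. [] :: (vertex \<times> int) comb)"
    and CD: "list_all (\<lambda>(n, j, i, par). list_all (\<lambda>x. tgt x = i \<longrightarrow>
      czero p (cbind (cert_C T) (d1 (x, n)))) (out_arrows j)) ptable"
    and ok: "cert_ok p N q0 d1 q1 v1 (map (signed q0) ls) P (\<lambda>_. [] :: (vertex \<times> int) comb) T"
  shows "HK_basis 2 (map (\<lambda>g w. lc (\<lambda>k. basis_cochain relator k w) g) (map (signed q0) ls) :: 'f cochain list)"
proof -
  interpret R: bimodule_family "relator :: _ \<Rightarrow> 'f path_alg" "\<lambda>i. i" "\<lambda>i. i" "Suc (Suc 0)"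
    by (rule family_relator)
  \<comment> \<open>Cochains of degree three are modelled by the empty index set.\<close>
  have diff: "koszul_diff (Suc (Suc 0)) (comb_sum (basis_cochain relator) K0 \<alpha>) =
      comb_sum (\<lambda>_ _. 0) {} (\<lambda>m :: vertex \<times> int. \<Sum>k\<in>K0. \<alpha> k * comb_coeff [] m)" for \<alpha> :: "_ \<Rightarrow> 'f"
    unfolding koszul_diff_2[OF R.comb_sum_mem] by (simp add: comb_sum_def)
  have "cbind (\<lambda>_. []) c = ([] :: (vertex \<times> int) comb)" for c :: "(vertex \<times> int) comb"
    by (induction c) auto
  then have zero: "czero 0 (cbind (\<lambda>_. [] :: (vertex \<times> int) comb) (d1 j))" for j
    by (simp add: czero_def)
  show ?thesis
    unfolding numeral_2_eq_2
    by (rule R.HK_basis_table[where Kp = K1 and Kn = "{}" and En = "\<lambda>_ _. 0", OF _ _ _ _ _ _ _ _ _ _ _ _ _ ls char g ok])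
      ((rule q0_index q1_index(3) finite_index_set coboundaries_index_2 diff d1_index zero complete(1)[OF total]
        all_K1[of "\<lambda>j. czero p (cbind (cert_C T) (d1 j))", OF CD]; assumption) | simp)+
qed

section \<open>Integral homotopies in degrees zero, one and two\<close>

text \<open>The blocks \<open>unit\<close>, \<open>half\<close> and \<open>third\<close> cover the path lengths in which a rational homotopy has
  denominator 1, 2 and 3; \<open>two\<close> and \<open>three\<close> replace \<open>half\<close> and \<open>third\<close> in characteristics 2 and 3. Rescaling the
  blocks gives them a common multiple \<open>N\<close> of the identity.\<close>

definition cert0_unit_0 :: columns where
  "cert0_unit_0 = [
(1,[],[]),(8,[],[]),(15,[],[]),(23,[],[]),(32,[],[]),(39,[],[]),(49,[],[(3,-1)]),(50,[],[]),
(60,[],[]),(71,[],[]),(83,[],[(4,-1)]),(84,[],[]),(88,[],[]),(94,[],[]),(104,[],[]),(105,[],[]),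
(116,[],[]),(117,[],[]),(126,[],[]),(127,[],[]),(137,[],[]),(145,[],[]),(149,[],[(5,1)]),
(150,[],[(0,1)]),(155,[],[]),(156,[],[]),(165,[],[]),(166,[],[]),(167,[],[]),(179,[],[]),
(180,[],[]),(181,[],[]),(182,[],[]),(196,[],[]),(197,[],[]),(198,[],[]),(199,[],[]),(212,[],[]),
(213,[],[]),(214,[],[]),(215,[],[]),(227,[],[]),(228,[],[]),(229,[],[(2,-1)]),(239,[],[]),
(240,[],[]),(245,[],[(6,1)]),(246,[],[]),(251,[],[]),(260,[],[]),(261,[],[]),(271,[],[]),
(272,[],[]),(283,[],[]),(284,[],[(1,1)]),(285,[],[]),(297,[],[]),(298,[],[]),(308,[],[]),
(309,[],[]),(316,[],[]),(320,[],[(7,1)]),(321,[],[]),(325,[],[]),(339,[],[]),(347,[],[]),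
(348,[],[]),(357,[],[]),(369,[],[]),(372,[],[(8,-1)])]"

definition cert0_unit_1 :: columns where
  "cert0_unit_1 = [
(373,[],[]),(387,[],[]),(399,[],[(9,1)])]"

definition cert0_unit :: columns where
  "cert0_unit = cert0_unit_0 @ cert0_unit_1"

definition cert0_unit_P_0 :: contraction where
  "cert0_unit_P_0 = [
(2,[-1]),(6,[]),(12,[-8]),(13,[]),(20,[-15]),(21,[]),(29,[-23]),(30,[23,-199,285,-347]),(36,[-32]),
(37,[214]),(44,[227]),(48,[]),(51,[-50]),(57,[94]),(64,[]),(69,[]),(74,[126]),(82,[145,-239]),
(85,[]),(86,[]),(90,[]),(91,[]),(98,[]),(99,[8,165,260,261]),(100,[]),(109,[60]),(110,[180]),
(111,[181]),(112,[-15,-60,-105,-179]),(120,[-116,-117,196,283]),(121,[23,196,197,283]),(122,[]),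
(123,[-116]),(131,[-71,-126]),(132,[212,213,297,357]),(133,[]),(141,[]),(142,[-137]),(147,[]),
(148,[]),(151,[]),(152,[50,84]),(153,[246,321,373]),(158,[-88,-156]),(159,[88]),
(160,[-155,-251,-325]),(161,[]),(162,[]),(170,[-166]),(171,[]),(172,[-167]),(173,[]),(174,[260]),
(175,[]),(176,[]),(185,[]),(186,[-15,-60,-104,-105,-179,-181,-182]),(187,[104,181]),
(188,[-15,-179]),(189,[]),(190,[]),(191,[]),(192,[]),(202,[]),(203,[]),(204,[]),(205,[]),
(206,[23,197]),(207,[283]),(208,[])]"

definition cert0_unit_P_1 :: contraction where
  "cert0_unit_P_1 = [
(209,[285,-347]),(218,[]),(219,[]),(220,[]),(221,[-71,127,212,213,297,357]),
(222,[-32,71,-127,-212,-215,-298]),(223,[]),(224,[-215]),(232,[39,227]),(233,[]),(234,[-228]),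
(235,[]),(236,[]),(242,[-240]),(243,[-239]),(244,[]),(247,[]),(248,[321,373]),(254,[-251,-325]),
(255,[]),(256,[]),(263,[-261]),(264,[]),(265,[]),(266,[]),(275,[]),(276,[]),(277,[]),(278,[-271]),
(279,[-272]),(288,[]),(289,[-23,116,198,199]),(290,[]),(291,[]),(292,[-348,387]),(301,[-215,-298]),
(302,[-32,71,-127,-212,-297,-357]),(303,[]),(304,[]),(311,[]),(312,[-308]),(313,[-309]),(318,[]),
(319,[]),(322,[]),(323,[373]),(328,[-325]),(335,[]),(342,[]),(343,[]),(344,[-271,-339]),(351,[]),
(352,[347,348,-387]),(353,[]),(361,[-357]),(367,[]),(370,[316]),(371,[]),(374,[]),(384,[]),
(389,[387]),(398,[-316,369])]"

definition cert0_unit_P :: contraction where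
  "cert0_unit_P = cert0_unit_P_0 @ cert0_unit_P_1"

definition cert1_unit :: columns where
  "cert1_unit = [
(2,[],[]),(29,[],[]),(30,[-116,-199,-283,-348],[(1,1)]),(36,[-32],[]),(37,[],[]),(44,[],[]),
(51,[],[]),(69,[],[]),(74,[],[]),(85,[50],[]),(86,[],[(0,1)]),(120,[-117,-197,285,-347],[(1,-1)]),
(121,[],[]),(122,[],[]),(123,[-116],[]),(131,[-71],[]),(132,[-126,212,213,-215,297,357],[]),
(133,[],[]),(141,[],[]),(142,[],[]),(151,[1],[]),(152,[50,84],[(0,1)]),(153,[],[]),(202,[-23],[]),
(203,[],[]),(204,[],[]),(205,[-116,196,197,-387],[(1,1)]),(206,[-196,-285,347,387],[]),(207,[],[]),
(208,[-116,-387],[(1,1)]),(209,[],[]),(218,[-214,-215],[]),(219,[],[]),(220,[-126],[]),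
(221,[-71,-126,127,212,213,-215,297,357],[]),(222,[-32,71,-127,-212],[]),(223,[],[]),(224,[],[]),
(232,[39],[]),(233,[137],[]),(234,[-137,-227,-228],[(2,1)]),(235,[],[(2,-1)]),(236,[],[]),
(247,[-246,-321,-373],[]),(248,[],[]),(288,[-285,347,387],[]),(289,[116,283,284,387],[(1,-1)]),
(290,[-283,-348,387],[]),(291,[],[]),(292,[],[]),(301,[],[]),
(302,[-32,71,-127,-212,215,-297,-357],[]),(303,[-215],[]),(304,[-298],[]),(311,[137,227],[(2,-1)]),
(312,[39,229],[]),(313,[],[]),(322,[-321,-373],[]),(323,[],[]),(351,[-348,387],[]),
(352,[347,387],[]),(353,[387],[]),(361,[-298,-357],[]),(367,[-137,-227,309],[(2,1)]),
(374,[-373],[]),(389,[],[])]"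

definition cert1_unit_P :: contraction where
  "cert1_unit_P = [
(1,[]),(32,[29,203,-209,291,292]),(39,[-37,-133]),(50,[]),(71,[-29,-69,-122,209,-291,-292]),
(84,[]),(88,[51]),(126,[29,121,122]),(127,[-121,-209,291,292]),(137,[-74]),(145,[-44,-141]),
(150,[]),(155,[2]),(156,[-2,-153,-248,-323]),(212,[-209,291,292]),(213,[-29,209,-291,-292]),
(214,[204]),(215,[-29,207,-292,389]),(227,[-219,223,-224]),(228,[219]),(229,[-133]),(239,[44]),
(240,[142]),(246,[]),(251,[-248,-323]),(297,[292,-389]),(298,[291,292]),(308,[223,-224,301]),
(309,[219,224]),(316,[-44,-236]),(321,[]),(325,[-323]),(357,[-389]),(369,[44,236,313]),(373,[])]"

text \<open>These paths have lengths 3, 7 and 15. All columns \<open>C\<close> are empty, so twice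
  any cocycle of these lengths is an integral coboundary.\<close>

definition cert1_half :: columns where
  "cert1_half = [
(6,[],[]),(20,[],[]),(21,[15,15,60,60,104,104,105,105,181,181,182,182,-271,-271],[]),(48,[],[]),
(64,[-60,-60],[]),(82,[145,145,239,239],[]),(90,[155,155],[]),(91,[-88,-88],[]),(109,[],[]),
(110,[],[]),(111,[15,15,181,181],[]),(112,[-105,-105],[]),(147,[],[]),(148,[239,239],[]),
(158,[-88,-88,-156,-156,-251,-251,-325,-325],[]),(159,[],[]),(160,[],[]),(161,[],[]),
(162,[251,251,325,325],[]),(185,[15,15],[]),(186,[],[]),(187,[15,15,60,60,104,104,181,181],[]),
(188,[],[]),(189,[-179,-179,-180,-180,-271,-271],[]),(190,[-179,-179],[]),
(191,[179,179,271,271],[]),(192,[],[]),(242,[-240,-240],[]),(243,[],[]),(244,[],[]),(254,[],[]),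
(255,[],[]),(256,[325,325],[]),(275,[],[]),(276,[],[]),(277,[],[]),(278,[],[]),
(279,[-272,-272],[]),(318,[],[]),(319,[-316,-316],[]),(328,[],[]),(342,[],[]),(343,[],[]),
(344,[-339,-339],[]),(370,[],[]),(371,[-316,-316,-369,-369],[]),(384,[],[]),(398,[],[])]"

definition cert1_half_P :: contraction where
  "cert1_half_P = [
(8,[-6,-6,-159,-161,-255,-328]),(23,[-20,-20,-20,-186,-186,-192,-275,-275,-276,-276,278,-342]),
(49,[-48,-48,-244,318]),(83,[-147,-147,-243,-243,-244,318]),(94,[-159,-160,-160,-161,-255,-328]),
(116,[109,109]),(117,[-20,-20,-20,-110,-110,-192,-275,-275,-276,-276,278,-342]),
(149,[-243,-243,-244,318]),(165,[-159,161,-254,-254,-255,-328]),(166,[159,159]),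
(167,[-159,-161,-255,-328]),(196,[20,20]),(197,[-20,-20,-20,-192,-275,-275,-276,-276,278,-342]),
(198,[20,20,192,192,-277,-277]),(199,[188,188]),(245,[244,-318]),(260,[-159,161,-255,-328]),
(261,[159,-161,255,-328]),(283,[20,20,275,275]),(284,[-20,-20,-20,-192,-275,-275,278,-342]),
(285,[20,20,192,192]),(320,[244,318]),(347,[-20,-192,278,342]),(348,[20,20,192,192,343,343]),
(372,[244,318,370,370]),(387,[-20,-192,278,342,384,384]),(399,[244,318,370,370,398,398])]"

text \<open>The same situation in length 5, with factor 3 in place of 2.\<close>

definition cert1_third :: columns where
  "cert1_third = [
(12,[],[]),(13,[166,166,166],[]),(57,[],[]),(98,[-94,-94,-94],[]),(99,[],[]),(100,[],[]),
(170,[],[]),(171,[8,8,8],[]),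
(172,[-8,-8,-8,-165,-165,-165,-167,-167,-167,-260,-260,-260,-261,-261,-261],[]),(173,[],[]),
(174,[],[]),(175,[],[]),(176,[165,165,165,260,260,260,261,261,261],[]),(263,[165,165,165],[]),
(264,[],[]),(265,[],[]),(266,[],[]),(335,[260,260,260],[])]"

definition cert1_third_P :: contraction where
  "cert1_third_P = [
(15,[99,99,-170,-170,-170,-173,-173,-174,-175,-265]),
(60,[-57,-57,-57,-99,-173,-173,-174,-175,-265]),(104,[-99,-100,-100,-100,173,-174,-175,-265]),
(105,[-99,-173,-173,-174,-175,-265]),(179,[99,99,-173,-173,-174,-175,-265]),(180,[12,12,12]),
(181,[99,99,-173,-173,-174,175,175,-264,-264,-264,-265]),(182,[-99,173,-174,-175,-265]),
(271,[-99,173,174,174,-175,-265]),(272,[99,99,-173,-173,-174,175,175,-265]),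
(339,[-99,173,-174,-175,265,265,266,266,266])]"

text \<open>Modulo 2 the columns \<open>C\<close> no longer vanish: generators 3, 4 and 5 are
  \<open>rho3\<close>, \<open>rho7\<close> and \<open>rho15\<close>, one for each of the lengths 3,
  7 and 15.\<close>

definition cert1_two :: columns where
  "cert1_two = [
(6,[],[]),(20,[],[]),(21,[],[]),(48,[],[]),(64,[60,105],[]),(82,[],[]),(90,[],[]),(91,[88],[]),
(109,[105],[]),(110,[],[]),(111,[],[]),(112,[],[]),(147,[145,239,240],[(5,1)]),(148,[],[]),
(158,[88,156,251,325],[]),(159,[],[]),(160,[155],[]),(161,[],[]),(162,[155],[(3,1)]),(185,[15],[]),
(186,[60,104,105,182],[(4,1)]),(187,[60,104,105],[]),(188,[],[]),(189,[15,179,180,181],[(4,1)]),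
(190,[179],[]),(191,[15,179,181],[(4,1)]),(192,[271],[(4,1)]),(242,[],[(5,1)]),
(243,[239,240],[(5,1)]),(244,[],[]),(254,[],[]),(255,[155,251,325],[(3,1)]),(256,[],[]),
(275,[],[]),(276,[],[]),(277,[15,181,271],[(4,1)]),(278,[],[]),(279,[],[]),(318,[240],[(5,1)]),
(319,[240,316],[(5,1)]),(328,[325],[]),(342,[],[]),(343,[271,272],[(4,1)]),(344,[],[]),(370,[],[]),
(371,[],[]),(384,[271,272,339],[(4,1)]),(398,[240,316,369],[(5,1)])]"

definition cert1_two_P :: contraction where
  "cert1_two_P = [
(8,[6,161]),(23,[20,21,111,188]),(49,[48]),(83,[82,148]),(94,[90,254]),(116,[112,188]),(117,[110]),
(149,[148]),(165,[254]),(166,[159]),(167,[161]),(196,[20]),(197,[]),(198,[111]),(199,[188]),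
(245,[]),(260,[]),(261,[256]),(283,[20,275]),(284,[276]),(285,[278,342]),(320,[244]),
(347,[20,275,276,342]),(348,[20,275,279]),(372,[244,370]),(387,[276,279,342,344]),
(399,[244,370,371])]"

text \<open>Modulo 3 generator 3 is \<open>rho5\<close>, the new class in length 5.\<close>

definition cert1_three :: columns where
  "cert1_three = [
(12,[-8,-166,167],[(3,-1)]),(13,[166],[]),(57,[94],[]),(98,[],[]),
(99,[8,165,166,-167,260,261],[(3,1)]),(100,[],[]),(170,[],[]),(171,[-166,167],[(3,-1)]),
(172,[166,167],[(3,1)]),(173,[],[]),(174,[],[]),(175,[],[]),(176,[],[]),(263,[-260,-261],[]),
(264,[],[]),(265,[],[]),(266,[],[]),(335,[260],[])]"

definition cert1_three_P :: contraction where
  "cert1_three_P = [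
(15,[-170,-174,-175,-265]),(60,[-98,-100]),(104,[-100]),(105,[-173]),(179,[-174,-175,-265]),
(180,[174,-176,264,-265]),(181,[-174,-264,-265]),(182,[]),(271,[174]),(272,[-174,-265]),
(339,[265,266])]"

definition cert2_unit :: columns where
  "cert2_unit = [
(1,[],[(0,1)]),(32,[-30,-123,207,208],[]),(39,[-37,-133],[]),(50,[],[(1,1)]),
(71,[-120,-123,-205,207,208],[]),(84,[],[(2,1)]),(88,[51],[]),(126,[-123,-205,207,208],[]),
(127,[-121,-288,-351,-389],[]),(137,[-74],[]),(145,[232,-234],[]),(150,[],[(3,1)]),(155,[151],[]),
(156,[51,152],[]),(212,[-288,-351,-389],[]),(213,[-123,208,288],[]),(214,[123],[]),
(215,[-123,207,208],[]),(227,[-74,132],[]),(228,[36],[]),(229,[-133],[]),(239,[232],[]),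
(240,[233],[]),(246,[],[(4,1)]),(251,[-322,-374],[]),(297,[-351,-389],[]),(298,[207,208,289],[]),
(308,[-361],[]),(309,[36,224],[]),(316,[232,311],[]),(321,[],[(5,1)]),(325,[-374],[]),
(357,[-389],[]),(369,[232,311,367],[]),(373,[],[(6,1)])]"

text \<open>Twice each basis cochain of length 4, 8 or 16 is an integral coboundary. This is the
  torsion that becomes visible in characteristic 2.\<close>

definition cert2_half :: columns where
  "cert2_half = [
(8,[-91,-158,-158,-162,-254,-256],[]),(23,[-20,-21,-111,-186,-188],[]),(49,[-48,-242],[]),
(83,[-82,-147],[]),(94,[-90,-90,-91,-162,-254,-256],[]),(116,[109,109],[]),
(117,[-20,21,-111,-186,-188,-189,-189],[]),(149,[-82,147],[]),(165,[-91,-162,-254,-256],[]),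
(166,[91,91],[]),(167,[-91,162,-254,-255,-255,-256],[]),(196,[20,20],[]),
(197,[-20,-21,-111,186,-188],[]),(198,[111,111],[]),(199,[188,188],[]),(245,[-48,242],[]),
(260,[-91,-162,254,-256],[]),(261,[91,162,-254,-256],[]),(283,[188,188,190,190],[]),
(284,[-111,-188,-188,-190,-190,-277,278,-342],[]),(285,[111,111,277,277],[]),(320,[319,-370],[]),
(347,[-111,-277,278,342],[]),(348,[111,111,277,277,343,343],[]),(372,[319,370],[]),
(387,[-111,-277,278,342,384,384],[]),(399,[319,370,398,398],[])]"

text \<open>In length 6 it is three times each basis cochain that bounds.\<close>

definition cert2_third :: columns where
  "cert2_third = [
(15,[-13,-13,-13,-100,-100,172,172,-174,-264,-265],[]),
(60,[-98,-98,-98,-100,-100,-172,-174,-264,-265],[]),(104,[-100,-100,-172,-174,-264,-265],[]),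
(105,[100,-172,-173,-173,-173,-174,-264,-265],[]),
(179,[-13,-13,-13,-100,-100,170,170,170,172,172,-174,-264,-265],[]),(180,[171,171,171],[]),
(181,[-100,-100,172,172,-174,-264,-265],[]),(182,[100,-172,-174,-264,-265],[]),
(271,[100,-172,174,174,-264,-265],[]),(272,[-100,-100,172,172,-174,264,264,-265],[]),
(339,[100,-172,-174,-264,265,265,266,266,266],[])]"

definition cert2_two :: columns where
  "cert2_two = [
(8,[],[(7,1)]),(23,[],[(8,1)]),(49,[],[(9,1)]),(83,[82,148,242],[(9,1)]),(94,[6,160],[(7,1)]),
(116,[109],[]),(117,[110,186],[(8,1)]),(149,[148,242],[(9,1)]),(165,[158],[(7,1)]),(166,[159],[]),
(167,[6],[(7,1)]),(196,[185],[]),(197,[186],[(8,1)]),(198,[109,187],[]),(199,[188],[]),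
(245,[242],[(9,1)]),(260,[158,254],[(7,1)]),(261,[158,254,256],[(7,1)]),(283,[279,344,384],[]),
(284,[186,276],[(8,1)]),(285,[278,342],[]),(320,[242,318],[(9,1)]),
(347,[186,276,279,342,344,384],[(8,1)]),(348,[344,384],[]),(372,[242,318,319],[(9,1)]),
(387,[186,276,279,342,344],[(8,1)]),(399,[242,318,319,371],[(9,1)])]"

definition cert2_three :: columns where
  "cert2_three = [
(15,[],[(7,1)]),(60,[-57,-99,170],[(7,1)]),(104,[13,-172],[(7,1)]),(105,[-99,170],[(7,1)]),
(179,[170],[(7,1)]),(180,[171],[]),(181,[13],[(7,1)]),(182,[-99,170,173],[(7,1)]),
(271,[170,171,263],[(7,1)]),(272,[170,175],[(7,1)]),(339,[170,171,263,335],[(7,1)])]"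

definition "cert0 = scaled 1 cert0_unit"

definition "cert0_P = scaled 1 cert0_unit_P"

text \<open>The blocks prove the identity with multiples 1, 2 and 3, which the factors 6, 3 and 2
  bring to \<open>N = 6\<close>. In characteristic 2 the common multiple is 3 and in characteristic
  3 it is 2, so \<open>N\<close> is invertible in each case.\<close>

definition "cert1 = scaled 6 cert1_unit @ scaled 3 cert1_half @ scaled 2 cert1_third"

definition "cert1_P = scaled 6 cert1_unit_P @ scaled 3 cert1_half_P @ scaled 2 cert1_third_P"

definition "cert1_char2 = scaled 3 cert1_unit @ scaled 3 cert1_two @ scaled 1 cert1_third"

definition "cert1_char2_P = scaled 3 cert1_unit_P @ scaled 3 cert1_two_P @ scaled 1 cert1_third_P"

definition "cert1_char3 = scaled 2 cert1_unit @ scaled 1 cert1_half @ scaled 2 cert1_three"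

definition "cert1_char3_P = scaled 2 cert1_unit_P @ scaled 1 cert1_half_P @ scaled 2 cert1_three_P"

definition "cert2 = scaled 6 cert2_unit @ scaled 3 cert2_half @ scaled 2 cert2_third"

definition "cert2_char2 = scaled 3 cert2_unit @ scaled 3 cert2_two @ scaled 1 cert2_third"

definition "cert2_char3 = scaled 2 cert2_unit @ scaled 1 cert2_half @ scaled 2 cert2_three"

lemmas cert_defs =
  cert0_unit_0_def cert0_unit_1_def cert0_unit_def cert0_unit_P_0_def cert0_unit_P_1_def cert0_unit_P_def
  cert1_unit_def cert1_unit_P_def cert1_half_def cert1_half_P_def cert1_third_def cert1_third_P_def
  cert1_two_def cert1_two_P_def cert1_three_def cert1_three_P_def cert2_unit_def cert2_half_def
  cert2_third_def cert2_two_def cert2_three_def scaled_def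

lemmas cert_table_defs =
  cert0_def cert0_P_def cert1_def cert1_P_def cert1_char2_def cert1_char2_P_def
  cert1_char3_def cert1_char3_P_def cert2_def cert2_char2_def cert2_char3_def

lemma cert_distinct:
  "distinct (map fst cert0)"
  "distinct (map fst cert0_P)"
  "distinct (map fst cert1)"
  "distinct (map fst cert1_P)"
  "distinct (map fst cert1_char2)"
  "distinct (map fst cert1_char2_P)"
  "distinct (map fst cert1_char3)"
  "distinct (map fst cert1_char3_P)"
  "distinct (map fst cert2)"
  "distinct (map fst cert2_char2)"
  "distinct (map fst cert2_char3)"
  by (simp_all add: cert_defs cert_table_defs)

lemmas cert_eqs = map_of_eqs[OF cert0_def[symmetric] cert_distinct(1)]
  map_of_eqs[OF cert0_P_def[symmetric] cert_distinct(2)]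
  map_of_eqs[OF cert1_def[symmetric] cert_distinct(3)]
  map_of_eqs[OF cert1_P_def[symmetric] cert_distinct(4)]
  map_of_eqs[OF cert1_char2_def[symmetric] cert_distinct(5)]
  map_of_eqs[OF cert1_char2_P_def[symmetric] cert_distinct(6)]
  map_of_eqs[OF cert1_char3_def[symmetric] cert_distinct(7)]
  map_of_eqs[OF cert1_char3_P_def[symmetric] cert_distinct(8)]
  map_of_eqs[OF cert2_def[symmetric] cert_distinct(9)]
  map_of_eqs[OF cert2_char2_def[symmetric] cert_distinct(10)]
  map_of_eqs[OF cert2_char3_def[symmetric] cert_distinct(11)]
lemmas cert_rules = cert_eqs[unfolded cert_defs list.map append.simps list.pred_inject prod.case]

section \<open>Coordinates of the given elements and cochains\<close>

definition z0_keys :: "int list" where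
  "z0_keys = [1,50,84,150,246,321,373]"
definition z8_keys :: "int list" where
  "z8_keys = [23,-116,-198,-199,284,-348,387]"
definition z12_keys :: "int list" where
  "z12_keys = [-39,-137,-227,-229,-308]"
text \<open>Up to sign each socle element is the last basis path in the block of its vertex.\<close>

definition pi0_keys :: "int list" where
  "pi0_keys = [-49]"
definition pi1_keys :: "int list" where
  "pi1_keys = [-83]"
definition pi2_keys :: "int list" where
  "pi2_keys = [149]"
definition pi3_keys :: "int list" where
  "pi3_keys = [245]"
definition pi4_keys :: "int list" where
  "pi4_keys = [320]"
definition pi5_keys :: "int list" where
  "pi5_keys = [-372]"
definition pi6_keys :: "int list" where
  "pi6_keys = [399]"
definition zeta_z0_keys :: "int list" where
  "zeta_z0_keys = [2,51,86,153,248,323]"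
definition zeta_z8_keys :: "int list" where
  "zeta_z8_keys = [29,-123,208,292,353]"
definition zeta_z12_keys :: "int list" where
  "zeta_z12_keys = [-44,-142,-235,-236]"
definition rho3_keys :: "int list" where
  "rho3_keys = [90,159,160,161,162,256]"
text \<open>The repeated 21 is a coefficient 2. It vanishes where \<open>rho7\<close> is a
  generator, but the comparison with the defining words is made over the integers.\<close>

definition rho7_keys :: "int list" where
  "rho7_keys = [20,21,21,-190,-191,-192,-275,-276,-277]"
definition rho15_keys :: "int list" where
  "rho15_keys = [-48,-242]"
definition rho5_keys :: "int list" where
  "rho5_keys = [-13,100,170,171,-172,174,175,176]"
definition h0_keys :: "int list" where
  "h0_keys = [1]"
definition h1_keys :: "int list" where
  "h1_keys = [50]"
definition h2_keys :: "int list" where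
  "h2_keys = [84]"
definition h3_keys :: "int list" where
  "h3_keys = [150]"
definition h4_keys :: "int list" where
  "h4_keys = [246]"
definition h5_keys :: "int list" where
  "h5_keys = [321]"
definition h6_keys :: "int list" where
  "h6_keys = [373]"
definition gamma4_keys :: "int list" where
  "gamma4_keys = [8]"
definition gamma8_keys :: "int list" where
  "gamma8_keys = [23]"
definition gamma16_keys :: "int list" where
  "gamma16_keys = [-49]"
definition gamma6_keys :: "int list" where
  "gamma6_keys = [15]"

lemmas keys_defs =
  z0_keys_def z8_keys_def z12_keys_def pi0_keys_def pi1_keys_def pi2_keys_def pi3_keys_def
  pi4_keys_def pi5_keys_def pi6_keys_def zeta_z0_keys_def zeta_z8_keys_def zeta_z12_keys_def rho3_keys_def
  rho7_keys_def rho15_keys_def rho5_keys_def h0_keys_def h1_keys_def h2_keys_def h3_keys_def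
  h4_keys_def h5_keys_def h6_keys_def gamma4_keys_def gamma8_keys_def gamma16_keys_def gamma6_keys_def

definition "gens0 = [z0_keys, z8_keys, z12_keys, pi0_keys, pi1_keys, pi2_keys, pi3_keys, pi4_keys, pi5_keys, pi6_keys]"

definition "gens1 = [zeta_z0_keys, zeta_z8_keys, zeta_z12_keys]"

definition "gens1_char2 = [zeta_z0_keys, zeta_z8_keys, zeta_z12_keys, rho3_keys, rho7_keys, rho15_keys]"

definition "gens1_char3 = [zeta_z0_keys, zeta_z8_keys, zeta_z12_keys, rho5_keys]"

definition "gens2 = [h0_keys, h1_keys, h2_keys, h3_keys, h4_keys, h5_keys, h6_keys]"

definition "gens2_char2 = [h0_keys, h1_keys, h2_keys, h3_keys, h4_keys, h5_keys, h6_keys, gamma4_keys, gamma8_keys, gamma16_keys]"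

definition "gens2_char3 = [h0_keys, h1_keys, h2_keys, h3_keys, h4_keys, h5_keys, h6_keys, gamma6_keys]"

lemmas gens_defs = gens0_def gens1_def gens1_char2_def gens1_char3_def gens2_def gens2_char2_def gens2_char3_def

section \<open>Verification of the certificates\<close>

context
  notes table_simps [simp] d_eqs [simp] d0.simps [simp del] d1.simps [simp del] cert_rules [simp]
    q0_def [simp] q1_def [simp] v0_def [simp] v1_def [simp] cert_Y_def [simp] cert_C_def [simp]
    cert_P_def [simp] gens_defs [simp] keys_defs [simp]
begin

lemma gens0_ok:
  "list_all (list_all (\<lambda>n. v0 \<bar>n\<bar>)) gens0"
  "nth_ok 0 1 (map (signed q0) gens0) (cert_C cert0) d0"
  by (simp_all add: nth_ok_def upt_rec)

lemma cert0_complete: "complete0 cert0"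
  by (simp only: ptable_rows; simp)

lemma cert0_ok: "cert_ok 0 1 q0 (\<lambda>_ :: vertex \<times> int. []) q0 (\<lambda>_. False) (map (signed q0) gens0) (cert_P q0 cert0_P) d0 cert0"
  unfolding cert_ok_def cert0_def by (simp only: cert_defs list.map append.simps prod.case; simp)

lemma gens1_ok:
  "list_all (list_all (\<lambda>n. v1 \<bar>n\<bar>)) gens1"
  "nth_ok 0 6 (map (signed q1) gens1) (cert_C cert1) d1"
  by (simp_all add: nth_ok_def upt_rec)

lemma cert1_complete: "complete1 cert1"
  by (simp only: ptable_rows; simp)

lemma cert1_ok: "cert_ok 0 6 q1 d0 q0 v0 (map (signed q1) gens1) (cert_P q1 cert1_P) d1 cert1"
  unfolding cert_ok_def cert1_def by (simp only: cert_defs list.map append.simps prod.case; simp)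

lemma cert1_diff: "list_all (\<lambda>(n, j, i, p). i = j \<longrightarrow> czero 0 (cbind (cert_C cert1) (d0 (j, n)))) ptable"
  by (simp only: ptable_rows; simp)

lemma gens1_char2_ok:
  "list_all (list_all (\<lambda>n. v1 \<bar>n\<bar>)) gens1_char2"
  "nth_ok 2 3 (map (signed q1) gens1_char2) (cert_C cert1_char2) d1"
  by (simp_all add: nth_ok_def upt_rec)

lemma cert1_char2_complete: "complete1 cert1_char2"
  by (simp only: ptable_rows; simp)

lemma cert1_char2_ok: "cert_ok 2 3 q1 d0 q0 v0 (map (signed q1) gens1_char2) (cert_P q1 cert1_char2_P) d1 cert1_char2"
  unfolding cert_ok_def cert1_char2_def by (simp only: cert_defs list.map append.simps prod.case; simp)

lemma cert1_char2_diff: "list_all (\<lambda>(n, j, i, p). i = j \<longrightarrow> czero 2 (cbind (cert_C cert1_char2) (d0 (j, n)))) ptable"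
  by (simp only: ptable_rows; simp)

lemma gens1_char3_ok:
  "list_all (list_all (\<lambda>n. v1 \<bar>n\<bar>)) gens1_char3"
  "nth_ok 3 2 (map (signed q1) gens1_char3) (cert_C cert1_char3) d1"
  by (simp_all add: nth_ok_def upt_rec)

lemma cert1_char3_complete: "complete1 cert1_char3"
  by (simp only: ptable_rows; simp)

lemma cert1_char3_ok: "cert_ok 3 2 q1 d0 q0 v0 (map (signed q1) gens1_char3) (cert_P q1 cert1_char3_P) d1 cert1_char3"
  unfolding cert_ok_def cert1_char3_def by (simp only: cert_defs list.map append.simps prod.case; simp)

lemma cert1_char3_diff: "list_all (\<lambda>(n, j, i, p). i = j \<longrightarrow> czero 3 (cbind (cert_C cert1_char3) (d0 (j, n)))) ptable"
  by (simp only: ptable_rows; simp)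

lemma gens2_ok:
  "list_all (list_all (\<lambda>n. v0 \<bar>n\<bar>)) gens2"
  "nth_ok 0 6 (map (signed q0) gens2) (cert_C cert2) (\<lambda>_. [] :: (vertex \<times> int) comb)"
  by (simp_all add: nth_ok_def upt_rec)

lemma cert2_complete: "complete0 cert2"
  by (simp only: ptable_rows; simp)

lemma cert2_ok: "cert_ok 0 6 q0 d1 q1 v1 (map (signed q0) gens2) (\<lambda>_. []) (\<lambda>_. [] :: (vertex \<times> int) comb) cert2"
  unfolding cert_ok_def cert2_def by (simp only: cert_defs list.map append.simps prod.case; simp)

lemma cert2_diff: "list_all (\<lambda>(n, j, i, p). list_all (\<lambda>x. tgt x = i \<longrightarrow>
    czero 0 (cbind (cert_C cert2) (d1 (x, n)))) (out_arrows j)) ptable"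
  by (simp only: ptable_rows; simp)

lemma gens2_char2_ok:
  "list_all (list_all (\<lambda>n. v0 \<bar>n\<bar>)) gens2_char2"
  "nth_ok 2 3 (map (signed q0) gens2_char2) (cert_C cert2_char2) (\<lambda>_. [] :: (vertex \<times> int) comb)"
  by (simp_all add: nth_ok_def upt_rec)

lemma cert2_char2_complete: "complete0 cert2_char2"
  by (simp only: ptable_rows; simp)

lemma cert2_char2_ok: "cert_ok 2 3 q0 d1 q1 v1 (map (signed q0) gens2_char2) (\<lambda>_. []) (\<lambda>_. [] :: (vertex \<times> int) comb) cert2_char2"
  unfolding cert_ok_def cert2_char2_def by (simp only: cert_defs list.map append.simps prod.case; simp)

lemma cert2_char2_diff: "list_all (\<lambda>(n, j, i, p). list_all (\<lambda>x. tgt x = i \<longrightarrow>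
    czero 2 (cbind (cert_C cert2_char2) (d1 (x, n)))) (out_arrows j)) ptable"
  by (simp only: ptable_rows; simp)

lemma gens2_char3_ok:
  "list_all (list_all (\<lambda>n. v0 \<bar>n\<bar>)) gens2_char3"
  "nth_ok 3 2 (map (signed q0) gens2_char3) (cert_C cert2_char3) (\<lambda>_. [] :: (vertex \<times> int) comb)"
  by (simp_all add: nth_ok_def upt_rec)

lemma cert2_char3_complete: "complete0 cert2_char3"
  by (simp only: ptable_rows; simp)

lemma cert2_char3_ok: "cert_ok 3 2 q0 d1 q1 v1 (map (signed q0) gens2_char3) (\<lambda>_. []) (\<lambda>_. [] :: (vertex \<times> int) comb) cert2_char3"
  unfolding cert_ok_def cert2_char3_def by (simp only: cert_defs list.map append.simps prod.case; simp)

lemma cert2_char3_diff: "list_all (\<lambda>(n, j, i, p). list_all (\<lambda>x. tgt x = i \<longrightarrow>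
    czero 3 (cbind (cert_C cert2_char3) (d1 (x, n)))) (out_arrows j)) ptable"
  by (simp only: ptable_rows; simp)

end

section \<open>The given cochains\<close>

abbreviation (input) "keyed b q ns \<equiv> \<lambda>w. lc (\<lambda>k. basis_cochain b k w) (signed q ns)"

lemma arr_arr_off:
  assumes "src x \<noteq> tgt y"
  shows "arr x * arr y = (0 :: 'f :: field preproj)" "arr x * (arr y * a) = (0 :: 'f preproj)"
proof -
  have "arr x * arr y = arr x * vx (src x) * (vx (tgt y) * (arr y :: 'f preproj))" by (simp add: vx_mult)
  also have "\<dots> = arr x * (vx (src x) * vx (tgt y)) * arr y" by (simp only: mult.assoc)
  finally show "arr x * arr y = (0 :: 'f preproj)" using assms by (simp add: vx_mult)
  then show "arr x * (arr y * a) = (0 :: 'f preproj)" by (simp flip: mult.assoc)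
qed

lemmas element_defs = z0_def z8_def z12_def c0_def c2_def c3_def

lemmas word_simps = vx_mult vx_mult_assoc arr_arr_off mult.assoc distrib_left distrib_right
  left_diff_distrib right_diff_distrib power2_eq_square power3_eq_cube power4_eq_xxxx

lemma vertex_valuesI:
  assumes "bimodule_family b (\<lambda>i. i) (\<lambda>i. i) p"
    and "\<phi> V0 = values_at v V0" "\<phi> V1 = values_at v V1" "\<phi> V2 = values_at v V2" "\<phi> V3 = values_at v V3"
    "\<phi> V4 = values_at v V4" "\<phi> V5 = values_at v V5" "\<phi> V6 = values_at v V6"
    and z: "czero 0 (cscale (-1) (signed q ns) @ values_comb v)"
  shows "cochain_on b \<phi> = keyed b q ns"
proof (rule bimodule_family.cochain_on_values[OF assms(1) _ z])
  show "\<phi> i = values_at v i" for i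
    by (cases i) (simp_all only: assms(2-8))
qed

lemma arrow_valuesI:
  assumes "\<phi> a0 = values_at v a0" "\<phi> a1 = values_at v a1" "\<phi> a2 = values_at v a2" "\<phi> a3 = values_at v a3"
    "\<phi> a4 = values_at v a4" "\<phi> a5 = values_at v a5" "\<phi> b0 = values_at v b0" "\<phi> b1 = values_at v b1"
    "\<phi> b2 = values_at v b2" "\<phi> b3 = values_at v b3" "\<phi> b4 = values_at v b4" "\<phi> b5 = values_at v b5"
    and z: "czero 0 (cscale (-1) (signed q ns) @ values_comb v)"
  shows "cochain_on arrow_elt \<phi> = keyed arrow_elt q ns"
proof (rule bimodule_family.cochain_on_values[OF family_arrow _ z])
  show "\<phi> x = values_at v x" for x
  proof (cases x)
    case (Fwd e)
    then show ?thesis by (cases e) (simp_all only: assms(1-6))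
  next
    case (Rev e)
    then show ?thesis by (cases e) (simp_all only: assms(7-12))
  qed
qed

context
  notes table_simps [simp] q0_def [simp] q1_def [simp] keys_defs [simp] element_defs [simp] word_simps [simp]
begin

lemma z0_comb: "central_cochain z0 = keyed idem q0 z0_keys"
  unfolding central_cochain_def
  by (rule vertex_valuesI[OF family_idem, where v = "[
(V0,[((V0,[]),1)]),(V1,[((V1,[]),1)]),(V2,[((V2,[]),1)]),(V3,[((V3,[]),1)]),(V4,[((V4,[]),1)]),
(V5,[((V5,[]),1)]),(V6,[((V6,[]),1)])]"]) simp_all

text \<open>Multiplication by the idempotents isolates the single summand of \<open>z8\<close> at
  each vertex; there is none at \<open>V1\<close>.\<close>

lemma z8_comb: "central_cochain z8 = keyed idem q0 z8_keys"
  unfolding central_cochain_def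
  by (rule vertex_valuesI[OF family_idem, where v = "[
(V0,[((V0,[b0,a2,b2,a0,b0,a2,b2,a0]),1)]),(V2,[((V2,[b2,a2,b2,a0,b0,a2,b2,a2]),-1)]),
(V3,[((V3,[a2,b2,b3,a3,b3,a3,a2,b2]),-1)]),(V4,[((V4,[a3,a0,b0,a2,b2,a0,b0,b3]),1)]),
(V5,[((V5,[a4,a3,a2,b2,a2,b2,b3,b4]),-1)]),(V6,[((V6,[a5,a4,a3,a0,b0,b3,b4,b5]),1)])]"]) simp_all

lemma z12_comb: "central_cochain z12 = keyed idem q0 z12_keys"
  unfolding central_cochain_def
  by (rule vertex_valuesI[OF family_idem, where v = "[
(V0,[((V0,[b0,a2,b2,a0,b0,a2,b2,a0,b0,a2,b2,a0]),1)]),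
(V2,[((V2,[b2,a0,b0,a2,b2,a0,b0,a2,b2,a0,b0,a2]),1)]),
(V3,[((V3,[b3,a3,a0,b0,b3,a3,b3,a3,a0,b0,b3,a3]),-1)]),
(V4,[((V4,[a3,b3,a3,a0,b0,b3,a3,a0,b0,b3,a3,b3]),1)])]"]) simp_all

lemma pi0_comb: "central_cochain (socle_elt V0) = keyed idem q0 pi0_keys"
  unfolding central_cochain_def
  by (rule vertex_valuesI[OF family_idem, where v = "[
(V0,[((V0,[b0,b3,a3,a0,b0,b3,a3,a0,b0,b3,a3,a0,b0,b3,a3,a0]),1)])]"]) simp_all

lemma pi1_comb: "central_cochain (socle_elt V1) = keyed idem q0 pi1_keys"
  unfolding central_cochain_def
  by (rule vertex_valuesI[OF family_idem, where v = "[
(V1,[((V1,[b1,b2,a0,b0,b3,a3,b3,a3,a0,b0,b3,a3,a0,b0,a2,a1]),-1)])]"]) simp_all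

lemma pi2_comb: "central_cochain (socle_elt V2) = keyed idem q0 pi2_keys"
  unfolding central_cochain_def
  by (rule vertex_valuesI[OF family_idem, where v = "[
(V2,[((V2,[b2,a0,b0,a2,b2,a0,b0,a2,b2,a0,b0,a2,b2,a0,b0,a2]),-1)])]"]) simp_all

lemma pi3_comb: "central_cochain (socle_elt V3) = keyed idem q0 pi3_keys"
  unfolding central_cochain_def
  by (rule vertex_valuesI[OF family_idem, where v = "[
(V3,[((V3,[b3,a3,a0,b0,b3,a3,a0,b0,b3,a3,a0,b0,b3,a3,b3,a3]),1)])]"]) simp_all

lemma pi4_comb: "central_cochain (socle_elt V4) = keyed idem q0 pi4_keys"
  unfolding central_cochain_def
  by (rule vertex_valuesI[OF family_idem, where v = "[
(V4,[((V4,[a3,a0,b0,b3,a3,a0,b0,b3,a3,a0,b0,b3,a3,a0,b0,b3]),-1)])]"]) simp_all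

lemma pi5_comb: "central_cochain (socle_elt V5) = keyed idem q0 pi5_keys"
  unfolding central_cochain_def
  by (rule vertex_valuesI[OF family_idem, where v = "[
(V5,[((V5,[a4,a3,b3,a3,a0,b0,b3,a3,a0,b0,b3,a3,a0,b0,b3,b4]),-1)])]"]) simp_all

lemma pi6_comb: "central_cochain (socle_elt V6) = keyed idem q0 pi6_keys"
  unfolding central_cochain_def
  by (rule vertex_valuesI[OF family_idem, where v = "[
(V6,[((V6,[a5,a4,a3,a0,b0,b3,a3,a0,b0,b3,a3,a0,b0,b3,b4,b5]),-1)])]"]) simp_all

lemma zeta_z0_comb: "zeta z0 = keyed arrow_elt q1 zeta_z0_keys"
  unfolding zeta_def
  by (rule arrow_valuesI[where v = "[
(a0,[((V3,[a0]),1)]),(a1,[((V2,[a1]),1)]),(a2,[((V3,[a2]),1)]),(a3,[((V4,[a3]),1)]),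
(a4,[((V5,[a4]),1)]),(a5,[((V6,[a5]),1)])]"]) simp_all

text \<open>The factor \<open>z8\<close> stands to the right of the arrow, so its summand at the
  source is the one that survives. Hence \<open>a1\<close> receives the value zero.\<close>

lemma zeta_z8_comb: "zeta z8 = keyed arrow_elt q1 zeta_z8_keys"
  unfolding zeta_def
  by (rule arrow_valuesI[where v = "[
(a0,[((V3,[a0,b0,a2,b2,a0,b0,a2,b2,a0]),1)]),(a2,[((V3,[a2,b2,a2,b2,a0,b0,a2,b2,a2]),-1)]),
(a3,[((V4,[a3,a2,b2,b3,a3,b3,a3,a2,b2]),-1)]),(a4,[((V5,[a4,a3,a0,b0,a2,b2,a0,b0,b3]),1)]),
(a5,[((V6,[a5,a4,a3,a2,b2,a2,b2,b3,b4]),-1)])]"]) simp_all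

lemma zeta_z12_comb: "zeta z12 = keyed arrow_elt q1 zeta_z12_keys"
  unfolding zeta_def
  by (rule arrow_valuesI[where v = "[
(a0,[((V3,[a0,b0,a2,b2,a0,b0,a2,b2,a0,b0,a2,b2,a0]),1)]),
(a2,[((V3,[a2,b2,a0,b0,a2,b2,a0,b0,a2,b2,a0,b0,a2]),1)]),
(a3,[((V4,[a3,b3,a3,a0,b0,b3,a3,b3,a3,a0,b0,b3,a3]),-1)]),
(a4,[((V5,[a4,a3,b3,a3,a0,b0,b3,a3,a0,b0,b3,a3,b3]),1)])]"]) simp_all

lemma rho3_comb: "rho3 = keyed arrow_elt q1 rho3_keys"
  unfolding rho3_def
  by (rule arrow_valuesI[where v = "[
(a2,[((V3,[a0,b0,a2]),1)]),(a3,[((V4,[a3,b3,a3]),1)]),(a4,[((V5,[a4,a3,b3]),1)]),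
(b2,[((V2,[b2,b3,a3]),1)])]"]) simp_all

lemma rho7_comb: "rho7 = keyed arrow_elt q1 rho7_keys"
  unfolding rho7_def
  by (rule arrow_valuesI[where v = "[
(a0,[((V3,[b3,a3,a0,b0,b3,a3,a0]),1),((V3,[b3,a3,b3,a3,b3,a3,a0]),1)]),
(a3,[((V4,[a3,b3,a3,a0,b0,b3,a3]),1)]),(b3,[((V3,[b3,a3,a0,b0,b3,a3,b3]),1)])]"]) simp_all

lemma rho15_comb: "rho15 = keyed arrow_elt q1 rho15_keys"
  unfolding rho15_def
  by (rule arrow_valuesI[where v = "[
(a0,[((V3,[a2,b2,a0,b0,a2,b2,a0,b0,a2,b2,a0,b0,a2,b2,a0]),1)]),
(b0,[((V0,[b0,a2,b2,a0,b0,a2,b2,a0,b0,a2,b2,a0,b0,a2,b2]),1)])]"]) simp_all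

lemma rho5_comb: "rho5 = keyed arrow_elt q1 rho5_keys"
  unfolding rho5_def
  by (rule arrow_valuesI[where v = "[
(a0,[((V3,[a2,b2,b3,a3,a0]),-1)]),(a2,[((V3,[b3,a3,a0,b0,a2]),1)]),
(a3,[((V4,[a3,b3,a3,b3,a3]),1)]),(b0,[((V0,[b0,b3,a3,b3,a3]),1)]),
(b2,[((V2,[b2,a2,b2,a0,b0]),-1)])]"]) simp_all

lemma h0_comb: "h_cochain V0 = keyed relator q0 h0_keys"
  unfolding h_cochain_def
  by (rule vertex_valuesI[OF family_relator, where v = "[
(V0,[((V0,[]),1)])]"]) simp_all

lemma h1_comb: "h_cochain V1 = keyed relator q0 h1_keys"
  unfolding h_cochain_def
  by (rule vertex_valuesI[OF family_relator, where v = "[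
(V1,[((V1,[]),1)])]"]) simp_all

lemma h2_comb: "h_cochain V2 = keyed relator q0 h2_keys"
  unfolding h_cochain_def
  by (rule vertex_valuesI[OF family_relator, where v = "[
(V2,[((V2,[]),1)])]"]) simp_all

lemma h3_comb: "h_cochain V3 = keyed relator q0 h3_keys"
  unfolding h_cochain_def
  by (rule vertex_valuesI[OF family_relator, where v = "[
(V3,[((V3,[]),1)])]"]) simp_all

lemma h4_comb: "h_cochain V4 = keyed relator q0 h4_keys"
  unfolding h_cochain_def
  by (rule vertex_valuesI[OF family_relator, where v = "[
(V4,[((V4,[]),1)])]"]) simp_all

lemma h5_comb: "h_cochain V5 = keyed relator q0 h5_keys"
  unfolding h_cochain_def
  by (rule vertex_valuesI[OF family_relator, where v = "[
(V5,[((V5,[]),1)])]"]) simp_all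

lemma h6_comb: "h_cochain V6 = keyed relator q0 h6_keys"
  unfolding h_cochain_def
  by (rule vertex_valuesI[OF family_relator, where v = "[
(V6,[((V6,[]),1)])]"]) simp_all

lemma gamma4_comb: "gamma4 = keyed relator q0 gamma4_keys"
  unfolding gamma4_def
  by (rule vertex_valuesI[OF family_relator, where v = "[
(V0,[((V0,[b0,b3,a3,a0]),1)])]"]) simp_all

lemma gamma8_comb: "gamma8 = keyed relator q0 gamma8_keys"
  unfolding gamma8_def
  by (rule vertex_valuesI[OF family_relator, where v = "[
(V0,[((V0,[b0,b3,a3,b3,a3,b3,a3,a0]),1)])]"]) simp_all

lemma gamma16_comb: "gamma16 = keyed relator q0 gamma16_keys"
  unfolding gamma16_def
  by (rule vertex_valuesI[OF family_relator, where v = "[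
(V0,[((V0,[b0,b3,a3,a0,b0,b3,a3,a0,b0,b3,a3,a0,b0,b3,a3,a0]),1)])]"]) simp_all

lemma gamma6_comb: "gamma6 = keyed relator q0 gamma6_keys"
  unfolding gamma6_def
  by (rule vertex_valuesI[OF family_relator, where v = "[
(V0,[((V0,[b0,b3,a3,b3,a3,a0]),1)])]"]) simp_all

end

lemmas cochain_combs =
  z0_comb z8_comb z12_comb pi0_comb pi1_comb pi2_comb pi3_comb pi4_comb
  pi5_comb pi6_comb zeta_z0_comb zeta_z8_comb zeta_z12_comb rho3_comb rho7_comb rho15_comb
  rho5_comb h0_comb h1_comb h2_comb h3_comb h4_comb h5_comb h6_comb
  gamma4_comb gamma8_comb gamma16_comb gamma6_comb

section \<open>Invertibility of the factors in a given characteristic\<close>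

text \<open>A characteristic dividing 2 or 3 would be 1, 2 or 3, and a field excludes 1.
  Characteristic zero is covered as well, since 0 divides neither number.\<close>

lemma char_neq_zero:
  assumes "CHAR('f :: field) \<notin> {2, 3}"
  shows "(2 :: 'f) \<noteq> 0" "(3 :: 'f) \<noteq> 0"
proof -
  have "\<not> CHAR('f) dvd n" if n: "n = 2 \<or> n = 3" for n
  proof
    assume d: "CHAR('f) dvd n"
    then have "CHAR('f) \<le> 3" "CHAR('f) \<noteq> 0" using n dvd_imp_le[of "CHAR('f)" n] by (auto intro!: Nat.gr0I)
    moreover have "CHAR('f) \<noteq> 1" "CHAR('f) \<noteq> 2" "CHAR('f) \<noteq> 3" using assms by simp_all
    ultimately show False by linarith
  qed
  from this[of 2] this[of 3]
  show "(2 :: 'f) \<noteq> 0" "(3 :: 'f) \<noteq> 0"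
    using of_nat_eq_0_iff_char_dvd[of 2, where ?'a = 'f] of_nat_eq_0_iff_char_dvd[of 3, where ?'a = 'f]
    by simp_all
qed

lemma char_numerals:
  "CHAR('f :: field) = 2 \<Longrightarrow> (2 :: 'f) = 0 \<and> (3 :: 'f) \<noteq> 0"
  "CHAR('f :: field) = 3 \<Longrightarrow> (3 :: 'f) = 0 \<and> (2 :: 'f) \<noteq> 0"
  using of_nat_eq_0_iff_char_dvd[of 2, where ?'a = 'f] of_nat_eq_0_iff_char_dvd[of 3, where ?'a = 'f]
  by auto

theorem proposition6p17:
  shows
    "HK_basis 0 (map central_cochain
       ([z0, z8, z12] @ map socle_elt [V0, V1, V2, V3, V4, V5, V6]) :: 'f :: field cochain list) \<and>
     (CHAR('f) \<notin> {2, 3} \<longrightarrow>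
       HK_basis 1 (map zeta [z0, z8, z12] :: 'f cochain list)) \<and>
     (CHAR('f) = 2 \<longrightarrow>
       HK_basis 1 (map zeta [z0, z8, z12] @ [rho3, rho7, rho15] :: 'f cochain list)) \<and>
     (CHAR('f) = 3 \<longrightarrow>
       HK_basis 1 (map zeta [z0, z8, z12] @ [rho5] :: 'f cochain list)) \<and>
     (CHAR('f) \<notin> {2, 3} \<longrightarrow>
       HK_basis 2 (map h_cochain [V0, V1, V2, V3, V4, V5, V6] :: 'f cochain list)) \<and>
     (CHAR('f) = 2 \<longrightarrow>
       HK_basis 2 (map h_cochain [V0, V1, V2, V3, V4, V5, V6] @ [gamma4, gamma8, gamma16]
         :: 'f cochain list)) \<and>
     (CHAR('f) = 3 \<longrightarrow>
       HK_basis 2 (map h_cochain [V0, V1, V2, V3, V4, V5, V6] @ [gamma6] :: 'f cochain list))"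
proof (intro conjI impI)
  note combs = cochain_combs list.map append.simps
  show "HK_basis 0 (map central_cochain
      ([z0, z8, z12] @ map socle_elt [V0, V1, V2, V3, V4, V5, V6]) :: 'f cochain list)"
    \<comment> \<open>The certificate in degree zero has \<open>N = 1\<close>, so it applies over
      every field.\<close>
    using HK0_basis[OF gens0_ok(1) _ cert0_complete gens0_ok(2) cert0_ok, where ?'f = 'f]
    by (simp only: gens0_def combs of_int_1 one_neq_zero not_False_eq_True simp_thms)
  show "HK_basis 1 (map zeta [z0, z8, z12] :: 'f cochain list)" if char: "CHAR('f) \<notin> {2, 3}"
  proof -
    have "of_int 0 = (0 :: 'f)" "of_int 6 \<noteq> (0 :: 'f)"
      using char_neq_zero[OF char] mult_eq_0_iff[of "2 :: 'f" 3] by simp_all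
    from HK1_basis[OF gens1_ok(1) this cert1_complete gens1_ok(2) cert1_diff cert1_ok]
    show ?thesis by (simp only: gens1_def combs)
  qed
  show "HK_basis 1 (map zeta [z0, z8, z12] @ [rho3, rho7, rho15] :: 'f cochain list)" if char: "CHAR('f) = 2"
  proof -
    have "of_int 2 = (0 :: 'f)" "of_int 3 \<noteq> (0 :: 'f)" using char_numerals(1)[OF char] by simp_all
    from HK1_basis[OF gens1_char2_ok(1) this cert1_char2_complete gens1_char2_ok(2) cert1_char2_diff
        cert1_char2_ok]
    show ?thesis by (simp only: gens1_char2_def combs)
  qed
  show "HK_basis 1 (map zeta [z0, z8, z12] @ [rho5] :: 'f cochain list)" if char: "CHAR('f) = 3"
  proof -
    have "of_int 3 = (0 :: 'f)" "of_int 2 \<noteq> (0 :: 'f)" using char_numerals(2)[OF char] by simp_all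
    from HK1_basis[OF gens1_char3_ok(1) this cert1_char3_complete gens1_char3_ok(2) cert1_char3_diff
        cert1_char3_ok]
    show ?thesis by (simp only: gens1_char3_def combs)
  qed
  show "HK_basis 2 (map h_cochain [V0, V1, V2, V3, V4, V5, V6] :: 'f cochain list)"
    if char: "CHAR('f) \<notin> {2, 3}"
  proof -
    have "of_int 0 = (0 :: 'f)" "of_int 6 \<noteq> (0 :: 'f)"
      using char_neq_zero[OF char] mult_eq_0_iff[of "2 :: 'f" 3] by simp_all
    from HK2_basis[OF gens2_ok(1) this cert2_complete gens2_ok(2) cert2_diff cert2_ok]
    show ?thesis by (simp only: gens2_def combs)
  qed
  show "HK_basis 2 (map h_cochain [V0, V1, V2, V3, V4, V5, V6] @ [gamma4, gamma8, gamma16]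
      :: 'f cochain list)" if char: "CHAR('f) = 2"
  proof -
    have "of_int 2 = (0 :: 'f)" "of_int 3 \<noteq> (0 :: 'f)" using char_numerals(1)[OF char] by simp_all
    from HK2_basis[OF gens2_char2_ok(1) this cert2_char2_complete gens2_char2_ok(2) cert2_char2_diff
        cert2_char2_ok]
    show ?thesis by (simp only: gens2_char2_def combs)
  qed
  show "HK_basis 2 (map h_cochain [V0, V1, V2, V3, V4, V5, V6] @ [gamma6] :: 'f cochain list)"
    if char: "CHAR('f) = 3"
  proof -
    have "of_int 3 = (0 :: 'f)" "of_int 2 \<noteq> (0 :: 'f)" using char_numerals(2)[OF char] by simp_all
    from HK2_basis[OF gens2_char3_ok(1) this cert2_char3_complete gens2_char3_ok(2) cert2_char3_diff
        cert2_char3_ok]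
    show ?thesis by (simp only: gens2_char3_def combs)
  qed
qed

end
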